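(* Suppose that $\mathbf{n}\in\mathcal{A}\cap W^{1,\infty}(\Omega,M)$ is a weak local minimizer of $I$, and for $\mathbf{v}\in\mathrm{Var}_{\mathcal{A}}$ define $g(t)=I\big(P(\mathbf{n}+t\mathbf{v})\big)$ (for $|t|$ small). Then $$g'(0)=0\quad\text{and}\quad g''(0)\geqslant 0\qquad\text{for all }\mathbf{v}\in\mathrm{Var}_{\mathcal{A}}.$$
   Context: $\Omega\subset\mathbb{R}^d$ is a bounded Lipschitz domain whose boundary has two disjoint, relatively open, measurable components $\partial\Omega_1,\partial\Omega_2$ with $\partial\Omega=\overline{\partial\Omega_1}\cup\overline{\partial\Omega_2}$. $M\subset\mathbb{R}^k$ is a closed, bounded manifold of class $C^4$. There is an open set $U\supset M$ on which the nearest point projection $P:U\to M$ is uniquely defined and of class $C^3$. For $1\leqslant p\leqslant\infty$, $W^{1,p}(\Omega,M)=\{\mathbf{n}\in W^{1,p}(\Omega,\mathbb{R}^k): \mathbf{n}(x)\in M\text{ a.e.}\}$. Given $\mathbf{n}_0\in W^{1,1}(\Omega,M)$, the admissible set is $\mathcal{A}=\{\mathbf{n}\in W^{1,1}(\Omega,M):\mathbf{n}=\mathbf{n}_0\text{ on }\partial\Omega_1\}$, and $\mathrm{Var}_{\mathcal{A}}=\{\mathbf{v}\in C^\infty(\overline{\Omega},\mathbb{R}^k):\mathbf{v}=0\text{ on }\partial\Omega_1\}$. The functional is $I(\mathbf{n})=\int_\Omega F(x,\mathbf{n}(x),\nabla\mathbf{n}(x))\,dx$, where $F\in C(\overline{\Omega}\times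 M\times\mathbb{R}^{k\times d})$ and there is an open neighbourhood $O$ of $M$ (with $O\subset U$) such that $F(x,\cdot,\cdot)\in C^2(O\times\mathbb{R}^{k\times d})$ for every $x\in\Omega$. $\mathbf{n}\in\mathcal{A}$ is a weak local minimizer of $I$ if there is $\epsilon>0$ such that $I(\mathbf{m})\geqslant I(\mathbf{n})$ for all $\mathbf{m}\in\mathcal{A}$ with $\|\mathbf{n}-\mathbf{m}\|_{1,\infty}<\epsilon$, where $\|\cdot\|_{1,\infty}$ is the $W^{1,\infty}$ norm.
   Formalization: As stated g'(0) may fail to exist; shown here: g'(0)=0 and g''(0)≥0 whenever these derivatives exist, and both exist if the first and second derivatives of F in (n,∇n) are bounded on Ω×M×(bounded sets). *)

theory Defs
  imports "HOL-Analysis.Analysis" "HOL-Probability.Essential_Supremum"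
begin

subsection \<open>Functions of class $C^r$\<close>

text \<open>
  Meant for open \<open>S\<close> and finite-dimensional domains, where continuity of all iterated directional
  derivatives in fixed directions is continuity of the iterated Frechet derivatives. Recursing on
  directional derivatives keeps the type of the function unchanged.
\<close>

primrec Ck_on :: "nat \<Rightarrow> 'a::real_normed_vector set \<Rightarrow> ('a \<Rightarrow> 'b::real_normed_vector) \<Rightarrow> bool" where
  "Ck_on 0 S f \<longleftrightarrow> continuous_on S f"
| "Ck_on (Suc r) S f \<longleftrightarrow>
     (\<forall>x\<in>S. f differentiable (at x)) \<and> (\<forall>h. Ck_on r S (\<lambda>x. frechet_derivative f (at x) h))"

definition smooth_on :: "'a::real_normed_vector set \<Rightarrow> ('a \<Rightarrow> 'b::real_normed_vector) \<Rightarrow> bool" where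
  "smooth_on S f \<longleftrightarrow> (\<forall>r. Ck_on r S f)"

text \<open>$C^1(\overline\Omega)$ and $C^\infty(\overline\Omega)$: restrictions to the closure of functions
  that are regular on an open neighbourhood of it.\<close>

definition C1_closure :: "'a::real_normed_vector set \<Rightarrow> ('a \<Rightarrow> 'b::real_normed_vector) \<Rightarrow> bool" where
  "C1_closure \<Omega> f \<longleftrightarrow>
     (\<exists>V h. open V \<and> closure \<Omega> \<subseteq> V \<and> Ck_on 1 V h \<and> (\<forall>x\<in>closure \<Omega>. f x = h x))"

definition smooth_closure :: "'a::real_normed_vector set \<Rightarrow> ('a \<Rightarrow> 'b::real_normed_vector) \<Rightarrow> bool" where
  "smooth_closure \<Omega> f \<longleftrightarrow>
     (\<exists>V h. open V \<and> closure \<Omega> \<subseteq> V \<and> smooth_on V h \<and> (\<forall>x\<in>closure \<Omega>. f x = h x))"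

subsection \<open>Lipschitz domains, submanifolds, nearest point projections\<close>

text \<open>
  Near each boundary point, in rotated coordinates whose last axis is \<open>e\<close>, the set lies above the
  graph of a Lipschitz function of the remaining coordinates, that is, of a function \<open>\<gamma>\<close> that
  does not depend on the \<open>e\<close>-component of its argument.
\<close>

definition bounded_lipschitz_domain :: "'a::euclidean_space set \<Rightarrow> bool" where
  "bounded_lipschitz_domain \<Omega> \<longleftrightarrow>
     open \<Omega> \<and> connected \<Omega> \<and> \<Omega> \<noteq> {} \<and> bounded \<Omega> \<and>
     (\<forall>z\<in>frontier \<Omega>. \<exists>r>0. \<exists>e \<gamma> L. norm e = 1 \<and> L-lipschitz_on UNIV \<gamma> \<and>
        (\<forall>x s. \<gamma> (x + s *\<^sub>R e) = (\<gamma> x :: real)) \<and>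
        \<Omega> \<inter> ball z r = {x \<in> ball z r. \<gamma> x < x \<bullet> e})"

definition C_submanifold :: "nat \<Rightarrow> 'b::euclidean_space set \<Rightarrow> bool" where
  "C_submanifold r M \<longleftrightarrow>
     (\<exists>m. \<forall>p\<in>M. \<exists>V W (S :: 'b set) \<phi> \<psi>.
        open V \<and> p \<in> V \<and> open W \<and> subspace S \<and> dim S = m \<and>
        homeomorphism V W \<phi> \<psi> \<and> Ck_on r V \<phi> \<and> Ck_on r W \<psi> \<and> \<phi> ` (V \<inter> M) = W \<inter> S)"

definition nearest_point_projection :: "'b::metric_space set \<Rightarrow> 'b set \<Rightarrow> ('b \<Rightarrow> 'b) \<Rightarrow> bool" where
  "nearest_point_projection M U P \<longleftrightarrow>
     (\<forall>y\<in>U. P y \<in> M \<and> (\<forall>z\<in>M. z \<noteq> P y \<longrightarrow> dist y (P y) < dist y z))"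

subsection \<open>Hausdorff measure\<close>

text \<open>
  \<^const>\<open>outer_measure\<close> takes the infimum over disjoint countable covers; as the gauge is monotone,
  this agrees with the infimum over all countable covers. Sets of diameter greater than \<open>\<delta>\<close>
  are excluded by giving them infinite weight. For \<open>s = 0\<close> the convention \<open>0 ^ 0 = 1\<close> yields counting
  measure.
\<close>

definition hausdorff_gauge :: "nat \<Rightarrow> real \<Rightarrow> 'a::metric_space set \<Rightarrow> ennreal" where
  "hausdorff_gauge s \<delta> C =
     (if C = {} then 0
      else if bounded C \<and> diameter C \<le> \<delta> then ennreal (unit_ball_vol (real s) * (diameter C / 2) ^ s)
      else \<infinity>)"

definition hausdorff_outer :: "nat \<Rightarrow> 'a::metric_space set \<Rightarrow> ennreal" where
  "hausdorff_outer s A = (SUP \<delta>\<in>{0<..}. outer_measure UNIV (hausdorff_gauge s \<delta>) A)"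

definition hausdorff_measure :: "nat \<Rightarrow> 'a::metric_space measure" where
  "hausdorff_measure s =
     measure_of UNIV (lambda_system UNIV UNIV (hausdorff_outer s)) (hausdorff_outer s)"

lemma outer_measure_space_hausdorff_outer:
  "outer_measure_space UNIV (hausdorff_outer s :: 'a::metric_space set \<Rightarrow> ennreal)"
proof -
  interpret sigma_algebra "UNIV :: 'a set" UNIV
    using sigma_algebra_Pow[of "UNIV :: 'a set"] by simp
  have oms: "outer_measure_space UNIV (outer_measure UNIV (hausdorff_gauge s \<delta> :: 'a set \<Rightarrow> ennreal))"
    for \<delta> :: real
  proof -
    have "positive UNIV (hausdorff_gauge s \<delta> :: 'a set \<Rightarrow> ennreal)"
      by (simp add: positive_def hausdorff_gauge_def)
    moreover have "increasing UNIV (hausdorff_gauge s \<delta> :: 'a set \<Rightarrow> ennreal)"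
      unfolding increasing_def
    proof (intro ballI impI)
      fix A B :: "'a set" assume AB: "A \<subseteq> B"
      show "hausdorff_gauge s \<delta> A \<le> hausdorff_gauge s \<delta> B"
      proof (cases "A = {} \<or> \<not> (bounded B \<and> diameter B \<le> \<delta>)")
        case True
        then show ?thesis using AB by (auto simp: hausdorff_gauge_def)
      next
        case False
        then have "bounded A" "diameter A \<le> diameter B" "B \<noteq> {}" "0 \<le> diameter A"
          using AB bounded_subset[of B A] diameter_subset[of A B] diameter_ge_0[of A] by auto
        then show ?thesis using False
          by (auto simp: hausdorff_gauge_def intro!: ennreal_leI mult_left_mono power_mono)
      qed
    qed
    ultimately show ?thesis
      using outer_measure_space_outer_measure by simp
  qed
  show ?thesis
    unfolding outer_measure_space_def
  proof (intro conjI)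
    show "positive UNIV (hausdorff_outer s :: 'a set \<Rightarrow> ennreal)"
      using oms by (simp add: outer_measure_space_def positive_def hausdorff_outer_def)
    show "increasing UNIV (hausdorff_outer s :: 'a set \<Rightarrow> ennreal)"
      using oms unfolding outer_measure_space_def increasing_def hausdorff_outer_def
      by (auto intro!: SUP_mono)
    show "countably_subadditive UNIV (hausdorff_outer s :: 'a set \<Rightarrow> ennreal)"
      unfolding countably_subadditive_def
    proof (intro allI impI)
      fix A :: "nat \<Rightarrow> 'a set"
      assume dis: "disjoint_family A"
      show "hausdorff_outer s (\<Union>i. A i) \<le> (\<Sum>i. hausdorff_outer s (A i))"
        unfolding hausdorff_outer_def[of s "\<Union>i. A i"]
      proof (rule SUP_least)
        fix \<delta> :: real assume \<delta>: "\<delta> \<in> {0<..}"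
        have "outer_measure UNIV (hausdorff_gauge s \<delta>) (\<Union>i. A i)
            \<le> (\<Sum>i. outer_measure UNIV (hausdorff_gauge s \<delta>) (A i))"
          using oms[of \<delta>] dis by (auto simp: outer_measure_space_def countably_subadditive_def)
        also have "\<dots> \<le> (\<Sum>i. hausdorff_outer s (A i))"
          using \<delta> unfolding hausdorff_outer_def by (intro suminf_le SUP_upper) auto
        finally show "outer_measure UNIV (hausdorff_gauge s \<delta>) (\<Union>i. A i)
            \<le> (\<Sum>i. hausdorff_outer s (A i))" .
      qed
    qed
  qed
qed

lemma hausdorff_measure_space:
  "measure_space UNIV (lambda_system UNIV UNIV (hausdorff_outer s))
     (hausdorff_outer s :: 'a::metric_space set \<Rightarrow> ennreal)"
proof -
  interpret sigma_algebra "UNIV :: 'a set" UNIV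
    using sigma_algebra_Pow[of "UNIV :: 'a set"] by simp
  show ?thesis
    by (rule caratheodory_lemma[OF outer_measure_space_hausdorff_outer])
qed

lemma sets_hausdorff_measure:
  "sets (hausdorff_measure s :: 'a::metric_space measure)
     = lambda_system UNIV UNIV (hausdorff_outer s)"
  using hausdorff_measure_space[where 'a = 'a and s = s]
  unfolding hausdorff_measure_def measure_space_def
  by (intro sigma_algebra.sets_measure_of_eq) simp

lemma emeasure_hausdorff_measure:
  fixes A :: "'a::metric_space set"
  assumes "A \<in> sets (hausdorff_measure s)"
  shows "emeasure (hausdorff_measure s) A = hausdorff_outer s A"
  using hausdorff_measure_space[where 'a = 'a and s = s] assms
  unfolding sets_hausdorff_measure
  unfolding hausdorff_measure_def measure_space_def
  by (intro emeasure_measure_of_sigma) auto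

abbreviation surface_measure :: "(real^'d) measure" where
  "surface_measure \<equiv> hausdorff_measure (CARD('d) - 1)"

subsection \<open>Sobolev spaces\<close>

definition test_function :: "'a::euclidean_space set \<Rightarrow> ('a \<Rightarrow> real) \<Rightarrow> bool" where
  "test_function \<Omega> \<phi> \<longleftrightarrow>
     smooth_on UNIV \<phi> \<and> compact (closure {x. \<phi> x \<noteq> 0}) \<and> closure {x. \<phi> x \<noteq> 0} \<subseteq> \<Omega>"

definition locally_integrable ::
  "'a::euclidean_space set \<Rightarrow> ('a \<Rightarrow> 'b::{banach, second_countable_topology}) \<Rightarrow> bool" where
  "locally_integrable \<Omega> u \<longleftrightarrow> (\<forall>K. compact K \<and> K \<subseteq> \<Omega> \<longrightarrow> integrable (lebesgue_on K) u)"

text \<open>The entry \<open>G x $ i $ j\<close> is the \<open>j\<close>-th partial derivative of the \<open>i\<close>-th component of \<open>u\<close>.\<close>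

definition has_weak_gradient ::
  "(real^'d) set \<Rightarrow> (real^'d \<Rightarrow> real^'k) \<Rightarrow> (real^'d \<Rightarrow> real^'d^'k) \<Rightarrow> bool" where
  "has_weak_gradient \<Omega> u G \<longleftrightarrow>
     locally_integrable \<Omega> u \<and> locally_integrable \<Omega> G \<and>
     (\<forall>\<phi> i j. test_function \<Omega> \<phi> \<longrightarrow>
        (\<integral>x. u x $ i * frechet_derivative \<phi> (at x) (axis j 1) \<partial>lebesgue_on \<Omega>)
          = - (\<integral>x. G x $ i $ j * \<phi> x \<partial>lebesgue_on \<Omega>))"

text \<open>Well defined up to null sets, when a weak gradient exists.\<close>

definition weak_gradient :: "(real^'d) set \<Rightarrow> (real^'d \<Rightarrow> real^'k) \<Rightarrow> real^'d \<Rightarrow> real^'d^'k" where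
  "weak_gradient \<Omega> u = (SOME G. has_weak_gradient \<Omega> u G)"

definition Lp_norm :: "'a measure \<Rightarrow> ennreal \<Rightarrow> ('a \<Rightarrow> 'b::real_normed_vector) \<Rightarrow> ennreal" where
  "Lp_norm N p u =
     (if p = \<infinity> then esssup N (\<lambda>x. ennreal (norm (u x)))
      else let J = (\<integral>\<^sup>+x. ennreal (norm (u x) powr enn2real p) \<partial>N)
           in if J = \<infinity> then \<infinity> else ennreal (enn2real J powr (1 / enn2real p)))"

definition sobolev :: "(real^'d) set \<Rightarrow> ennreal \<Rightarrow> (real^'d \<Rightarrow> real^'k) set" where
  "sobolev \<Omega> p =
     {u. u \<in> borel_measurable (lebesgue_on \<Omega>) \<and> Lp_norm (lebesgue_on \<Omega>) p u < \<infinity> \<and>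
         (\<exists>G \<in> borel_measurable (lebesgue_on \<Omega>).
            has_weak_gradient \<Omega> u G \<and> Lp_norm (lebesgue_on \<Omega>) p G < \<infinity>)}"

text \<open>Meaningful for functions that possess a weak gradient on \<open>\<Omega>\<close>.\<close>

definition sobolev_norm :: "(real^'d) set \<Rightarrow> ennreal \<Rightarrow> (real^'d \<Rightarrow> real^'k) \<Rightarrow> ennreal" where
  "sobolev_norm \<Omega> p u =
     Lp_norm (lebesgue_on \<Omega>) p u + Lp_norm (lebesgue_on \<Omega>) p (weak_gradient \<Omega> u)"

definition sobolev_into ::
  "(real^'d) set \<Rightarrow> ennreal \<Rightarrow> (real^'k) set \<Rightarrow> (real^'d \<Rightarrow> real^'k) set" where
  "sobolev_into \<Omega> p M = {u \<in> sobolev \<Omega> p. AE x in lebesgue_on \<Omega>. u x \<in> M}"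

text \<open>
  Boundary values on \<open>\<Gamma> \<subseteq> frontier \<Omega>\<close> of \<open>u\<close> in $W^{1,1}$: the trace is the continuous extension to
  $W^{1,1}$, with values in $L^1$ of the boundary, of the restriction map of $C^1(\overline\Omega)$.
\<close>

definition has_trace_on ::
  "(real^'d) set \<Rightarrow> (real^'d) set \<Rightarrow> (real^'d \<Rightarrow> real^'k) \<Rightarrow> (real^'d \<Rightarrow> real^'k) \<Rightarrow> bool" where
  "has_trace_on \<Omega> \<Gamma> u w \<longleftrightarrow>
     set_integrable surface_measure \<Gamma> w \<and>
     (\<exists>\<phi> :: nat \<Rightarrow> real^'d \<Rightarrow> real^'k.
        (\<forall>j. C1_closure \<Omega> (\<phi> j)) \<and>
        (\<lambda>j. sobolev_norm \<Omega> 1 (\<lambda>x. \<phi> j x - u x)) \<longlonglongrightarrow> 0 \<and>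
        (\<lambda>j. \<integral>\<^sup>+x\<in>\<Gamma>. ennreal (norm (\<phi> j x - w x)) \<partial>surface_measure) \<longlonglongrightarrow> 0)"

definition same_trace_on ::
  "(real^'d) set \<Rightarrow> (real^'d) set \<Rightarrow> (real^'d \<Rightarrow> real^'k) \<Rightarrow> (real^'d \<Rightarrow> real^'k) \<Rightarrow> bool" where
  "same_trace_on \<Omega> \<Gamma> u u' \<longleftrightarrow> (\<exists>w. has_trace_on \<Omega> \<Gamma> u w \<and> has_trace_on \<Omega> \<Gamma> u' w)"

subsection \<open>The variational problem\<close>

definition admissible ::
  "(real^'d) set \<Rightarrow> (real^'d) set \<Rightarrow> (real^'k) set \<Rightarrow> (real^'d \<Rightarrow> real^'k) \<Rightarrow> (real^'d \<Rightarrow> real^'k) set" where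
  "admissible \<Omega> \<Gamma> M n0 = {n \<in> sobolev_into \<Omega> 1 M. same_trace_on \<Omega> \<Gamma> n n0}"

definition variations :: "(real^'d) set \<Rightarrow> (real^'d) set \<Rightarrow> (real^'d \<Rightarrow> real^'k) set" where
  "variations \<Omega> \<Gamma> = {v. smooth_closure \<Omega> v \<and> (\<forall>x\<in>\<Gamma>. v x = 0)}"

definition energy ::
  "(real^'d) set \<Rightarrow> (real^'d \<Rightarrow> real^'k \<Rightarrow> real^'d^'k \<Rightarrow> real) \<Rightarrow> (real^'d \<Rightarrow> real^'k) \<Rightarrow> real" where
  "energy \<Omega> F n = (\<integral>x. F x (n x) (weak_gradient \<Omega> n x) \<partial>lebesgue_on \<Omega>)"

definition weak_local_minimizer ::
  "(real^'d) set \<Rightarrow> (real^'d \<Rightarrow> real^'k \<Rightarrow> real^'d^'k \<Rightarrow> real) \<Rightarrow> (real^'d \<Rightarrow> real^'k) set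
     \<Rightarrow> (real^'d \<Rightarrow> real^'k) \<Rightarrow> bool" where
  "weak_local_minimizer \<Omega> F A n \<longleftrightarrow>
     n \<in> A \<and> (\<exists>\<epsilon>>0. \<forall>m\<in>A. sobolev_norm \<Omega> \<infinity> (\<lambda>x. n x - m x) < ennreal \<epsilon> \<longrightarrow>
                  energy \<Omega> F n \<le> energy \<Omega> F m)"

text \<open>
  Continuity of \<open>F\<close> on $\overline\Omega\times M\times\mathbb{R}^{k\times d}$ and $C^2$ regularity of
  \<open>F x\<close> for each single \<open>x\<close> do not make \<open>t \<mapsto> energy \<Omega> F (P \<circ> (n + t v))\<close> differentiable at \<open>0\<close>:
  for \<open>\<Omega> = (0, 1)\<close>, \<open>M\<close> the unit circle, and
  \<open>F x y A = (exp (- 2 / (1 - x)) + norm A ^ 2) powr (1 / 4)\<close> (with \<open>exp\<close> term \<open>0\<close> at \<open>x = 1\<close>), every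
  constant map minimizes the energy, but the map in question has infinite slope at \<open>0\<close> for suitable \<open>v\<close>.
  Differentiation under the integral is licensed by the following bound, which holds whenever the
  derivatives of order at most two in \<open>(y, A)\<close> are jointly continuous up to the closure of \<open>\<Omega>\<close>.
\<close>

definition locally_bounded_derivatives ::
  "(real^'d) set \<Rightarrow> (real^'k) set \<Rightarrow> (real^'d \<Rightarrow> real^'k \<Rightarrow> real^'d^'k \<Rightarrow> real) \<Rightarrow> bool" where
  "locally_bounded_derivatives \<Omega> M F \<longleftrightarrow>
     (\<forall>R. \<exists>C. \<forall>x\<in>\<Omega>. \<forall>y\<in>M. \<forall>A. norm A \<le> R \<longrightarrow> (\<forall>h h'.
        \<bar>frechet_derivative (case_prod (F x)) (at (y, A)) h\<bar> \<le> C * norm h \<and>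
        \<bar>frechet_derivative (\<lambda>z. frechet_derivative (case_prod (F x)) (at z) h) (at (y, A)) h'\<bar>
          \<le> C * norm h * norm h'))"

end

theory Submission
  imports Defs
begin

text \<open>
  The function \<open>g\<close> has a local minimum at \<open>0\<close>, and the claims about its derivatives at \<open>0\<close> are then
  calculus of one variable. For small \<open>t\<close> the map \<open>P(n + t v)\<close> has values in \<open>M\<close> almost everywhere;
  what has to be shown is that it is an admissible competitor and that it is close to \<open>n\<close> in
  $W^{1,\infty}$.

  For admissibility one needs a chain rule for weak gradients and the trace of \<open>P(n + t v)\<close> on \<open>\<Gamma>1\<close>.
  Both come from the $C^1$ functions \<open>\<phi>\<^sub>j\<close> that approximate \<open>n\<close> in the definition of its trace. These
  need not take values near \<open>M\<close>, so \<open>P\<close> is first replaced by a map \<open>Q\<close> of class $C^3$ with compact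
  support that agrees with \<open>P\<close> near \<open>M\<close> (\<open>Ck_on_compact_support_extension\<close>). As \<open>DQ\<close> is bounded
  and Lipschitz and the gradient of \<open>n\<close> is bounded, compositions of the approximations with \<open>Q\<close>
  converge in $W^{1,1}$ (\<open>C1_approx_compose\<close>). The functions \<open>\<phi>\<^sub>j + Q(\<phi>\<^sub>j + t v) - Q(\<phi>\<^sub>j)\<close> converge to
  \<open>P(n + t v)\<close> and agree with \<open>\<phi>\<^sub>j\<close> on \<open>\<Gamma>1\<close>, where \<open>v\<close> vanishes; therefore the trace is unchanged
  (\<open>projected_variation_trace_and_gradient\<close>).

  Weak gradients are unique almost everywhere by the fundamental lemma of the calculus of variations,
  for which smooth bump functions on boxes are constructed. Hence \<open>P(n) = n\<close> gives
  \<open>DP(n) \<nabla>n = \<nabla>n\<close>, and the gradients of \<open>n\<close> and \<open>P(n + t v)\<close> differ by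
  \<open>(DP(n) - DP(n + t v)) \<nabla>n - t DP(n + t v) \<nabla>v\<close>, which is bounded by a multiple of \<open>\<bar>t\<bar>\<close>.

  Under \<open>locally_bounded_derivatives\<close> the integrand of \<open>g t\<close> is, at almost every point of \<open>\<Omega>\<close>, twice
  differentiable in \<open>t\<close> with bounds independent of the point (\<open>C2_family_chain_rule_curve\<close>,
  \<open>C2_family_integrand\<close>), and dominated convergence, used twice, shows that \<open>g\<close> is twice
  differentiable (\<open>C2_family_integral_twice_differentiable\<close>).
\<close>

section \<open>Calculus of functions of class $C^r$\<close>

lemma Ck_on_continuous_on:
  assumes "Ck_on r S f"
  shows "continuous_on S f"
proof (cases r)
  case 0 then show ?thesis using assms by simp
next
  case (Suc m)
  then show ?thesis using assms
    by (auto intro!: continuous_at_imp_continuous_on differentiable_imp_continuous_within)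
qed

lemma Ck_on_Suc_imp: "Ck_on (Suc r) S f \<Longrightarrow> Ck_on r S f"
proof (induction r arbitrary: f)
  case 0 then show ?case using Ck_on_continuous_on by fastforce
next
  case (Suc r) then show ?case by (metis Ck_on.simps(2))
qed

lemma Ck_on_le: "Ck_on s S f \<Longrightarrow> r \<le> s \<Longrightarrow> Ck_on r S f"
  by (induction s) (auto simp: le_Suc_eq dest: Ck_on_Suc_imp simp del: Ck_on.simps(2))

lemma Ck_on_subset: "Ck_on r S f \<Longrightarrow> T \<subseteq> S \<Longrightarrow> Ck_on r T f"
  by (induction r arbitrary: f) (auto intro: continuous_on_subset)

lemma has_derivative_cong_open:
  assumes "open S" "x \<in> S" "\<And>y. y \<in> S \<Longrightarrow> f y = g y"
  shows "(f has_derivative D) (at x) \<longleftrightarrow> (g has_derivative D) (at x)"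
  using assms has_derivative_transform_within_open by metis

lemma frechet_derivative_cong_open:
  assumes "open S" "x \<in> S" "\<And>y. y \<in> S \<Longrightarrow> f y = g y"
  shows "frechet_derivative f (at x) = frechet_derivative g (at x)"
  using has_derivative_cong_open[OF assms] by (simp add: frechet_derivative_def)

lemma differentiable_cong_open:
  assumes "open S" "x \<in> S" "\<And>y. y \<in> S \<Longrightarrow> f y = g y"
  shows "f differentiable (at x) \<longleftrightarrow> g differentiable (at x)"
  using has_derivative_cong_open[OF assms] by (simp add: differentiable_def)

lemma Ck_on_cong:
  assumes "open S" "\<And>y. y \<in> S \<Longrightarrow> f y = g y"
  shows "Ck_on r S f \<longleftrightarrow> Ck_on r S g"
  using assms(2)
proof (induction r arbitrary: f g)
  case 0 then show ?case by (simp cong: continuous_on_cong)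
next
  case (Suc r)
  have "Ck_on r S (\<lambda>x. frechet_derivative f (at x) h) \<longleftrightarrow> Ck_on r S (\<lambda>x. frechet_derivative g (at x) h)" for h
    by (rule Suc.IH) (simp add: frechet_derivative_cong_open[OF assms(1) _ Suc.prems])
  moreover have "(\<forall>x\<in>S. f differentiable (at x)) \<longleftrightarrow> (\<forall>x\<in>S. g differentiable (at x))"
    by (intro ball_cong refl differentiable_cong_open[OF assms(1) _ Suc.prems])
  ultimately show ?case by simp
qed

text \<open>
  All closure properties below are inductions on \<open>r\<close> through this rule: exhibiting some derivative
  \<open>D\<close> is easier than computing \<open>frechet_derivative\<close>.
\<close>

lemma Ck_on_SucI:
  assumes "open S" "\<And>x. x \<in> S \<Longrightarrow> (f has_derivative D x) (at x)" "\<And>h. Ck_on r S (\<lambda>x. D x h)"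
  shows "Ck_on (Suc r) S f"
proof -
  have "frechet_derivative f (at x) = D x" if "x \<in> S" for x
    using frechet_derivative_at[OF assms(2)[OF that]] by simp
  then have "Ck_on r S (\<lambda>x. frechet_derivative f (at x) h) \<longleftrightarrow> Ck_on r S (\<lambda>x. D x h)" for h
    by (intro Ck_on_cong assms) simp
  then show ?thesis using assms by (auto simp: differentiable_def)
qed

lemma Ck_on_SucD:
  assumes "Ck_on (Suc r) S f"
  shows "x \<in> S \<Longrightarrow> (f has_derivative frechet_derivative f (at x)) (at x)"
    and "Ck_on r S (\<lambda>x. frechet_derivative f (at x) h)"
  using assms by (auto simp: frechet_derivative_works[symmetric])

lemma Ck_on_Un:
  assumes "open S" "open T" "Ck_on r S f" "Ck_on r T f"
  shows "Ck_on r (S \<union> T) f"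
  using assms(3,4)
  by (induction r arbitrary: f) (auto intro: continuous_on_open_Un assms)

lemma Ck_on_const: "Ck_on r S (\<lambda>x. c)"
  by (induction r arbitrary: c) (auto simp: frechet_derivative_const)

lemma Ck_on_add:
  assumes "open S" "Ck_on r S f" "Ck_on r S g"
  shows "Ck_on r S (\<lambda>x. f x + g x)"
  using assms(2,3)
proof (induction r arbitrary: f g)
  case 0 then show ?case by (auto intro: continuous_on_add)
next
  case (Suc r)
  show ?case
    by (rule Ck_on_SucI[OF assms(1)])
      (auto intro!: has_derivative_add Suc.IH Ck_on_SucD[OF Suc.prems(1)] Ck_on_SucD[OF Suc.prems(2)])
qed

lemma Ck_on_scaleR:
  fixes f :: "'a::real_normed_vector \<Rightarrow> real"
  assumes "open S" "Ck_on r S f" "Ck_on r S g"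
  shows "Ck_on r S (\<lambda>x. f x *\<^sub>R g x)"
  using assms(2,3)
proof (induction r arbitrary: f g)
  case 0 then show ?case by (auto intro: continuous_on_scaleR)
next
  case (Suc r)
  note D = Ck_on_SucD[OF Suc.prems(1)] Ck_on_SucD[OF Suc.prems(2)]
    Ck_on_Suc_imp[OF Suc.prems(1)] Ck_on_Suc_imp[OF Suc.prems(2)]
  show ?case
  proof (rule Ck_on_SucI[OF assms(1)])
    show "((\<lambda>x. f x *\<^sub>R g x) has_derivative
        (\<lambda>h. f x *\<^sub>R frechet_derivative g (at x) h + frechet_derivative f (at x) h *\<^sub>R g x)) (at x)"
      if "x \<in> S" for x using that by (intro has_derivative_scaleR D)
    show "Ck_on r S (\<lambda>x. f x *\<^sub>R frechet_derivative g (at x) h + frechet_derivative f (at x) h *\<^sub>R g x)" for h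
      by (intro Ck_on_add assms(1) Suc.IH D)
  qed
qed

lemma Ck_on_mult:
  fixes f g :: "'a::real_normed_vector \<Rightarrow> real"
  assumes "open S" "Ck_on r S f" "Ck_on r S g"
  shows "Ck_on r S (\<lambda>x. f x * g x)"
  using Ck_on_scaleR[OF assms] by simp

lemma Ck_on_linear:
  assumes "bounded_linear f"
  shows "Ck_on r S f"
proof -
  have "Ck_on r UNIV f"
  proof (cases r)
    case 0 then show ?thesis using assms by (simp add: linear_continuous_on)
  next
    case (Suc m)
    then show ?thesis
      by (auto intro!: Ck_on_SucI bounded_linear_imp_has_derivative assms Ck_on_const simp del: Ck_on.simps)
  qed
  then show ?thesis by (rule Ck_on_subset) simp
qed

lemma Ck_on_bounded_linear_compose:
  assumes "open S" "bounded_linear L" "Ck_on r S f"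
  shows "Ck_on r S (\<lambda>x. L (f x))"
  using assms(3)
proof (induction r arbitrary: f)
  case 0 then show ?case using assms(2) by (auto intro: bounded_linear.continuous_on)
next
  case (Suc r)
  show ?case
    by (rule Ck_on_SucI[OF assms(1)])
      (auto intro!: bounded_linear.has_derivative[OF assms(2)] Suc.IH Ck_on_SucD[OF Suc.prems])
qed

lemma Ck_on_minus: "open S \<Longrightarrow> Ck_on r S f \<Longrightarrow> Ck_on r S (\<lambda>x. - f x)"
  by (rule Ck_on_bounded_linear_compose[OF _ bounded_linear_minus[OF bounded_linear_ident]])

lemma Ck_on_diff: "open S \<Longrightarrow> Ck_on r S f \<Longrightarrow> Ck_on r S g \<Longrightarrow> Ck_on r S (\<lambda>x. f x - g x)"
  using Ck_on_add[OF _ _ Ck_on_minus] by fastforce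

lemma Ck_on_sum:
  assumes "open S" "\<And>i. i \<in> I \<Longrightarrow> Ck_on r S (f i)"
  shows "Ck_on r S (\<lambda>x. \<Sum>i\<in>I. f i x)"
  using assms(2)
  by (induction I rule: infinite_finite_induct) (auto intro!: Ck_on_add[OF assms(1)] Ck_on_const)

lemma Ck_on_prod:
  fixes f :: "'i \<Rightarrow> 'a::real_normed_vector \<Rightarrow> real"
  assumes "open S" "\<And>i. i \<in> I \<Longrightarrow> Ck_on r S (f i)"
  shows "Ck_on r S (\<lambda>x. \<Prod>i\<in>I. f i x)"
  using assms(2)
  by (induction I rule: infinite_finite_induct) (auto intro!: Ck_on_mult[OF assms(1)] Ck_on_const)

section \<open>Bump functions\<close>

text \<open>
  Smooth functions that vanish to infinite order at \<open>0\<close>. The polynomial factor makes the family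
  closed under differentiation; the classical bump profile is \<open>flat 1\<close>.
\<close>

definition flat :: "real poly \<Rightarrow> real \<Rightarrow> real" where
  "flat p x = (if x > 0 then poly p (1 / x) * exp (- 1 / x) else 0)"

lemma poly_exp_tendsto_0: "((\<lambda>y. poly p y * exp (- y)) \<longlongrightarrow> (0::real)) at_top"
proof -
  have "((\<lambda>y::real. \<Sum>i\<le>degree p. coeff p i * (y ^ i / exp y)) \<longlongrightarrow> (\<Sum>i\<le>degree p. coeff p i * 0)) at_top"
    by (intro tendsto_intros tendsto_power_div_exp_0)
  then show ?thesis
    by (simp add: poly_altdef exp_minus field_simps sum_divide_distrib)
qed

lemma flat_tendsto_0: "(flat p \<longlongrightarrow> 0) (at 0)"
proof -
  have "((\<lambda>x. poly p (1/x) * exp (- (1/x))) \<longlongrightarrow> 0) (at_right (0::real))"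
    using filterlim_compose[OF poly_exp_tendsto_0[of p] filterlim_inverse_at_top_right]
    by (simp add: inverse_eq_divide)
  then have "(flat p \<longlongrightarrow> 0) (at_right 0)"
    by (rule Lim_transform_eventually) (auto simp: eventually_at_filter flat_def)
  moreover have "(flat p \<longlongrightarrow> 0) (at_left 0)"
    by (rule Lim_transform_eventually[OF tendsto_const]) (auto simp: eventually_at_filter flat_def)
  ultimately show ?thesis using filterlim_split_at by blast
qed

text \<open>
  For \<open>x > 0\<close> differentiation turns \<open>p(1/x) exp(-1/x)\<close> into \<open>(1/x)\<^sup>2 (p - p')(1/x) exp(-1/x)\<close>. At \<open>0\<close>
  the difference quotient is \<open>flat\<close> of the polynomial \<open>X p\<close>, which tends to \<open>0\<close>.
\<close>

lemma flat_has_derivative: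
  "(flat p has_real_derivative flat ([:0, 0, 1:] * (p - pderiv p)) x) (at x)"
proof -
  consider "x > 0" | "x < 0" | "x = 0" by linarith
  then show ?thesis
  proof cases
    case 1
    have "((\<lambda>x. poly p (1 / x) * exp (- 1 / x)) has_real_derivative flat ([:0, 0, 1:] * (p - pderiv p)) x) (at x)"
      using 1 by (auto intro!: derivative_eq_intros simp: flat_def field_simps power2_eq_square)
    then show ?thesis
      by (rule DERIV_cong_ev[THEN iffD1, rotated -1])
        (use 1 in \<open>auto simp: flat_def intro!: eventually_mono[OF eventually_nhds_in_open[of "{0<..}" x]]\<close>)
  next
    case 2
    have "((\<lambda>x. 0) has_real_derivative flat ([:0, 0, 1:] * (p - pderiv p)) x) (at x)"
      using 2 by (simp add: flat_def)
    then show ?thesis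
      by (rule DERIV_cong_ev[THEN iffD1, rotated -1])
        (use 2 in \<open>auto simp: flat_def intro!: eventually_mono[OF eventually_nhds_in_open[of "{..<0}" x]]\<close>)
  next
    case 3
    have "((\<lambda>h. (flat p (0 + h) - flat p 0) / h) \<longlongrightarrow> 0) (at 0)"
      by (rule Lim_transform_eventually[OF flat_tendsto_0[of "[:0, 1:] * p"]])
        (auto simp: eventually_at_filter flat_def field_simps)
    then show ?thesis using 3 by (simp add: DERIV_def flat_def)
  qed
qed

lemma Ck_on_flat_compose:
  fixes s :: "'a::real_normed_vector \<Rightarrow> real"
  assumes "open S" "Ck_on r S s"
  shows "Ck_on r S (\<lambda>x. flat p (s x))"
  using assms(2)
proof (induction r arbitrary: p)
  case 0
  have "continuous_on UNIV (flat p)"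
    by (auto intro!: continuous_at_imp_continuous_on DERIV_isCont[OF flat_has_derivative])
  then show ?case using 0 by (auto intro: continuous_on_compose2)
next
  case (Suc r)
  let ?q = "[:0, 0, 1:] * (p - pderiv p)"
  show ?case
  proof (rule Ck_on_SucI[OF assms(1)])
    show "((\<lambda>x. flat p (s x)) has_derivative (\<lambda>h. flat ?q (s x) * frechet_derivative s (at x) h)) (at x)"
      if "x \<in> S" for x
      by (rule has_derivative_compose[OF Ck_on_SucD(1)[OF Suc.prems that]
            flat_has_derivative[unfolded has_field_derivative_def]])
    show "Ck_on r S (\<lambda>x. flat ?q (s x) * frechet_derivative s (at x) h)" for h
      by (intro Ck_on_mult assms(1) Suc.IH Ck_on_Suc_imp[OF Suc.prems] Ck_on_SucD(2)[OF Suc.prems])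
  qed
qed

text \<open>
  For \<open>m > 0\<close> positive exactly on the open box between \<open>a\<close> and \<open>b\<close>. The parameter \<open>m\<close> steepens the walls: as
  \<open>m\<close> grows the function tends to the indicator of the box, because \<open>exp(-1/(m s))\<close> tends to \<open>1\<close>
  for \<open>s > 0\<close>. This is what lets test functions detect integrals over boxes.
\<close>

definition box_bump :: "real \<Rightarrow> 'a::euclidean_space \<Rightarrow> 'a \<Rightarrow> 'a \<Rightarrow> real" where
  "box_bump m a b x = (\<Prod>i\<in>Basis. flat 1 (m * (x \<bullet> i - a \<bullet> i)) * flat 1 (m * (b \<bullet> i - x \<bullet> i)))"

lemma Ck_on_box_bump: "Ck_on r UNIV (box_bump m a b)"
  unfolding box_bump_def[abs_def]
  by (intro Ck_on_prod Ck_on_mult Ck_on_flat_compose Ck_on_diff Ck_on_const Ck_on_linear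
      bounded_linear_inner_left open_UNIV)


lemma flat_one: "flat 1 x = (if x > 0 then exp (- 1 / x) else 0)"
  by (simp add: flat_def)

lemma flat_one_bounds: "0 \<le> flat 1 x" "flat 1 x \<le> 1"
  by (auto simp: flat_one)

lemma flat_one_pos_iff: "0 < flat 1 x \<longleftrightarrow> 0 < x"
  by (auto simp: flat_one)

lemma box_bump_bounds: "0 \<le> box_bump m a b x" "box_bump m a b x \<le> 1"
  unfolding box_bump_def
  by (auto intro!: prod_nonneg prod_le_1 mult_le_one mult_nonneg_nonneg simp: flat_one_bounds)

lemma box_bump_pos: "0 < m \<Longrightarrow> x \<in> box a b \<Longrightarrow> 0 < box_bump m a b x"
  unfolding box_bump_def by (auto intro!: prod_pos mult_pos_pos simp: flat_one_pos_iff mem_box)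

lemma box_bump_eq_0: "0 < m \<Longrightarrow> x \<notin> box a b \<Longrightarrow> box_bump m a b x = 0"
  unfolding box_bump_def
  by (auto simp: mem_box prod_zero_iff flat_one not_less zero_less_mult_iff intro: bexI[rotated])

lemma box_bump_tendsto_indicator:
  "(\<lambda>n. box_bump (real (Suc n)) a b x) \<longlonglongrightarrow> indicator (box a b) x"
proof (cases "x \<in> box a b")
  case True
  have lim: "(\<lambda>n. flat 1 (real (Suc n) * y)) \<longlonglongrightarrow> 1" if "y > 0" for y
  proof -
    have "(\<lambda>n. exp (- (inverse y * inverse (real (Suc n))))) \<longlonglongrightarrow> exp (- (inverse y * 0))"
      by (intro tendsto_intros LIMSEQ_inverse_real_of_nat)
    then show ?thesis using that
      by (simp add: flat_one zero_less_mult_iff) (simp add: field_simps add_pos_nonneg)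
  qed
  have "(\<lambda>n. box_bump (real (Suc n)) a b x) \<longlonglongrightarrow> (\<Prod>i\<in>(Basis::'a set). 1 * 1)"
    unfolding box_bump_def using True by (intro tendsto_prod tendsto_mult lim) (auto simp: mem_box)
  then show ?thesis using True by simp
next
  case False
  then show ?thesis by (simp add: box_bump_eq_0)
qed

lemma test_function_box_bump:
  assumes "0 < m" "cbox a b \<subseteq> \<Omega>"
  shows "test_function \<Omega> (box_bump m a b)"
proof -
  have "closure {x. box_bump m a b x \<noteq> 0} \<subseteq> cbox a b"
    using assms(1) box_bump_eq_0 box_subset_cbox by (intro closure_minimal) fastforce+
  moreover from this have "compact (closure {x. box_bump m a b x \<noteq> 0})"
    using bounded_subset[OF bounded_cbox] compact_eq_bounded_closed by blast
  ultimately show ?thesis using assms(2)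
    unfolding test_function_def smooth_on_def by (blast intro: Ck_on_box_bump)
qed

text \<open>
  A sum \<open>s\<close> of bumps on finitely many boxes covering \<open>K\<close> is at least some \<open>c > 0\<close> on \<open>K\<close>. Composing
  it with a profile that is \<open>0\<close> at \<open>0\<close> and \<open>1\<close> from \<open>c/2\<close> on gives the cutoff.
\<close>

lemma smooth_cutoff_exists:
  fixes K :: "'a::euclidean_space set"
  assumes "compact K" "open U" "K \<subseteq> U"
  obtains \<eta> :: "'a \<Rightarrow> real" and W C where "\<And>r. Ck_on r UNIV \<eta>" "open W" "K \<subseteq> W"
    "\<And>x. x \<in> W \<Longrightarrow> \<eta> x = 1" "compact C" "C \<subseteq> U" "\<And>x. x \<notin> C \<Longrightarrow> \<eta> x = 0"
proof (cases "K = {}")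
  case True
  show ?thesis by (rule that[of "\<lambda>x. 0" "{}" "{}"]) (auto simp: True Ck_on_const)
next
  case False
  have "\<exists>a b. p \<in> box a b \<and> cbox a b \<subseteq> U" if "p \<in> K" for p
  proof -
    have "p \<in> U" using that assms(3) by auto
    from open_contains_cbox[OF assms(2) this] show ?thesis by metis
  qed
  then obtain a b where ab: "\<And>p. p \<in> K \<Longrightarrow> p \<in> box (a p) (b p)" "\<And>p. p \<in> K \<Longrightarrow> cbox (a p) (b p) \<subseteq> U"
    by metis
  obtain D where D: "D \<subseteq> K" "finite D" "K \<subseteq> (\<Union>p\<in>D. box (a p) (b p))"
    by (rule compactE_image[OF assms(1), of K "\<lambda>p. box (a p) (b p)"]) (use ab in auto)
  \<comment> \<open>Positive on \<open>K\<close> by the covering property, zero off the closed boxes.\<close>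
  define s where "s x = (\<Sum>p\<in>D. box_bump 1 (a p) (b p) x)" for x
  have Cs: "Ck_on r UNIV s" for r
    unfolding s_def[abs_def] by (intro Ck_on_sum Ck_on_box_bump open_UNIV)
  have contS: "continuous_on T s" for T
    using Ck_on_continuous_on[OF Cs] continuous_on_subset by blast
  have "0 < s x" if x: "x \<in> K" for x
  proof -
    obtain p where "p \<in> D" "x \<in> box (a p) (b p)" using D(3) x by blast
    then show ?thesis unfolding s_def using D(2)
      by (intro sum_pos2[of D p]) (auto simp: box_bump_pos box_bump_bounds)
  qed
  moreover obtain x0 where "x0 \<in> K" "\<And>x. x \<in> K \<Longrightarrow> s x0 \<le> s x"
    using continuous_attains_inf[OF assms(1) False contS] by blast
  ultimately obtain c where c: "0 < c" "\<And>x. x \<in> K \<Longrightarrow> c \<le> s x" by blast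
  \<comment> \<open>Here \<open>flat 1 (c/2 - s x)\<close> vanishes once \<open>s x \<ge> c/2\<close> and equals \<open>flat 1 (c/2)\<close> once \<open>s x = 0\<close>.\<close>
  show ?thesis
  proof (rule that[of "\<lambda>x. 1 - inverse (flat 1 (c/2)) * flat 1 (c/2 - s x)" "{x. c/2 < s x}" "\<Union>p\<in>D. cbox (a p) (b p)"])
    show "Ck_on r UNIV (\<lambda>x. 1 - inverse (flat 1 (c/2)) * flat 1 (c/2 - s x))" for r
      by (intro Ck_on_diff Ck_on_mult Ck_on_const Ck_on_flat_compose Cs open_UNIV)
    show "open {x. c / 2 < s x}"
      by (intro open_Collect_less contS continuous_on_const)
    show "K \<subseteq> {x. c / 2 < s x}" using c by force
    show "compact (\<Union>p\<in>D. cbox (a p) (b p))" using D(2) by (intro compact_UN) auto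
    show "(\<Union>p\<in>D. cbox (a p) (b p)) \<subseteq> U" using ab D(1) by blast
    fix x assume x: "x \<notin> (\<Union>p\<in>D. cbox (a p) (b p))"
    then have "s x = 0" unfolding s_def using box_subset_cbox
      by (intro sum.neutral ballI box_bump_eq_0) auto
    then show "1 - inverse (flat 1 (c/2)) * flat 1 (c/2 - s x) = 0"
      using c flat_one_pos_iff[of "c/2"] by simp
  qed (auto simp: flat_one)
qed

text \<open>
  The nearest point projection is given only near the manifold, while the approximations of a
  Sobolev map with values in the manifold may take values anywhere. Multiplication by a cutoff yields
  a map of the whole space that has bounded derivatives and agrees with the projection near the
  manifold.
\<close>

lemma Ck_on_compact_support_extension:
  fixes K :: "'a::euclidean_space set"
  assumes "compact K" "open U" "K \<subseteq> U" "Ck_on r U f"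
  obtains g W C where "Ck_on r UNIV g" "open W" "K \<subseteq> W" "W \<subseteq> U" "\<And>x. x \<in> W \<Longrightarrow> g x = f x"
    "compact C" "\<And>x. x \<notin> C \<Longrightarrow> g x = 0"
proof -
  obtain \<eta> :: "'a \<Rightarrow> real" and W C where \<eta>: "\<And>r. Ck_on r UNIV \<eta>" "open W" "K \<subseteq> W"
    "\<And>x. x \<in> W \<Longrightarrow> \<eta> x = 1" "compact C" "C \<subseteq> U" "\<And>x. x \<notin> C \<Longrightarrow> \<eta> x = 0"
    using smooth_cutoff_exists[OF assms(1-3)] by blast
  define g where "g x = \<eta> x *\<^sub>R f x" for x
  have "Ck_on r U g"
    unfolding g_def[abs_def] by (intro Ck_on_scaleR assms Ck_on_subset[OF \<eta>(1)]) simp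
  moreover have "open (- C)" using \<eta>(5) compact_imp_closed open_Compl by blast
  moreover from this have "Ck_on r (- C) g"
    by (subst Ck_on_cong[of _ _ "\<lambda>_. 0"]) (auto simp: g_def \<eta>(7) Ck_on_const)
  ultimately have "Ck_on r (U \<union> - C) g" using assms(2) Ck_on_Un by blast
  moreover have "U \<union> - C = UNIV" using \<eta>(6) by auto
  ultimately show ?thesis using \<eta>(2-5,7) assms(2,3)
    by (intro that[of g "W \<inter> U" C]) (auto simp: g_def)
qed

section \<open>Functions of compact support\<close>

lemma frechet_derivative_zero_outside:
  assumes "closed C" "\<And>x. x \<notin> C \<Longrightarrow> f x = 0" "x \<notin> C"
  shows "frechet_derivative f (at x) h = 0"
  using frechet_derivative_cong_open[of "- C" x f "\<lambda>_. 0"] assms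
  by (auto simp: frechet_derivative_const open_Compl)

lemma compact_support_bounded:
  assumes "continuous_on UNIV f" "compact C" "\<And>x. x \<notin> C \<Longrightarrow> f x = 0"
  obtains B where "0 \<le> B" "\<And>x. norm (f x) \<le> B"
proof -
  have "bounded (f ` C)"
    by (intro compact_imp_bounded compact_continuous_image continuous_on_subset[OF assms(1)] assms) auto
  then obtain B where "\<And>x. x \<in> C \<Longrightarrow> norm (f x) \<le> B" by (auto simp: bounded_iff)
  then have "norm (f x) \<le> max 0 B" for x using assms(3)[of x] by (cases "x \<in> C") (auto simp: le_max_iff_disj)
  then show ?thesis by (intro that[of "max 0 B"]) auto
qed

lemma linear_norm_le_sum_Basis:
  fixes L :: "'a::euclidean_space \<Rightarrow> 'b::real_normed_vector"
  assumes "linear L" "\<And>b. b \<in> Basis \<Longrightarrow> norm (L b) \<le> c b"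
  shows "norm (L h) \<le> (\<Sum>b\<in>Basis. c b) * norm h"
proof -
  have "L h = L (\<Sum>b\<in>Basis. (h \<bullet> b) *\<^sub>R b)" by (simp add: euclidean_representation)
  also have "\<dots> = (\<Sum>b\<in>Basis. (h \<bullet> b) *\<^sub>R L b)"
    by (simp add: linear_sum[OF assms(1)] linear_scale[OF assms(1)])
  finally have "norm (L h) \<le> (\<Sum>b\<in>Basis. norm ((h \<bullet> b) *\<^sub>R L b))" by (simp only: norm_sum)
  also have "\<dots> \<le> (\<Sum>b\<in>Basis. c b * norm h)"
    using assms(2) by (intro sum_mono) (simp, subst mult.commute, auto intro!: mult_mono Basis_le_norm order_trans[OF norm_ge_zero])
  finally show ?thesis by (simp add: sum_distrib_right)
qed

lemma C1_compact_support_derivative_bound: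
  fixes f :: "'a::euclidean_space \<Rightarrow> 'b::real_normed_vector"
  assumes "Ck_on 1 UNIV f" "compact C" "\<And>x. x \<notin> C \<Longrightarrow> f x = 0"
  obtains B where "0 \<le> B" "\<And>x h. norm (frechet_derivative f (at x) h) \<le> B * norm h"
proof -
  have f: "Ck_on (Suc 0) UNIV f" using assms(1) by simp
  have "\<exists>c\<ge>0. \<forall>x. norm (frechet_derivative f (at x) b) \<le> c" for b
  proof -
    have "frechet_derivative f (at x) b = 0" if "x \<notin> C" for x
      using frechet_derivative_zero_outside[of C f] assms that compact_imp_closed by blast
    moreover have "continuous_on UNIV (\<lambda>x. frechet_derivative f (at x) b)"
      using Ck_on_SucD(2)[OF f, of b] by simp
    ultimately show ?thesis using compact_support_bounded[of "\<lambda>x. frechet_derivative f (at x) b" C] assms(2)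
      by metis
  qed
  then obtain c where c: "\<And>b. c b \<ge> 0" "\<And>b x. norm (frechet_derivative f (at x) b) \<le> c b" by metis
  show ?thesis
  proof (rule that[of "\<Sum>b\<in>Basis. c b"])
    show "norm (frechet_derivative f (at x) h) \<le> (\<Sum>b\<in>Basis. c b) * norm h" for x h
      using c Ck_on_SucD(1)[OF f, of x] by (intro linear_norm_le_sum_Basis) (auto intro: has_derivative_linear)
  qed (simp add: c sum_nonneg)
qed

text \<open>
  The derivative in a fixed direction is itself a $C^1$ function of compact support, so each basis
  direction has a bound; the second derivative is linear in the direction, which combines these.
\<close>

lemma C2_compact_support_second_derivative_bound:
  fixes f :: "'a::euclidean_space \<Rightarrow> 'b::real_normed_vector"
  assumes "Ck_on 2 UNIV f" "compact C" "\<And>x. x \<notin> C \<Longrightarrow> f x = 0"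
  obtains B where "0 \<le> B"
    "\<And>y h k. norm (frechet_derivative (\<lambda>z. frechet_derivative f (at z) h) (at y) k) \<le> B * norm h * norm k"
proof -
  have f: "Ck_on (Suc 1) UNIV f" using assms(1) by (simp add: numeral_2_eq_2)
  define E where "E h y = frechet_derivative (\<lambda>z. frechet_derivative f (at z) h) (at y)" for h y
  have q: "Ck_on 1 UNIV (\<lambda>z. frechet_derivative f (at z) h)" for h by (rule Ck_on_SucD(2)[OF f])
  have q': "((\<lambda>z. frechet_derivative f (at z) h) has_derivative E h y) (at y)" for h y
    using Ck_on_SucD(1)[of 0 UNIV "\<lambda>z. frechet_derivative f (at z) h" y] q[of h] unfolding E_def by simp
  have lin: "linear (frechet_derivative f (at z))" for z
    using Ck_on_SucD(1)[OF f, of z] by (auto intro: has_derivative_linear)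
  have z: "frechet_derivative f (at x) h = 0" if "x \<notin> C" for x h
    by (rule frechet_derivative_zero_outside[OF compact_imp_closed[OF assms(2)] assms(3) that])
  have "\<exists>c\<ge>0. \<forall>y k. norm (E b y k) \<le> c * norm k" for b
  proof -
    obtain B where "0 \<le> B" "\<And>y k. norm (E b y k) \<le> B * norm k"
      unfolding E_def using C1_compact_support_derivative_bound[OF q[of b] assms(2) z[of _ b]] by blast
    then show ?thesis by blast
  qed
  then obtain c where c: "\<And>b. c b \<ge> 0" "\<And>b y k. norm (E b y k) \<le> c b * norm k" by metis
  have "linear (\<lambda>h. E h y k)" for y k
  proof (rule linearI)
    fix h h' :: 'a and r :: real
    have "((\<lambda>z. frechet_derivative f (at z) h + frechet_derivative f (at z) h') has_derivative (\<lambda>k. E h y k + E h' y k)) (at y)"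
      by (rule has_derivative_add[OF q' q'])
    then have "((\<lambda>z. frechet_derivative f (at z) (h + h')) has_derivative (\<lambda>k. E h y k + E h' y k)) (at y)"
      by (simp add: linear_add[OF lin])
    from has_derivative_unique[OF q' this] show "E (h + h') y k = E h y k + E h' y k" by (rule fun_cong)
    have "((\<lambda>z. r *\<^sub>R frechet_derivative f (at z) h) has_derivative (\<lambda>k. r *\<^sub>R E h y k)) (at y)"
      by (rule has_derivative_scaleR_right[OF q'])
    then have "((\<lambda>z. frechet_derivative f (at z) (r *\<^sub>R h)) has_derivative (\<lambda>k. r *\<^sub>R E h y k)) (at y)"
      by (simp add: linear_scale[OF lin])
    from has_derivative_unique[OF q' this] show "E (r *\<^sub>R h) y k = r *\<^sub>R E h y k" by (rule fun_cong)
  qed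
  then have "norm (E h y k) \<le> (\<Sum>b\<in>Basis. c b * norm k) * norm h" for h y k
    using c by (intro linear_norm_le_sum_Basis[where L="\<lambda>h. E h y k"]) auto
  then have "norm (E h y k) \<le> (\<Sum>b\<in>Basis. c b) * norm h * norm k" for h y k
    by (simp add: sum_distrib_right[symmetric] mult.assoc mult.commute[of "norm h"])
  then show ?thesis using c(1) unfolding E_def by (intro that[of "\<Sum>b\<in>Basis. c b"]) (simp_all add: sum_nonneg)
qed

lemma C2_compact_support_derivative_Lipschitz:
  fixes f :: "'a::euclidean_space \<Rightarrow> 'b::real_normed_vector"
  assumes "Ck_on 2 UNIV f" "compact C" "\<And>x. x \<notin> C \<Longrightarrow> f x = 0"
  obtains B where "0 \<le> B"
    "\<And>x y h. norm (frechet_derivative f (at x) h - frechet_derivative f (at y) h) \<le> B * norm (x - y) * norm h"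
proof -
  have f: "Ck_on (Suc (Suc 0)) UNIV f" using assms(1) by (simp add: numeral_2_eq_2)
  obtain B where B: "0 \<le> B"
    "\<And>y h k. norm (frechet_derivative (\<lambda>z. frechet_derivative f (at z) h) (at y) k) \<le> B * norm h * norm k"
    by (rule C2_compact_support_second_derivative_bound[OF assms]) (assumption, rule that)
  have "norm (frechet_derivative f (at x) h - frechet_derivative f (at y) h) \<le> (B * norm h) * norm (x - y)" for x y h
    by (rule differentiable_bound[of UNIV _ "\<lambda>z. frechet_derivative (\<lambda>z. frechet_derivative f (at z) h) (at z)"])
      (use B(2) Ck_on_SucD(1)[OF Ck_on_SucD(2)[OF f]] in \<open>auto intro!: onorm_le\<close>)
  then show ?thesis using B(1) by (intro that[of B]) (simp_all add: mult_ac)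
qed

section \<open>The fundamental lemma of the calculus of variations\<close>

text \<open>
  The boxes form an intersection-stable generator of the Borel sets, so the sets with integral zero,
  being closed under disjoint unions and, as the whole space is an increasing union of boxes, under
  complements, include all Borel sets. Lebesgue sets differ from Borel sets by null sets.
\<close>

lemma AE_zero_if_box_integrals_zero:
  fixes f :: "'a::euclidean_space \<Rightarrow> real"
  assumes int: "integrable lebesgue f"
    and box: "\<And>c d. set_lebesgue_integral lebesgue (box c d) f = 0"
  shows "AE x in lebesgue. f x = 0"
proof (rule density_unique_real[OF int integrable_zero, simplified])
  have si: "set_integrable lebesgue A f" if "A \<in> sets lebesgue" for A
    using int that unfolding set_integrable_def by (rule integrable_mult_indicator[rotated])
  let ?B = "\<lambda>n. box (- real n *\<^sub>R One) (real n *\<^sub>R One) :: 'a set"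
  have "incseq ?B"
    by (intro monoI subset_box_imp) (auto simp: inner_simps)
  moreover have UB: "(\<Union>n. ?B n) = UNIV"
    using UN_box_eq_UNIV by (simp add: scaleR_minus_left)
  ultimately have "(\<lambda>n. set_lebesgue_integral lebesgue (?B n) f) \<longlonglongrightarrow> set_lebesgue_integral lebesgue UNIV f"
    using set_integral_cont_up[of ?B lebesgue f] si[of UNIV] by simp
  then have U: "set_lebesgue_integral lebesgue UNIV f = 0"
    unfolding box using LIMSEQ_unique tendsto_const by blast
  have borel: "set_lebesgue_integral lebesgue A f = 0" if "A \<in> sets borel" for A
  proof -
    have "Int_stable (range (\<lambda>(a, b). box a b :: 'a set))"
      by (auto simp: Int_stable_def box_Int_box)
    moreover have "range (\<lambda>(a, b). box a b :: 'a set) \<subseteq> Pow UNIV" by simp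
    moreover have "A \<in> sigma_sets UNIV (range (\<lambda>(a, b). box a b))"
      using that by (simp add: borel_eq_box)
    ultimately show ?thesis
    proof (induction rule: sigma_sets_induct_disjoint)
      case (basic A) then show ?case using box by auto
    next
      case empty then show ?case by (simp add: set_lebesgue_integral_def)
    next
      case (compl A)
      then have "A \<in> sets borel" by (simp add: borel_eq_box)
      then have A: "A \<in> sets lebesgue" "- A \<in> sets lebesgue" by (simp_all add: borel_comp)
      have "set_lebesgue_integral lebesgue (A \<union> - A) f
          = set_lebesgue_integral lebesgue A f + set_lebesgue_integral lebesgue (- A) f"
        using A by (intro set_integral_Un si) auto
      then show ?case using compl U by (simp add: Compl_eq_Diff_UNIV[symmetric] Compl_partition)
    next
      case (union A)
      then have "A i \<in> sets borel" for i by (simp add: borel_eq_box image_subset_iff)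
      then have A: "A i \<in> sets lebesgue" for i by simp
      then show ?case using union
        by (subst lebesgue_integral_countable_add) (auto simp: disjoint_family_on_def intro!: si)
    qed
  qed
  fix A assume "A \<in> sets (lebesgue :: 'a measure)"
  then obtain S N N' where A: "A = S \<union> N" "N \<subseteq> N'" "N' \<in> null_sets lborel" "S \<in> sets lborel"
    by (rule sets_completionE)
  have "AE x in lborel. x \<notin> N'" using A(3) by (rule AE_not_in)
  then have "AE x in lebesgue. x \<notin> N'" by (rule AE_completion)
  then have "AE x in lebesgue. indicator A x *\<^sub>R f x = indicator S x *\<^sub>R f x"
    using A by (auto elim!: eventually_mono simp: indicator_def)
  then have "set_lebesgue_integral lebesgue A f = set_lebesgue_integral lebesgue S f"
    unfolding set_lebesgue_integral_def using int \<open>A \<in> sets lebesgue\<close> A(4)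
    by (intro integral_cong_AE borel_measurable_scaleR borel_measurable_indicator) auto
  then show "set_lebesgue_integral lebesgue A f = 0" using borel A(4) by simp
qed

lemma integrable_lebesgue_on_zero_outside:
  fixes f :: "'a::euclidean_space \<Rightarrow> 'b::{banach, second_countable_topology}"
  assumes "A \<in> sets lebesgue" "B \<in> sets lebesgue" "A \<subseteq> B" "\<And>x. x \<in> B \<Longrightarrow> x \<notin> A \<Longrightarrow> f x = 0"
  shows "integrable (lebesgue_on A) f \<longleftrightarrow> integrable (lebesgue_on B) f"
    and "integral\<^sup>L (lebesgue_on A) f = integral\<^sup>L (lebesgue_on B) f"
proof -
  have "(\<lambda>x. indicator A x *\<^sub>R f x) = (\<lambda>x. indicator B x *\<^sub>R f x)"
    using assms(3,4) by (auto simp: indicator_def fun_eq_iff)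
  then show "integrable (lebesgue_on A) f \<longleftrightarrow> integrable (lebesgue_on B) f"
    "integral\<^sup>L (lebesgue_on A) f = integral\<^sup>L (lebesgue_on B) f"
    using assms by (simp_all add: integrable_restrict_space integral_restrict_space)
qed

lemma locally_integrable_mult_compact_support:
  fixes u \<psi> :: "'a::euclidean_space \<Rightarrow> real"
  assumes "open \<Omega>" "locally_integrable \<Omega> u" "continuous_on UNIV \<psi>" "compact K" "K \<subseteq> \<Omega>"
    "\<And>x. x \<notin> K \<Longrightarrow> \<psi> x = 0"
  shows "integrable (lebesgue_on \<Omega>) (\<lambda>x. u x * \<psi> x)"
proof -
  obtain B where B: "0 \<le> B" "\<And>x. norm (\<psi> x) \<le> B"
    using compact_support_bounded[OF assms(3,4,6)] by blast
  have K: "K \<in> sets lebesgue" using assms(4) by (simp add: compact_imp_closed borel_closed)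
  have u: "integrable (lebesgue_on K) u" using assms by (auto simp: locally_integrable_def)
  have m: "\<psi> \<in> borel_measurable (lebesgue_on K)"
    by (rule continuous_imp_measurable_on_sets_lebesgue[OF continuous_on_subset[OF assms(3)] K]) simp
  have "integrable (lebesgue_on K) (\<lambda>x. u x * \<psi> x)"
  proof (rule Bochner_Integration.integrable_bound)
    show "integrable (lebesgue_on K) (\<lambda>x. B * u x)" using u by simp
    show "(\<lambda>x. u x * \<psi> x) \<in> borel_measurable (lebesgue_on K)" using u m by auto
    show "AE x in lebesgue_on K. norm (u x * \<psi> x) \<le> norm (B * u x)"
      using B by (intro AE_I2) (auto simp: abs_mult mult.commute intro!: mult_right_mono)
  qed
  then show ?thesis
    using integrable_lebesgue_on_zero_outside(1)[of K \<Omega> "\<lambda>x. u x * \<psi> x"] K assms by auto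
qed

lemma test_functionD:
  assumes "test_function \<Omega> \<phi>"
  obtains K where "compact K" "K \<subseteq> \<Omega>" "\<And>x. x \<notin> K \<Longrightarrow> \<phi> x = 0" "\<And>r. Ck_on r UNIV \<phi>"
    "\<And>x h. x \<notin> K \<Longrightarrow> frechet_derivative \<phi> (at x) h = 0"
proof (rule that[of "closure {x. \<phi> x \<noteq> 0}"])
  show *: "\<phi> x = 0" if "x \<notin> closure {x. \<phi> x \<noteq> 0}" for x
    using that closure_subset[of "{x. \<phi> x \<noteq> 0}"] by blast
  show "frechet_derivative \<phi> (at x) h = 0" if "x \<notin> closure {x. \<phi> x \<noteq> 0}" for x h
    by (rule frechet_derivative_zero_outside[OF closed_closure * that])
qed (use assms in \<open>auto simp: test_function_def smooth_on_def\<close>)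

text \<open>
  Testing with \<open>box_bump\<close> and letting its steepness tend to infinity shows that \<open>f\<close> has integral
  zero over every box whose closure lies in \<open>\<Omega>\<close>; countably many such boxes cover \<open>\<Omega>\<close>.
\<close>

lemma fundamental_lemma_calculus_of_variations:
  fixes f :: "'a::euclidean_space \<Rightarrow> real"
  assumes \<Omega>: "open \<Omega>" and f: "locally_integrable \<Omega> f"
    and zero: "\<And>\<phi>. test_function \<Omega> \<phi> \<Longrightarrow> (\<integral>x. f x * \<phi> x \<partial>lebesgue_on \<Omega>) = 0"
  shows "AE x in lebesgue_on \<Omega>. f x = 0"
proof -
  have L: "integrable lebesgue (\<lambda>x. indicator (cbox a b) x *\<^sub>R f x)" if "cbox a b \<subseteq> \<Omega>" for a b
    using f that integrable_restrict_space[of "cbox a b" lebesgue f]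
    by (auto simp: locally_integrable_def)
  have boxes: "set_lebesgue_integral lebesgue (box a b) f = 0" if ab: "cbox a b \<subseteq> \<Omega>" for a b
  proof -
    have [measurable]: "(\<lambda>x. indicator (cbox a b) x *\<^sub>R f x) \<in> borel_measurable lebesgue"
      using L[OF ab] by auto
    have bump_m[measurable]: "box_bump m a b \<in> borel_measurable lebesgue" for m
      using borel_measurable_continuous_onI[OF Ck_on_continuous_on[OF Ck_on_box_bump[of 0 m a b]]]
      by (simp add: measurable_completion)
    let ?h = "\<lambda>n x. (indicator (cbox a b) x *\<^sub>R f x) * box_bump (real (Suc n)) a b x"
    have "(\<lambda>n. \<integral>x. ?h n x \<partial>lebesgue) \<longlonglongrightarrow> (\<integral>x. (indicator (cbox a b) x *\<^sub>R f x) * indicator (box a b) x \<partial>lebesgue)"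
    proof (rule integral_dominated_convergence[where w="\<lambda>x. norm (indicator (cbox a b) x *\<^sub>R f x)"])
      show "integrable lebesgue (\<lambda>x. norm (indicator (cbox a b) x *\<^sub>R f x))"
        using L[OF ab] by (rule integrable_norm)
      show "AE x in lebesgue. (\<lambda>n. ?h n x) \<longlonglongrightarrow> indicator (cbox a b) x *\<^sub>R f x * indicator (box a b) x"
        by (intro AE_I2 tendsto_intros box_bump_tendsto_indicator)
      show "AE x in lebesgue. norm (?h n x) \<le> norm (indicator (cbox a b) x *\<^sub>R f x)" for n
        using box_bump_bounds[of "real (Suc n)" a b]
        by (intro AE_I2) (auto simp: abs_mult intro!: mult_left_le simp del: of_nat_Suc)
      show "?h n \<in> borel_measurable lebesgue" for n by measurable
      show "(\<lambda>x. indicator (cbox a b) x *\<^sub>R f x * indicator (box a b) x) \<in> borel_measurable lebesgue"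
        by (rule borel_measurable_times[OF _ borel_measurable_indicator]) (measurable, simp)
    qed
    moreover have "(\<integral>x. ?h n x \<partial>lebesgue) = 0" for n
    proof -
      have "(\<lambda>x. indicator \<Omega> x *\<^sub>R (f x * box_bump (real (Suc n)) a b x)) = ?h n"
        using ab box_bump_eq_0[of "real (Suc n)" _ a b] box_subset_cbox[of a b]
        by (auto simp: indicator_def fun_eq_iff)
      then show ?thesis
        using zero[OF test_function_box_bump[OF _ ab, of "real (Suc n)"]] \<Omega>
        by (simp add: integral_restrict_space)
    qed
    moreover have "(\<lambda>x. (indicator (cbox a b) x *\<^sub>R f x) * indicator (box a b) x) = (\<lambda>x. indicator (box a b) x *\<^sub>R f x)"
      using box_subset_cbox[of a b] by (auto simp: indicator_def fun_eq_iff)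
    ultimately have "(\<lambda>n::nat. 0::real) \<longlonglongrightarrow> set_lebesgue_integral lebesgue (box a b) f"
      by (simp only: set_lebesgue_integral_def)
    then show ?thesis by (simp add: LIMSEQ_const_iff)
  qed
  have ae: "AE x in lebesgue. x \<in> box a b \<longrightarrow> f x = 0" if ab: "cbox a b \<subseteq> \<Omega>" for a b
  proof -
    let ?g = "\<lambda>x. indicator (box a b) x *\<^sub>R f x"
    have "?g = (\<lambda>x. indicator (box a b) x *\<^sub>R (indicator (cbox a b) x *\<^sub>R f x))"
      using box_subset_cbox[of a b] by (auto simp: indicator_def fun_eq_iff)
    then have "integrable lebesgue ?g"
      using integrable_mult_indicator[OF _ L[OF ab], of "box a b"] by simp
    moreover have "set_lebesgue_integral lebesgue (box c d) ?g = 0" for c d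
    proof -
      obtain p q where pq: "box c d \<inter> box a b = box p q" "cbox c d \<inter> cbox a b = cbox p q"
        by (rule that[OF box_Int_box Int_interval])
      have "set_lebesgue_integral lebesgue (box c d) ?g = set_lebesgue_integral lebesgue (box c d \<inter> box a b) f"
        by (simp add: set_lebesgue_integral_def indicator_inter_arith mult.assoc)
      also have "\<dots> = 0" unfolding pq(1) by (rule boxes) (use pq(2) ab in auto)
      finally show ?thesis .
    qed
    ultimately have "AE x in lebesgue. ?g x = 0" by (rule AE_zero_if_box_integrals_zero)
    then show ?thesis by eventually_elim (auto simp: indicator_def split: if_splits)
  qed
  let ?F = "{box a b |a b. cbox a b \<subseteq> \<Omega>}"
  obtain F' where F': "F' \<subseteq> ?F" "countable F'" "\<Union>F' = \<Union>?F"
  proof (rule Lindelof[of ?F])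
    show "open S" if "S \<in> ?F" for S using that by (elim CollectE exE conjE) (simp only: open_box)
  qed
  have U: "\<Omega> \<subseteq> \<Union>?F"
  proof
    fix x assume "x \<in> \<Omega>"
    then obtain a b where "cbox a b \<subseteq> \<Omega>" "x \<in> box a b"
      using open_contains_cbox[OF \<Omega>] by metis
    then show "x \<in> \<Union>?F" by (intro UnionI[of "box a b"] CollectI exI[of _ a] exI[of _ b] conjI refl)
  qed
  have "\<forall>B\<in>F'. AE x in lebesgue. x \<in> B \<longrightarrow> f x = 0"
  proof
    fix B assume "B \<in> F'"
    with F'(1) have "B \<in> ?F" by (rule subsetD)
    then have "\<exists>a b. B = box a b \<and> cbox a b \<subseteq> \<Omega>" by (rule CollectD)
    then obtain a b where B: "B = box a b" "cbox a b \<subseteq> \<Omega>" by blast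
    show "AE x in lebesgue. x \<in> B \<longrightarrow> f x = 0"
      unfolding B(1) by (rule ae[OF B(2)])
  qed
  then have "AE x in lebesgue. \<forall>B\<in>F'. x \<in> B \<longrightarrow> f x = 0"
    by (simp only: AE_ball_countable[OF F'(2)])
  then have "AE x in lebesgue. x \<in> \<Omega> \<longrightarrow> f x = 0"
  proof (rule eventually_mono)
    fix x assume *: "\<forall>B\<in>F'. x \<in> B \<longrightarrow> f x = 0"
    show "x \<in> \<Omega> \<longrightarrow> f x = 0"
    proof
      assume "x \<in> \<Omega>"
      then have "x \<in> \<Union>F'" unfolding F'(3) by (rule subsetD[OF U])
      then show "f x = 0" using * by (meson UnionE)
    qed
  qed
  then show ?thesis using \<Omega> by (subst AE_restrict_space_iff) auto
qed

section \<open>Integration by parts\<close>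

text \<open>
  The integral is the limit of the integrals of the difference quotients in direction \<open>e\<close>, and
  these vanish because Lebesgue measure is translation invariant.
\<close>

lemma integral_derivative_compact_support:
  fixes g :: "'a::euclidean_space \<Rightarrow> real"
  assumes g: "Ck_on 1 UNIV g" and K: "compact K" and 0: "\<And>x. x \<notin> K \<Longrightarrow> g x = 0"
  shows "(\<integral>x. frechet_derivative g (at x) e \<partial>lborel) = 0"
proof -
  have g1: "Ck_on (Suc 0) UNIV g" using g by simp
  have cont: "continuous_on UNIV g" using g by (rule Ck_on_continuous_on)
  then have gm[measurable]: "g \<in> borel_measurable borel" by (rule borel_measurable_continuous_onI)
  have [measurable]: "(\<lambda>x. frechet_derivative g (at x) e) \<in> borel_measurable borel"
    using Ck_on_SucD(2)[OF g1, of e] by (intro borel_measurable_continuous_onI) simp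
  obtain B where B: "0 \<le> B" "\<And>x h. norm (frechet_derivative g (at x) h) \<le> B * norm h"
    using C1_compact_support_derivative_bound[OF g K 0] by blast
  have lip: "norm (g x - g y) \<le> B * norm (x - y)" for x y
    by (rule differentiable_bound[of UNIV g "\<lambda>x. frechet_derivative g (at x)"])
      (use B Ck_on_SucD(1)[OF g1] in \<open>auto intro!: onorm_le\<close>)
  obtain R where R: "\<And>x. x \<in> K \<Longrightarrow> norm x \<le> R"
    using compact_imp_bounded[OF K] by (auto simp: bounded_iff)
  have gint: "integrable lborel g"
  proof -
    have "(\<lambda>x. indicator K x *\<^sub>R g x) = g" using 0 by (auto simp: indicator_def fun_eq_iff)
    then show ?thesis using borel_integrable_compact[OF K, of g] continuous_on_subset[OF cont] by auto
  qed
  have shift: "integrable lborel (\<lambda>x. g (x + t))" "(\<integral>x. g (x + t) \<partial>lborel) = (\<integral>x. g x \<partial>lborel)" for t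
    using integrable_distr[of "(+) t" lborel borel g] integral_distr[of "(+) t" lborel borel g] gint
    by (simp_all add: lborel_distr_plus add.commute)
  let ?s = "\<lambda>n. 1 / real (Suc n)"
  let ?q = "\<lambda>n x. (g (x + ?s n *\<^sub>R e) - g x) / ?s n"
  have "(\<lambda>n. \<integral>x. ?q n x \<partial>lborel) \<longlonglongrightarrow> (\<integral>x. frechet_derivative g (at x) e \<partial>lborel)"
  proof (rule integral_dominated_convergence[where w="\<lambda>x. indicator (cball 0 (R + norm e)) x *\<^sub>R (B * norm e)"])
    show "integrable lborel (\<lambda>x::'a. indicator (cball 0 (R + norm e)) x *\<^sub>R (B * norm e))"
      by (rule borel_integrable_compact) (auto intro: continuous_on_const)
    show "AE x in lborel. (\<lambda>n. ?q n x) \<longlonglongrightarrow> frechet_derivative g (at x) e"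
    proof (rule AE_I2)
      fix x
      have d: "(g has_derivative frechet_derivative g (at x)) (at x)" by (rule Ck_on_SucD(1)[OF g1]) simp
      have "((\<lambda>t. g (x + t *\<^sub>R e)) has_derivative (\<lambda>t. frechet_derivative g (at x) (t *\<^sub>R e))) (at 0)"
        by (rule has_derivative_compose[where f="\<lambda>t. x + t *\<^sub>R e" and g=g and x=0])
          (use d in \<open>auto intro!: derivative_eq_intros\<close>)
      then have "((\<lambda>t. g (x + t *\<^sub>R e)) has_real_derivative frechet_derivative g (at x) e) (at 0)"
        by (simp add: has_field_derivative_def linear_scale[OF has_derivative_linear[OF d]] mult_commute_abs)
      then have "((\<lambda>h. (g (x + h *\<^sub>R e) - g x) / h) \<longlongrightarrow> frechet_derivative g (at x) e) (at 0)"
        by (simp add: DERIV_def)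
      moreover have "filterlim ?s (at 0) sequentially"
        unfolding filterlim_at using LIMSEQ_Suc[OF lim_1_over_n[where 'a=real]] by simp
      ultimately show "(\<lambda>n. ?q n x) \<longlonglongrightarrow> frechet_derivative g (at x) e"
        by (rule filterlim_compose)
    qed
    show "AE x in lborel. norm (?q n x) \<le> indicator (cball 0 (R + norm e)) x *\<^sub>R (B * norm e)" for n
    proof (rule AE_I2)
      fix x
      show "norm (?q n x) \<le> indicator (cball 0 (R + norm e)) x *\<^sub>R (B * norm e)"
      proof (cases "x \<in> cball 0 (R + norm e)")
        case True
        have "norm (g (x + ?s n *\<^sub>R e) - g x) \<le> B * norm (?s n *\<^sub>R e)"
          using lip[of "x + ?s n *\<^sub>R e" x] by simp
        then have "norm (g (x + ?s n *\<^sub>R e) - g x) \<le> (B * norm e) * ?s n" by simp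
        then show ?thesis using True
          by (simp add: abs_mult pos_le_divide_eq del: of_nat_Suc)
      next
        case False
        have "norm (?s n *\<^sub>R e) \<le> 1 * norm e" unfolding norm_scaleR by (intro mult_right_mono) auto
        then have "norm x \<le> norm (x + ?s n *\<^sub>R e) + norm e"
          using norm_triangle_ineq4[of "x + ?s n *\<^sub>R e" "?s n *\<^sub>R e"] by simp
        then have "x + ?s n *\<^sub>R e \<notin> K" "x \<notin> K"
          using False R[of x] R[of "x + ?s n *\<^sub>R e"] norm_ge_zero[of e] by (auto simp del: norm_ge_zero)
        then show ?thesis using 0 False by simp
      qed
    qed
  qed auto
  moreover have "(\<integral>x. ?q n x \<partial>lborel) = 0" for n
    using shift[of "?s n *\<^sub>R e"] gint by simp
  ultimately have "(\<lambda>n::nat. 0::real) \<longlonglongrightarrow> (\<integral>x. frechet_derivative g (at x) e \<partial>lborel)"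
    by (simp only:)
  then show ?thesis by (simp add: LIMSEQ_const_iff)
qed

text \<open>
  The product \<open>f \<phi>\<close> vanishes off the support of \<open>\<phi>\<close>, so it is $C^1$ on the whole space although \<open>f\<close>
  is regular on \<open>V\<close> only, and the integral of its derivative is zero.
\<close>

lemma integration_by_parts_test_function:
  fixes f :: "'a::euclidean_space \<Rightarrow> real"
  assumes f: "Ck_on 1 V f" and V: "open V" "\<Omega> \<subseteq> V" and \<Omega>: "open \<Omega>" and \<phi>: "test_function \<Omega> \<phi>"
  shows "(\<integral>x. f x * frechet_derivative \<phi> (at x) e \<partial>lebesgue_on \<Omega>)
       = - (\<integral>x. frechet_derivative f (at x) e * \<phi> x \<partial>lebesgue_on \<Omega>)"
proof -
  obtain K where K: "compact K" "K \<subseteq> \<Omega>" "\<And>x. x \<notin> K \<Longrightarrow> \<phi> x = 0" "\<And>r. Ck_on r UNIV \<phi>"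
    "\<And>x h. x \<notin> K \<Longrightarrow> frechet_derivative \<phi> (at x) h = 0"
    using test_functionD[OF \<phi>] by blast
  have oK: "open (- K)" using K(1) compact_imp_closed open_Compl by blast
  have f1: "Ck_on (Suc 0) V f" using f by simp
  have glob: "Ck_on r UNIV g" if "Ck_on r V g" "\<And>x. x \<notin> K \<Longrightarrow> g x = 0" for r and g :: "'a \<Rightarrow> real"
  proof -
    have "Ck_on r (- K) g" using that(2) Ck_on_cong[OF oK, of g "\<lambda>_. 0"] Ck_on_const by auto
    then have "Ck_on r (V \<union> - K) g" by (intro Ck_on_Un that V oK)
    moreover have "V \<union> - K = UNIV" using K V by auto
    ultimately show ?thesis by simp
  qed
  have \<phi>V: "Ck_on r V \<phi>" for r by (rule Ck_on_subset[OF K(4)]) simp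
  let ?a = "\<lambda>x. f x * frechet_derivative \<phi> (at x) e" and ?b = "\<lambda>x. frechet_derivative f (at x) e * \<phi> x"
  have "Ck_on 1 UNIV (\<lambda>x. f x * \<phi> x)"
    by (rule glob) (use K(3) in \<open>auto intro!: Ck_on_mult[OF V(1) f] \<phi>V simp del: One_nat_def\<close>)
  then have "(\<integral>x. frechet_derivative (\<lambda>x. f x * \<phi> x) (at x) e \<partial>lborel) = 0"
    by (rule integral_derivative_compact_support[OF _ K(1)]) (simp add: K(3))
  moreover have "frechet_derivative (\<lambda>x. f x * \<phi> x) (at x) e = ?a x + ?b x" for x
  proof (cases "x \<in> V")
    case True
    have "((\<lambda>x. f x * \<phi> x) has_derivative (\<lambda>h. f x * frechet_derivative \<phi> (at x) h + frechet_derivative f (at x) h * \<phi> x)) (at x)"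
      using True by (intro has_derivative_mult Ck_on_SucD(1)[OF f1] Ck_on_SucD(1)[OF \<phi>V[of "Suc 0"]])
    from frechet_derivative_at[OF this] show ?thesis by metis
  next
    case False
    then have "x \<notin> K" using K V by blast
    then have "frechet_derivative (\<lambda>x. f x * \<phi> x) (at x) e = 0"
      using compact_imp_closed[OF K(1)] K(3) by (intro frechet_derivative_zero_outside[of K]) auto
    then show ?thesis using K(3,5) \<open>x \<notin> K\<close> by simp
  qed
  moreover have I: "integrable lborel h" if "Ck_on 0 V h" "\<And>x. x \<notin> K \<Longrightarrow> h x = 0" for h :: "'a \<Rightarrow> real"
  proof -
    have "(\<lambda>x. indicator K x *\<^sub>R h x) = h" using that by (auto simp: indicator_def fun_eq_iff)
    then show ?thesis using borel_integrable_compact[OF K(1), of h] glob[OF that] continuous_on_subset by fastforce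
  qed
  have Ia: "integrable lborel ?a"
    by (rule I) (use K(5) in \<open>auto intro!: Ck_on_mult[OF V(1)] Ck_on_le[OF f] Ck_on_SucD(2)[OF \<phi>V] simp del: Ck_on.simps\<close>)
  have Ib: "integrable lborel ?b"
    by (rule I) (use K(3) in \<open>auto intro!: Ck_on_mult[OF V(1)] Ck_on_SucD(2)[OF f1] \<phi>V simp del: Ck_on.simps\<close>)
  have tr: "(\<integral>x. h x \<partial>lebesgue_on \<Omega>) = (\<integral>x. h x \<partial>lborel)"
    if "integrable lborel h" "\<And>x. x \<notin> K \<Longrightarrow> h x = 0" for h :: "'a \<Rightarrow> real"
  proof -
    have "(\<lambda>x. indicator \<Omega> x *\<^sub>R h x) = h" using that K(2) by (auto simp: indicator_def fun_eq_iff)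
    then show ?thesis using \<Omega> that by (simp add: integral_restrict_space integral_completion)
  qed
  from calculation have "(\<integral>x. ?a x + ?b x \<partial>lborel) = 0" by simp
  then have "(\<integral>x. ?a x \<partial>lborel) + (\<integral>x. ?b x \<partial>lborel) = 0"
    using Ia Ib by simp
  then show ?thesis using tr[OF Ia] tr[OF Ib] K by simp
qed

section \<open>Weak gradients\<close>

text \<open>
  Lebesgue measure is complete. This gives measurability of functions that are controlled only up to
  null sets, such as \<open>weak_gradient\<close>, which is a choice, or a composition \<open>P \<circ> u\<close> where \<open>P\<close> is
  prescribed only near almost all values of \<open>u\<close>.
\<close>

lemma borel_measurable_lebesgue_on_AE_cong:
  assumes S: "S \<in> sets lebesgue" and g: "g \<in> borel_measurable (lebesgue_on S)"
    and ae: "AE x in lebesgue_on S. f x = g x"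
  shows "f \<in> borel_measurable (lebesgue_on S)"
proof -
  interpret complete_measure "lebesgue_on S"
  proof
    fix A B assume AB: "B \<subseteq> A" "A \<in> null_sets (lebesgue_on S)"
    then have A: "A \<subseteq> S" "A \<in> null_sets lebesgue" using null_sets_restrict_space[OF S] by auto
    then have "B \<in> null_sets lebesgue" using AB(1) by (metis completion.complete2)
    then show "B \<in> sets (lebesgue_on S)" using A AB(1) S by (auto simp: sets_restrict_space_iff)
  qed
  show ?thesis
  proof (rule measurableI)
    fix A :: "'b set" assume A: "A \<in> sets borel"
    show "f -` A \<inter> space (lebesgue_on S) \<in> sets (lebesgue_on S)"
    proof (rule in_sets_AE)
      show "AE x in lebesgue_on S. x \<in> g -` A \<inter> space (lebesgue_on S) \<longleftrightarrow> x \<in> f -` A \<inter> space (lebesgue_on S)"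
        using ae by (rule eventually_mono) auto
      show "g -` A \<inter> space (lebesgue_on S) \<in> sets (lebesgue_on S)" using g A by (rule measurable_sets)
    qed simp
  qed simp
qed

lemma AE_lebesgue_on_subset:
  assumes "A \<in> sets lebesgue" "B \<in> sets lebesgue" "A \<subseteq> B" "AE x in lebesgue_on B. P x"
  shows "AE x in lebesgue_on A. P x"
  using assms by (simp add: AE_restrict_space_iff) (erule eventually_mono, auto)

lemma integrable_lebesgue_on_subset:
  fixes f :: "'a::euclidean_space \<Rightarrow> 'b::{banach, second_countable_topology}"
  assumes "A \<in> sets lebesgue" "B \<in> sets lebesgue" "A \<subseteq> B" "integrable (lebesgue_on B) f"
  shows "integrable (lebesgue_on A) f"
proof -
  have "integrable lebesgue (\<lambda>x. indicator A x *\<^sub>R (indicator B x *\<^sub>R f x))"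
    using assms by (intro integrable_mult_indicator[of A lebesgue "\<lambda>x. indicator B x *\<^sub>R f x"])
      (simp_all add: integrable_restrict_space)
  moreover have "(\<lambda>x. indicator A x *\<^sub>R (indicator B x *\<^sub>R f x)) = (\<lambda>x. indicator A x *\<^sub>R f x)"
    using assms(3) by (auto simp: indicator_def fun_eq_iff)
  ultimately show ?thesis using assms(1) by (simp add: integrable_restrict_space)
qed

lemma compact_in_sets_lebesgue: "compact K \<Longrightarrow> K \<in> sets lebesgue"
  by (simp add: compact_imp_closed borel_closed)

lemma integrable_imp_locally_integrable:
  assumes "\<Omega> \<in> sets lebesgue" "integrable (lebesgue_on \<Omega>) u"
  shows "locally_integrable \<Omega> u"
  unfolding locally_integrable_def
  using integrable_lebesgue_on_subset[OF _ assms(1) _ assms(2)] compact_in_sets_lebesgue by blast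

lemma locally_integrable_bounded_linear:
  assumes "bounded_linear L" "locally_integrable \<Omega> u"
  shows "locally_integrable \<Omega> (\<lambda>x. L (u x))"
  using assms by (auto simp: locally_integrable_def intro: integrable_bounded_linear)

lemma locally_integrable_add:
  "locally_integrable \<Omega> u \<Longrightarrow> locally_integrable \<Omega> w \<Longrightarrow> locally_integrable \<Omega> (\<lambda>x. u x + w x)"
  by (auto simp: locally_integrable_def)

lemma locally_integrable_scaleR:
  "locally_integrable \<Omega> u \<Longrightarrow> locally_integrable \<Omega> (\<lambda>x. c *\<^sub>R u x)"
  by (auto simp: locally_integrable_def)

lemma locally_integrable_AE_cong:
  assumes "\<Omega> \<in> sets lebesgue" "locally_integrable \<Omega> u" "AE x in lebesgue_on \<Omega>. u x = w x"
  shows "locally_integrable \<Omega> w"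
  unfolding locally_integrable_def
proof (intro allI impI)
  fix K assume K: "compact K \<and> K \<subseteq> \<Omega>"
  then have u: "integrable (lebesgue_on K) u" using assms(2) by (simp add: locally_integrable_def)
  have ae: "AE x in lebesgue_on K. u x = w x"
    using K assms by (intro AE_lebesgue_on_subset[of K \<Omega>]) (auto intro: compact_in_sets_lebesgue)
  have "AE x in lebesgue_on K. w x = u x" using ae by (rule eventually_mono) simp
  then have "w \<in> borel_measurable (lebesgue_on K)"
    using K by (intro borel_measurable_lebesgue_on_AE_cong[OF _ borel_measurable_integrable[OF u]])
      (simp_all add: compact_in_sets_lebesgue)
  then show "integrable (lebesgue_on K) w"
    using u integrable_cong_AE[OF borel_measurable_integrable[OF u] _ ae] by simp
qed

lemma bounded_linear_matrix_entry: "bounded_linear (\<lambda>A::real^'d^'k. A $ i $ j)"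
  using bounded_linear_compose[OF bounded_linear_vec_nth[of j] bounded_linear_vec_nth[of i]] by simp

lemma abs_matrix_entry_le_norm: "\<bar>A $ i $ j\<bar> \<le> norm (A :: real^'d^'k)"
  using component_le_norm_cart[of "A $ i" j] Finite_Cartesian_Product.norm_nth_le[of A i] by simp

lemma has_weak_gradient_integrable:
  fixes u :: "real^'d \<Rightarrow> real^'k"
  assumes "open \<Omega>" "has_weak_gradient \<Omega> u G" "test_function \<Omega> \<phi>"
  shows "integrable (lebesgue_on \<Omega>) (\<lambda>x. u x $ i * frechet_derivative \<phi> (at x) e)"
    and "integrable (lebesgue_on \<Omega>) (\<lambda>x. G x $ i $ j * \<phi> x)"
proof -
  obtain K where K: "compact K" "K \<subseteq> \<Omega>" "\<And>x. x \<notin> K \<Longrightarrow> \<phi> x = 0" "\<And>r. Ck_on r UNIV \<phi>"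
    "\<And>x h. x \<notin> K \<Longrightarrow> frechet_derivative \<phi> (at x) h = 0"
    using test_functionD[OF assms(3)] by blast
  have u: "locally_integrable \<Omega> (\<lambda>x. u x $ i)"
    using assms(2) by (intro locally_integrable_bounded_linear[OF bounded_linear_vec_nth])
      (auto simp: has_weak_gradient_def)
  have G: "locally_integrable \<Omega> (\<lambda>x. G x $ i $ j)"
    using assms(2) by (intro locally_integrable_bounded_linear[OF bounded_linear_matrix_entry])
      (auto simp: has_weak_gradient_def)
  show "integrable (lebesgue_on \<Omega>) (\<lambda>x. u x $ i * frechet_derivative \<phi> (at x) e)"
    using Ck_on_SucD(2)[OF K(4)[of "Suc 0"], of e]
    by (intro locally_integrable_mult_compact_support[OF assms(1) u _ K(1,2,5)]) simp
  show "integrable (lebesgue_on \<Omega>) (\<lambda>x. G x $ i $ j * \<phi> x)"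
    using K(4)[of 0] by (intro locally_integrable_mult_compact_support[OF assms(1) G _ K(1,2,3)]) simp
qed

lemma has_weak_gradient_linear_combination:
  fixes u w :: "real^'d \<Rightarrow> real^'k"
  assumes \<Omega>: "open \<Omega>" and u: "has_weak_gradient \<Omega> u G" and w: "has_weak_gradient \<Omega> w H"
  shows "has_weak_gradient \<Omega> (\<lambda>x. a *\<^sub>R u x + b *\<^sub>R w x) (\<lambda>x. a *\<^sub>R G x + b *\<^sub>R H x)"
  unfolding has_weak_gradient_def
proof (intro conjI allI impI)
  show "locally_integrable \<Omega> (\<lambda>x. a *\<^sub>R u x + b *\<^sub>R w x)" "locally_integrable \<Omega> (\<lambda>x. a *\<^sub>R G x + b *\<^sub>R H x)"
    using u w by (auto simp: has_weak_gradient_def intro!: locally_integrable_add locally_integrable_scaleR)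
  fix \<phi> :: "real^'d \<Rightarrow> real" and i j assume \<phi>: "test_function \<Omega> \<phi>"
  let ?D = "\<lambda>x. frechet_derivative \<phi> (at x) (axis j 1)"
  have "(\<integral>x. (a *\<^sub>R u x + b *\<^sub>R w x) $ i * ?D x \<partial>lebesgue_on \<Omega>)
      = (\<integral>x. a * (u x $ i * ?D x) + b * (w x $ i * ?D x) \<partial>lebesgue_on \<Omega>)"
    by (simp add: algebra_simps)
  also have "\<dots> = a * (\<integral>x. u x $ i * ?D x \<partial>lebesgue_on \<Omega>) + b * (\<integral>x. w x $ i * ?D x \<partial>lebesgue_on \<Omega>)"
    using has_weak_gradient_integrable(1)[OF \<Omega> u \<phi>] has_weak_gradient_integrable(1)[OF \<Omega> w \<phi>] by simp
  also have "\<dots> = - (a * (\<integral>x. G x $ i $ j * \<phi> x \<partial>lebesgue_on \<Omega>) + b * (\<integral>x. H x $ i $ j * \<phi> x \<partial>lebesgue_on \<Omega>))"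
    using u w \<phi> by (simp add: has_weak_gradient_def)
  also have "\<dots> = - (\<integral>x. a * (G x $ i $ j * \<phi> x) + b * (H x $ i $ j * \<phi> x) \<partial>lebesgue_on \<Omega>)"
    using has_weak_gradient_integrable(2)[OF \<Omega> u \<phi>] has_weak_gradient_integrable(2)[OF \<Omega> w \<phi>] by simp
  also have "\<dots> = - (\<integral>x. (a *\<^sub>R G x + b *\<^sub>R H x) $ i $ j * \<phi> x \<partial>lebesgue_on \<Omega>)"
    by (simp add: algebra_simps)
  finally show "(\<integral>x. (a *\<^sub>R u x + b *\<^sub>R w x) $ i * ?D x \<partial>lebesgue_on \<Omega>)
      = - (\<integral>x. (a *\<^sub>R G x + b *\<^sub>R H x) $ i $ j * \<phi> x \<partial>lebesgue_on \<Omega>)" .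
qed

lemma has_weak_gradient_diff:
  assumes "open \<Omega>" "has_weak_gradient \<Omega> u G" "has_weak_gradient \<Omega> w H"
  shows "has_weak_gradient \<Omega> (\<lambda>x. u x - w x) (\<lambda>x. G x - H x)"
  using has_weak_gradient_linear_combination[OF assms, of 1 "-1"] by simp

lemma has_weak_gradient_unique:
  fixes u :: "real^'d \<Rightarrow> real^'k"
  assumes \<Omega>: "open \<Omega>" and G: "has_weak_gradient \<Omega> u G" and H: "has_weak_gradient \<Omega> u H"
  shows "AE x in lebesgue_on \<Omega>. G x = H x"
proof -
  have "AE x in lebesgue_on \<Omega>. G x $ i $ j - H x $ i $ j = 0" for i j
  proof (rule fundamental_lemma_calculus_of_variations[OF \<Omega>])
    have "locally_integrable \<Omega> (\<lambda>x. G x + (-1) *\<^sub>R H x)"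
      using G H by (intro locally_integrable_add locally_integrable_scaleR) (auto simp: has_weak_gradient_def)
    from locally_integrable_bounded_linear[OF bounded_linear_matrix_entry[of i j] this]
    show "locally_integrable \<Omega> (\<lambda>x. G x $ i $ j - H x $ i $ j)" by simp
    fix \<phi> assume \<phi>: "test_function \<Omega> \<phi>"
    let ?I = "\<integral>x. u x $ i * frechet_derivative \<phi> (at x) (axis j 1) \<partial>lebesgue_on \<Omega>"
    have "?I = - (\<integral>x. G x $ i $ j * \<phi> x \<partial>lebesgue_on \<Omega>)" "?I = - (\<integral>x. H x $ i $ j * \<phi> x \<partial>lebesgue_on \<Omega>)"
      using G H \<phi> by (simp_all add: has_weak_gradient_def)
    then have "(\<integral>x. G x $ i $ j * \<phi> x \<partial>lebesgue_on \<Omega>) = (\<integral>x. H x $ i $ j * \<phi> x \<partial>lebesgue_on \<Omega>)"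
      by linarith
    then show "(\<integral>x. (G x $ i $ j - H x $ i $ j) * \<phi> x \<partial>lebesgue_on \<Omega>) = 0"
      using has_weak_gradient_integrable(2)[OF \<Omega> G \<phi>, of i j] has_weak_gradient_integrable(2)[OF \<Omega> H \<phi>, of i j]
      by (simp add: left_diff_distrib)
  qed
  then have "AE x in lebesgue_on \<Omega>. \<forall>i j. G x $ i $ j - H x $ i $ j = 0"
    by (simp add: AE_all_countable)
  then show ?thesis by (rule eventually_mono) (simp add: vec_eq_iff)
qed

lemma has_weak_gradient_AE_cong:
  fixes u :: "real^'d \<Rightarrow> real^'k"
  assumes \<Omega>: "open \<Omega>" and u: "has_weak_gradient \<Omega> u G"
    and uw: "AE x in lebesgue_on \<Omega>. u x = w x" and GH: "AE x in lebesgue_on \<Omega>. G x = H x"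
  shows "has_weak_gradient \<Omega> w H"
  unfolding has_weak_gradient_def
proof (intro conjI allI impI)
  have \<Omega>L: "\<Omega> \<in> sets lebesgue" using \<Omega> by auto
  show "locally_integrable \<Omega> w" "locally_integrable \<Omega> H"
    using u uw GH locally_integrable_AE_cong[OF \<Omega>L] by (auto simp: has_weak_gradient_def)
  fix \<phi> :: "real^'d \<Rightarrow> real" and i j assume \<phi>: "test_function \<Omega> \<phi>"
  let ?D = "\<lambda>x. frechet_derivative \<phi> (at x) (axis j 1)"
  have 1: "AE x in lebesgue_on \<Omega>. w x $ i * ?D x = u x $ i * ?D x" using uw by (rule eventually_mono) simp
  have 2: "AE x in lebesgue_on \<Omega>. H x $ i $ j * \<phi> x = G x $ i $ j * \<phi> x" using GH by (rule eventually_mono) simp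
  note m = has_weak_gradient_integrable[OF \<Omega> u \<phi>, THEN borel_measurable_integrable]
  have "(\<integral>x. w x $ i * ?D x \<partial>lebesgue_on \<Omega>) = (\<integral>x. u x $ i * ?D x \<partial>lebesgue_on \<Omega>)"
    by (rule integral_cong_AE[OF borel_measurable_lebesgue_on_AE_cong[OF \<Omega>L m(1) 1] m(1) 1])
  moreover have "(\<integral>x. H x $ i $ j * \<phi> x \<partial>lebesgue_on \<Omega>) = (\<integral>x. G x $ i $ j * \<phi> x \<partial>lebesgue_on \<Omega>)"
    by (rule integral_cong_AE[OF borel_measurable_lebesgue_on_AE_cong[OF \<Omega>L m(2) 2] m(2) 2])
  ultimately show "(\<integral>x. w x $ i * ?D x \<partial>lebesgue_on \<Omega>) = - (\<integral>x. H x $ i $ j * \<phi> x \<partial>lebesgue_on \<Omega>)"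
    using u \<phi> by (simp add: has_weak_gradient_def)
qed

lemma weak_gradient_AE_eq:
  assumes "open \<Omega>" "has_weak_gradient \<Omega> u G"
  shows "AE x in lebesgue_on \<Omega>. weak_gradient \<Omega> u x = G x"
  unfolding weak_gradient_def
  by (rule has_weak_gradient_unique[OF assms(1) someI[of "has_weak_gradient \<Omega> u", OF assms(2)] assms(2)])

lemma L1_limit_integral:
  fixes f :: "nat \<Rightarrow> 'a \<Rightarrow> 'b::{banach, second_countable_topology}"
  assumes "\<And>n. integrable M (f n)" "integrable M g" "(\<lambda>n. \<integral>\<^sup>+x. ennreal (norm (f n x - g x)) \<partial>M) \<longlonglongrightarrow> 0"
  shows "(\<lambda>n. integral\<^sup>L M (f n)) \<longlonglongrightarrow> integral\<^sup>L M g"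
proof -
  have "ennreal (norm (integral\<^sup>L M (f n) - integral\<^sup>L M g)) \<le> (\<integral>\<^sup>+x. ennreal (norm (f n x - g x)) \<partial>M)" for n
    using integral_norm_bound_ennreal[of M "\<lambda>x. f n x - g x"] assms(1,2) by simp
  then have "(\<lambda>n. ennreal (norm (integral\<^sup>L M (f n) - integral\<^sup>L M g))) \<longlonglongrightarrow> 0"
    by (intro tendsto_sandwich[OF _ _ tendsto_const assms(3)]) auto
  then have "(\<lambda>n. norm (integral\<^sup>L M (f n) - integral\<^sup>L M g)) \<longlonglongrightarrow> 0"
    by (simp add: ennreal_0[symmetric] del: ennreal_0)
  then show ?thesis by (simp add: tendsto_norm_zero_iff LIM_zero_iff)
qed

lemma L1_norm_limit_mult_bounded:
  fixes f :: "nat \<Rightarrow> 'a \<Rightarrow> real" and F :: "nat \<Rightarrow> 'a \<Rightarrow> 'b::{real_normed_vector, second_countable_topology}"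
  assumes "\<And>n x. norm (f n x - g x) \<le> norm (F n x - G x)" "\<And>x. \<bar>\<psi> x\<bar> \<le> B" "0 \<le> B"
    "(\<lambda>n. \<integral>\<^sup>+x. ennreal (norm (F n x - G x)) \<partial>M) \<longlonglongrightarrow> 0"
    "\<And>n. F n \<in> borel_measurable M" "G \<in> borel_measurable M"
  shows "(\<lambda>n. \<integral>\<^sup>+x. ennreal (norm (f n x * \<psi> x - g x * \<psi> x)) \<partial>M) \<longlonglongrightarrow> 0"
proof (rule tendsto_sandwich[OF _ _ tendsto_const])
  show "(\<lambda>n. ennreal B * (\<integral>\<^sup>+x. ennreal (norm (F n x - G x)) \<partial>M)) \<longlonglongrightarrow> 0"
    using ennreal_tendsto_cmult[OF _ assms(4), of "ennreal B"] by simp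
  have "(\<integral>\<^sup>+x. ennreal (norm (f n x * \<psi> x - g x * \<psi> x)) \<partial>M) \<le> (\<integral>\<^sup>+x. ennreal B * ennreal (norm (F n x - G x)) \<partial>M)" for n
  proof (rule nn_integral_mono)
    fix x
    have "norm (f n x * \<psi> x - g x * \<psi> x) \<le> B * norm (F n x - G x)"
      using mult_mono[OF assms(2)[of x] assms(1)[of n x]] assms(3)
      by (simp add: left_diff_distrib[symmetric] abs_mult mult.commute[of "\<bar>\<psi> x\<bar>"])
    then show "ennreal (norm (f n x * \<psi> x - g x * \<psi> x)) \<le> ennreal B * ennreal (norm (F n x - G x))"
      using assms(3) by (simp add: ennreal_mult[symmetric] ennreal_leI)
  qed
  then show "\<forall>\<^sub>F n in sequentially. (\<integral>\<^sup>+x. ennreal (norm (f n x * \<psi> x - g x * \<psi> x)) \<partial>M) \<le> ennreal B * (\<integral>\<^sup>+x. ennreal (norm (F n x - G x)) \<partial>M)"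
    using assms(5,6) by (simp add: nn_integral_cmult)
qed simp

text \<open>
  Test functions and their derivatives are bounded, so both sides of the defining identity pass to
  the limit under convergence in $L^1$.
\<close>

lemma has_weak_gradient_L1_limit:
  fixes u :: "real^'d \<Rightarrow> real^'k"
  assumes \<Omega>: "open \<Omega>" and un: "\<And>n. has_weak_gradient \<Omega> (un n) (Gn n)"
    and m: "\<And>n. un n \<in> borel_measurable (lebesgue_on \<Omega>)" "\<And>n. Gn n \<in> borel_measurable (lebesgue_on \<Omega>)"
    and u: "integrable (lebesgue_on \<Omega>) u" and G: "integrable (lebesgue_on \<Omega>) G"
    and lu: "(\<lambda>n. \<integral>\<^sup>+x. ennreal (norm (un n x - u x)) \<partial>lebesgue_on \<Omega>) \<longlonglongrightarrow> 0"
    and lG: "(\<lambda>n. \<integral>\<^sup>+x. ennreal (norm (Gn n x - G x)) \<partial>lebesgue_on \<Omega>) \<longlonglongrightarrow> 0"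
  shows "has_weak_gradient \<Omega> u G"
  unfolding has_weak_gradient_def
proof (intro conjI allI impI)
  have \<Omega>L: "\<Omega> \<in> sets lebesgue" using \<Omega> by auto
  show lu': "locally_integrable \<Omega> u" and lG': "locally_integrable \<Omega> G"
    using integrable_imp_locally_integrable[OF \<Omega>L] u G by auto
  fix \<phi> :: "real^'d \<Rightarrow> real" and i j assume \<phi>: "test_function \<Omega> \<phi>"
  let ?D = "\<lambda>x. frechet_derivative \<phi> (at x) (axis j 1)"
  obtain K where K: "compact K" "K \<subseteq> \<Omega>" "\<And>x. x \<notin> K \<Longrightarrow> \<phi> x = 0" "\<And>r. Ck_on r UNIV \<phi>"
    "\<And>x h. x \<notin> K \<Longrightarrow> frechet_derivative \<phi> (at x) h = 0"
    using test_functionD[OF \<phi>] by blast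
  have cD: "continuous_on UNIV ?D" using Ck_on_SucD(2)[OF K(4)[of "Suc 0"]] by simp
  have c\<phi>: "continuous_on UNIV \<phi>" using K(4)[of 0] by simp
  obtain B where B: "0 \<le> B" "\<And>x. norm (?D x) \<le> B" using compact_support_bounded[OF cD K(1,5)] by blast
  obtain C where C: "0 \<le> C" "\<And>x. norm (\<phi> x) \<le> C" using compact_support_bounded[OF c\<phi> K(1,3)] by blast
  have 1: "(\<lambda>n. \<integral>x. un n x $ i * ?D x \<partial>lebesgue_on \<Omega>) \<longlonglongrightarrow> (\<integral>x. u x $ i * ?D x \<partial>lebesgue_on \<Omega>)"
  proof (rule L1_limit_integral)
    show "integrable (lebesgue_on \<Omega>) (\<lambda>x. un n x $ i * ?D x)" for n
      by (rule has_weak_gradient_integrable(1)[OF \<Omega> un \<phi>])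
    show "integrable (lebesgue_on \<Omega>) (\<lambda>x. u x $ i * ?D x)"
      by (rule locally_integrable_mult_compact_support[OF \<Omega> locally_integrable_bounded_linear[OF bounded_linear_vec_nth lu'] cD K(1,2,5)])
    show "(\<lambda>n. \<integral>\<^sup>+x. ennreal (norm (un n x $ i * ?D x - u x $ i * ?D x)) \<partial>lebesgue_on \<Omega>) \<longlonglongrightarrow> 0"
      using B u m by (intro L1_norm_limit_mult_bounded[OF _ _ _ lu]) (auto simp: component_le_norm_cart[of "_ - _", simplified])
  qed
  have 2: "(\<lambda>n. \<integral>x. Gn n x $ i $ j * \<phi> x \<partial>lebesgue_on \<Omega>) \<longlonglongrightarrow> (\<integral>x. G x $ i $ j * \<phi> x \<partial>lebesgue_on \<Omega>)"
  proof (rule L1_limit_integral)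
    show "integrable (lebesgue_on \<Omega>) (\<lambda>x. Gn n x $ i $ j * \<phi> x)" for n
      by (rule has_weak_gradient_integrable(2)[OF \<Omega> un \<phi>])
    show "integrable (lebesgue_on \<Omega>) (\<lambda>x. G x $ i $ j * \<phi> x)"
      by (rule locally_integrable_mult_compact_support[OF \<Omega> locally_integrable_bounded_linear[OF bounded_linear_matrix_entry lG'] c\<phi> K(1,2,3)])
    have "norm (A $ i $ j - A' $ i $ j) \<le> norm (A - A')" for A A' :: "real^'d^'k"
      using abs_matrix_entry_le_norm[of "A - A'" i j] by simp
    then show "(\<lambda>n. \<integral>\<^sup>+x. ennreal (norm (Gn n x $ i $ j * \<phi> x - G x $ i $ j * \<phi> x)) \<partial>lebesgue_on \<Omega>) \<longlonglongrightarrow> 0"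
      using C G m by (intro L1_norm_limit_mult_bounded[OF _ _ _ lG]) auto
  qed
  have "(\<lambda>n. \<integral>x. un n x $ i * ?D x \<partial>lebesgue_on \<Omega>) = (\<lambda>n. - (\<integral>x. Gn n x $ i $ j * \<phi> x \<partial>lebesgue_on \<Omega>))"
    using un \<phi> by (simp add: has_weak_gradient_def)
  then show "(\<integral>x. u x $ i * ?D x \<partial>lebesgue_on \<Omega>) = - (\<integral>x. G x $ i $ j * \<phi> x \<partial>lebesgue_on \<Omega>)"
    using LIMSEQ_unique[OF 1] tendsto_minus[OF 2] by simp
qed

section \<open>The chain rule in $W^{1,1}$\<close>

text \<open>
  The direction \<open>Df(x) h\<close> in which \<open>Q\<close> is differentiated varies with \<open>x\<close>; expanding it in a basis
  reduces continuity to that of the derivatives of \<open>Q\<close> in fixed directions.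
\<close>

lemma Ck_on_1_compose:
  fixes f :: "'a::real_normed_vector \<Rightarrow> 'b::euclidean_space"
  assumes S: "open S" and f: "Ck_on 1 S f" and Q: "Ck_on 1 UNIV Q"
  shows "Ck_on 1 S (\<lambda>x. Q (f x))"
proof -
  have f': "Ck_on (Suc 0) S f" and Q': "Ck_on (Suc 0) UNIV Q" using f Q by simp_all
  have "Ck_on (Suc 0) S (\<lambda>x. Q (f x))"
  proof (rule Ck_on_SucI[OF S])
    show "((\<lambda>x. Q (f x)) has_derivative (\<lambda>h. frechet_derivative Q (at (f x)) (frechet_derivative f (at x) h))) (at x)"
      if "x \<in> S" for x
      by (rule has_derivative_compose[OF Ck_on_SucD(1)[OF f' that] Ck_on_SucD(1)[OF Q' UNIV_I]])
    fix h
    let ?D = "\<lambda>x. frechet_derivative f (at x) h"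
    have lin: "linear (frechet_derivative Q (at y))" for y
      by (rule has_derivative_linear[OF Ck_on_SucD(1)[OF Q' UNIV_I]])
    have "frechet_derivative Q (at (f x)) (?D x) = (\<Sum>b\<in>Basis. (?D x \<bullet> b) *\<^sub>R frechet_derivative Q (at (f x)) b)" for x
      by (subst euclidean_representation[of "?D x", symmetric])
        (simp only: linear_sum[OF lin] linear_scale[OF lin])
    moreover have "continuous_on S (\<lambda>x. \<Sum>b\<in>Basis. (?D x \<bullet> b) *\<^sub>R frechet_derivative Q (at (f x)) b)"
    proof (intro continuous_intros)
      show "continuous_on S ?D" using Ck_on_SucD(2)[OF f'] by simp
      show "continuous_on S (\<lambda>x. frechet_derivative Q (at (f x)) b)" for b
        by (rule continuous_on_compose2[OF _ Ck_on_continuous_on[OF f]]) (use Ck_on_SucD(2)[OF Q'] in auto)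
    qed
    ultimately show "Ck_on 0 S (\<lambda>x. frechet_derivative Q (at (f x)) (?D x))" by simp
  qed
  then show ?thesis by simp
qed

definition jacobi_matrix :: "(real^'m \<Rightarrow> real^'n) \<Rightarrow> real^'m \<Rightarrow> real^'m^'n" where
  "jacobi_matrix f x = jacobian f (at x)"

lemma jacobi_matrix_entry: "jacobi_matrix f x $ i $ j = frechet_derivative f (at x) (axis j 1) $ i"
  by (simp add: jacobi_matrix_def jacobian_def matrix_def)

lemma continuous_on_jacobi_matrix:
  assumes "Ck_on 1 V h"
  shows "continuous_on V (jacobi_matrix h)"
proof -
  have h: "Ck_on (Suc 0) V h" using assms by simp
  have "continuous_on V (\<lambda>x. \<chi> i j. frechet_derivative h (at x) (axis j 1) $ i)"
    using Ck_on_SucD(2)[OF h]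
    by (intro continuous_on_vec_lambda continuous_on_component) simp
  then show ?thesis by (simp add: jacobi_matrix_def[abs_def] jacobian_def matrix_def)
qed

lemma norm_matrix_le_entries:
  fixes A :: "real^'d^'k"
  assumes "\<And>i j. \<bar>A $ i $ j\<bar> \<le> c"
  shows "norm A \<le> real CARD('k) * real CARD('d) * c"
proof -
  have "norm A \<le> (\<Sum>i\<in>UNIV. norm (A $ i))" unfolding norm_vec_def by (intro L2_set_le_sum) simp
  also have "\<dots> \<le> (\<Sum>i\<in>(UNIV::'k set). real CARD('d) * c)"
  proof (rule sum_mono)
    fix i
    have "norm (A $ i) \<le> (\<Sum>j\<in>UNIV. \<bar>A $ i $ j\<bar>)" by (rule norm_le_l1_cart)
    also have "\<dots> \<le> (\<Sum>j\<in>(UNIV::'d set). c)" using assms by (intro sum_mono)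
    finally show "norm (A $ i) \<le> real CARD('d) * c" by simp
  qed
  finally show ?thesis by simp
qed

lemma norm_matrix_mult_le:
  fixes A :: "real^'m^'k" and B :: "real^'d^'m"
  assumes "\<And>i l. \<bar>A $ i $ l\<bar> \<le> b"
  shows "norm (A ** B) \<le> real CARD('k) * real CARD('d) * real CARD('m) * b * norm B"
proof -
  have "\<bar>(A ** B) $ i $ j\<bar> \<le> real CARD('m) * b * norm B" for i j
  proof -
    have "\<bar>(A ** B) $ i $ j\<bar> \<le> (\<Sum>l\<in>UNIV. \<bar>A $ i $ l * B $ l $ j\<bar>)"
      by (simp add: matrix_matrix_mult_def sum_abs)
    also have "\<dots> \<le> (\<Sum>l\<in>(UNIV::'m set). b * norm B)"
      unfolding abs_mult using assms abs_matrix_entry_le_norm[of B]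
      by (intro sum_mono mult_mono) (auto intro: order_trans[OF abs_ge_zero])
    finally show ?thesis by simp
  qed
  from norm_matrix_le_entries[OF this] show ?thesis by (simp add: mult.assoc)
qed

lemma continuous_on_matrix_mult:
  fixes f :: "'a::topological_space \<Rightarrow> real^'m^'k" and g :: "'a \<Rightarrow> real^'d^'m"
  assumes "continuous_on S f" "continuous_on S g"
  shows "continuous_on S (\<lambda>x. f x ** g x)"
  unfolding matrix_matrix_mult_def
  using assms by (intro continuous_on_vec_lambda continuous_on_sum continuous_on_mult continuous_on_component)

text \<open>
  The three estimates on which the chain rule rests; one constant for all keeps later bounds short.
\<close>

lemma C2_compact_support_jacobi_matrix_bounds:
  fixes Q :: "real^'k \<Rightarrow> real^'m"
  assumes Q: "Ck_on 2 UNIV Q" "compact C" "\<And>y. y \<notin> C \<Longrightarrow> Q y = 0"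
  obtains K where "0 \<le> K" "\<And>y z. norm (Q y - Q z) \<le> K * norm (y - z)"
    "\<And>y (A :: real^'d^'k). norm (jacobi_matrix Q y ** A) \<le> K * norm A"
    "\<And>y z (A :: real^'d^'k). norm ((jacobi_matrix Q y - jacobi_matrix Q z) ** A) \<le> K * norm (y - z) * norm A"
proof -
  have Q1: "Ck_on 1 UNIV Q" by (rule Ck_on_le[OF Q(1)]) simp
  then have Q1': "Ck_on (Suc 0) UNIV Q" by simp
  obtain B where B: "0 \<le> B" "\<And>y h. norm (frechet_derivative Q (at y) h) \<le> B * norm h"
    using C1_compact_support_derivative_bound[OF Q1 Q(2,3)] by blast
  obtain L where L: "0 \<le> L" "\<And>x y h. norm (frechet_derivative Q (at x) h - frechet_derivative Q (at y) h) \<le> L * norm (x - y) * norm h"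
    using C2_compact_support_derivative_Lipschitz[OF Q] by blast
  have lip: "norm (Q x - Q y) \<le> B * norm (x - y)" for x y
    by (rule differentiable_bound[of UNIV Q "\<lambda>x. frechet_derivative Q (at x)"])
      (use B Ck_on_SucD(1)[OF Q1'] in \<open>auto intro!: onorm_le\<close>)
  define c where "c = real CARD('m) * real CARD('d) * real CARD('k)"
  have c: "0 \<le> c" by (simp add: c_def)
  have jacB: "norm (jacobi_matrix Q y ** A) \<le> c * B * norm A" for y and A :: "real^'d^'k"
    unfolding c_def
  proof (rule norm_matrix_mult_le)
    fix i l
    show "\<bar>jacobi_matrix Q y $ i $ l\<bar> \<le> B"
      using component_le_norm_cart[of "frechet_derivative Q (at y) (axis l 1)" i] B(2)[of y "axis l 1"]
      by (simp add: jacobi_matrix_entry norm_axis_1)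
  qed
  have jacL: "norm ((jacobi_matrix Q y - jacobi_matrix Q z) ** A) \<le> c * (L * norm (y - z)) * norm A" for y z and A :: "real^'d^'k"
    unfolding c_def
  proof (rule norm_matrix_mult_le)
    fix i l
    show "\<bar>(jacobi_matrix Q y - jacobi_matrix Q z) $ i $ l\<bar> \<le> L * norm (y - z)"
      using component_le_norm_cart[of "frechet_derivative Q (at y) (axis l 1) - frechet_derivative Q (at z) (axis l 1)" i]
        L(2)[of y "axis l 1" z]
      by (simp add: jacobi_matrix_entry norm_axis_1)
  qed
  define K where "K = B + c * B + c * L"
  have K: "B \<le> K" "c * B \<le> K" "c * L \<le> K" using B(1) L(1) c by (auto simp: K_def)
  show ?thesis
  proof (rule that[of K])
    show "0 \<le> K" using B(1) K(1) by simp
    show "norm (Q y - Q z) \<le> K * norm (y - z)" for y z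
      using lip[of y z] mult_right_mono[OF K(1) norm_ge_zero[of "y - z"]] by linarith
    show "norm (jacobi_matrix Q y ** A) \<le> K * norm A" for y and A :: "real^'d^'k"
      using jacB[of y A] mult_right_mono[OF K(2) norm_ge_zero[of A]] by linarith
    show "norm ((jacobi_matrix Q y - jacobi_matrix Q z) ** A) \<le> K * norm (y - z) * norm A" for y z and A :: "real^'d^'k"
      using jacL[of y z A] mult_right_mono[OF K(3), of "norm (y - z) * norm A"] by (simp add: mult.assoc)
  qed
qed

lemma norm_add_scaleR_diff_le:
  fixes a b a' b' :: "'z::real_normed_vector"
  shows "norm (a + c *\<^sub>R b - (a' + c *\<^sub>R b')) \<le> norm (a - a') + \<bar>c\<bar> * norm (b - b')"
proof -
  have eq: "a + c *\<^sub>R b - (a' + c *\<^sub>R b') = (a - a') + c *\<^sub>R (b - b')" by (simp add: algebra_simps)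
  show ?thesis unfolding eq
    using norm_triangle_ineq[of "a - a'" "c *\<^sub>R (b - b')"] by simp
qed

text \<open>
  Approximation in $W^{1,1}$ by functions in $C^1(\overline\Omega)$, with an explicit gradient \<open>G\<close> of
  the limit instead of the one chosen by \<open>weak_gradient\<close>. The definition of the trace supplies such
  approximations, so that the chain rule can be derived without mollifying.
\<close>

definition C1_approx ::
  "(real^'d) set \<Rightarrow> (nat \<Rightarrow> real^'d \<Rightarrow> real^'k) \<Rightarrow> (real^'d \<Rightarrow> real^'k) \<Rightarrow> (real^'d \<Rightarrow> real^'d^'k) \<Rightarrow> bool" where
  "C1_approx \<Omega> \<phi> u G \<longleftrightarrow> (\<forall>j. C1_closure \<Omega> (\<phi> j)) \<and>
     integrable (lebesgue_on \<Omega>) u \<and> integrable (lebesgue_on \<Omega>) G \<and>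
     (\<lambda>j. \<integral>\<^sup>+x. ennreal (norm (\<phi> j x - u x)) \<partial>lebesgue_on \<Omega>) \<longlonglongrightarrow> 0 \<and>
     (\<lambda>j. \<integral>\<^sup>+x. ennreal (norm (jacobi_matrix (\<phi> j) x - G x)) \<partial>lebesgue_on \<Omega>) \<longlonglongrightarrow> 0"

lemma Lp_norm_1: "Lp_norm N 1 u = (\<integral>\<^sup>+x. ennreal (norm (u x)) \<partial>N)"
proof (cases "(\<integral>\<^sup>+x. ennreal (norm (u x)) \<partial>N) = \<infinity>")
  case False
  then show ?thesis by (simp add: Lp_norm_def Let_def top.not_eq_extremum ennreal_enn2real_if)
qed (simp add: Lp_norm_def Let_def)

lemma smooth_closure_imp_C1_closure: "smooth_closure \<Omega> f \<Longrightarrow> C1_closure \<Omega> f"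
  unfolding smooth_closure_def C1_closure_def smooth_on_def by blast

lemma C1_closure_add:
  assumes "C1_closure \<Omega> f" "C1_closure \<Omega> g"
  shows "C1_closure \<Omega> (\<lambda>x. f x + c *\<^sub>R g x)"
proof -
  obtain V h W k where "open V" "closure \<Omega> \<subseteq> V" "Ck_on 1 V h" "\<forall>x\<in>closure \<Omega>. f x = h x"
    "open W" "closure \<Omega> \<subseteq> W" "Ck_on 1 W k" "\<forall>x\<in>closure \<Omega>. g x = k x"
    using assms unfolding C1_closure_def by blast
  then show ?thesis unfolding C1_closure_def
    by (intro exI[of _ "V \<inter> W"] exI[of _ "\<lambda>x. h x + c *\<^sub>R k x"])
      (auto intro!: Ck_on_add Ck_on_scaleR Ck_on_const elim: Ck_on_subset simp del: One_nat_def)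
qed

lemma C1_closure_compose:
  fixes f :: "'a::euclidean_space \<Rightarrow> 'b::euclidean_space"
  assumes "C1_closure \<Omega> f" "Ck_on 1 UNIV Q"
  shows "C1_closure \<Omega> (\<lambda>x. Q (f x))"
proof -
  obtain V h where "open V" "closure \<Omega> \<subseteq> V" "Ck_on 1 V h" "\<forall>x\<in>closure \<Omega>. f x = h x"
    using assms unfolding C1_closure_def by blast
  then show ?thesis unfolding C1_closure_def
    by (intro exI[of _ V] exI[of _ "\<lambda>x. Q (h x)"])
      (auto intro!: Ck_on_1_compose assms(2) simp del: One_nat_def)
qed

lemma C1_closure_has_derivative:
  assumes "open \<Omega>" "C1_closure \<Omega> f" "x \<in> \<Omega>"
  shows "(f has_derivative frechet_derivative f (at x)) (at x)"
proof -
  obtain V h where h: "open V" "closure \<Omega> \<subseteq> V" "Ck_on (Suc 0) V h" "\<forall>x\<in>closure \<Omega>. f x = h x"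
    using assms unfolding C1_closure_def One_nat_def by blast
  have "h differentiable (at x)"
    using Ck_on_SucD(1)[OF h(3), of x] h(2) closure_subset assms(3) differentiable_def by blast
  then have "f differentiable (at x)"
    using differentiable_cong_open[OF assms(1,3), of f h] h(4) closure_subset by blast
  then show ?thesis by (simp add: frechet_derivative_works)
qed

lemma jacobi_matrix_add_scaleR:
  assumes "open \<Omega>" "C1_closure \<Omega> f" "C1_closure \<Omega> g" "x \<in> \<Omega>"
  shows "jacobi_matrix (\<lambda>x. f x + c *\<^sub>R g x) x = jacobi_matrix f x + c *\<^sub>R jacobi_matrix g x"
proof -
  have "((\<lambda>x. f x + c *\<^sub>R g x) has_derivative (\<lambda>h. frechet_derivative f (at x) h + c *\<^sub>R frechet_derivative g (at x) h)) (at x)"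
    using assms by (intro has_derivative_add has_derivative_scaleR_right C1_closure_has_derivative)
  from frechet_derivative_at[OF this, symmetric] show ?thesis
    by (simp add: vec_eq_iff jacobi_matrix_entry)
qed

lemma jacobi_matrix_compose:
  assumes "open \<Omega>" "C1_closure \<Omega> f" "x \<in> \<Omega>" "Ck_on 1 UNIV Q"
  shows "jacobi_matrix (\<lambda>x. Q (f x)) x = jacobi_matrix Q (f x) ** jacobi_matrix f x"
proof -
  note f = C1_closure_has_derivative[OF assms(1-3)]
  have Q: "(Q has_derivative frechet_derivative Q (at (f x))) (at (f x))"
    using assms(4) Ck_on_SucD(1)[of 0 UNIV Q] by simp
  have "frechet_derivative (\<lambda>x. Q (f x)) (at x) = frechet_derivative Q (at (f x)) \<circ> frechet_derivative f (at x)"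
    using frechet_derivative_at[OF has_derivative_compose[OF f Q]] by (simp add: o_def)
  then show ?thesis
    unfolding jacobi_matrix_def jacobian_def by (simp add: matrix_compose has_derivative_linear[OF f] has_derivative_linear[OF Q])
qed

context
  fixes \<Omega> :: "(real^'d) set"
  assumes open_\<Omega>: "open \<Omega>" and bounded_\<Omega>: "bounded \<Omega>"
begin

lemma \<Omega>_lebesgue: "\<Omega> \<in> sets lebesgue"
  using open_\<Omega> by auto

lemma finite_measure_\<Omega>: "finite_measure (lebesgue_on \<Omega>)"
  by (rule finite_measure_lebesgue_on) (use open_\<Omega> bounded_\<Omega> in \<open>simp add: lmeasurable_open\<close>)

lemma integrable_continuous_on_closure:
  fixes g :: "real^'d \<Rightarrow> 'b::euclidean_space"
  assumes "continuous_on (closure \<Omega>) g"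
  shows "integrable (lebesgue_on \<Omega>) g"
proof -
  have "compact (g ` closure \<Omega>)"
    using assms bounded_\<Omega> by (intro compact_continuous_image) (simp_all add: compact_closure)
  then obtain B where B: "\<And>x. x \<in> closure \<Omega> \<Longrightarrow> norm (g x) \<le> B"
    using compact_imp_bounded by (fastforce simp: bounded_iff)
  show ?thesis
  proof (rule finite_measure.integrable_const_bound[OF finite_measure_\<Omega>])
    show "AE x in lebesgue_on \<Omega>. norm (g x) \<le> B"
      using B closure_subset by (intro AE_I2) auto
    show "g \<in> borel_measurable (lebesgue_on \<Omega>)"
      by (rule continuous_imp_measurable_on_sets_lebesgue[OF continuous_on_subset[OF assms closure_subset] \<Omega>_lebesgue])
  qed
qed

lemma C1_closure_bounded:
  assumes "C1_closure \<Omega> f"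
  obtains S where "\<And>x. x \<in> \<Omega> \<Longrightarrow> norm (f x) \<le> S" "\<And>x. x \<in> \<Omega> \<Longrightarrow> norm (jacobi_matrix f x) \<le> S"
proof -
  obtain V h where h: "open V" "closure \<Omega> \<subseteq> V" "Ck_on 1 V h" "\<forall>x\<in>closure \<Omega>. f x = h x"
    using assms unfolding C1_closure_def by blast
  have "compact (h ` closure \<Omega>)"
    using bounded_\<Omega> continuous_on_subset[OF Ck_on_continuous_on[OF h(3)] h(2)]
    by (intro compact_continuous_image) (simp_all add: compact_closure)
  then obtain S1 where S1: "\<And>x. x \<in> closure \<Omega> \<Longrightarrow> norm (h x) \<le> S1"
    using compact_imp_bounded by (fastforce simp: bounded_iff)
  have "compact (jacobi_matrix h ` closure \<Omega>)"
    using bounded_\<Omega> continuous_on_subset[OF continuous_on_jacobi_matrix[OF h(3)] h(2)]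
    by (intro compact_continuous_image) (simp_all add: compact_closure)
  then obtain S2 where S2: "\<And>x. x \<in> closure \<Omega> \<Longrightarrow> norm (jacobi_matrix h x) \<le> S2"
    using compact_imp_bounded by (fastforce simp: bounded_iff)
  have "norm (f x) \<le> max S1 S2 \<and> norm (jacobi_matrix f x) \<le> max S1 S2" if "x \<in> \<Omega>" for x
  proof -
    have x: "x \<in> closure \<Omega>" using that closure_subset by blast
    have "frechet_derivative f (at x) = frechet_derivative h (at x)"
      using h(4) closure_subset by (intro frechet_derivative_cong_open[OF open_\<Omega> that]) blast
    then show ?thesis using S1[OF x] S2[OF x] h(4) x by (simp add: jacobi_matrix_def jacobian_def le_max_iff_disj)
  qed
  then show ?thesis by (intro that[of "max S1 S2"]) auto
qed

lemma C1_closure_weak_gradient: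
  assumes "C1_closure \<Omega> f"
  shows "integrable (lebesgue_on \<Omega>) f" "integrable (lebesgue_on \<Omega>) (jacobi_matrix f)"
    "has_weak_gradient \<Omega> f (jacobi_matrix f)"
proof -
  obtain V h where h: "open V" "closure \<Omega> \<subseteq> V" "Ck_on 1 V h" "\<forall>x\<in>closure \<Omega>. f x = h x"
    using assms unfolding C1_closure_def by blast
  have \<Omega>V: "\<Omega> \<subseteq> V" using h(2) closure_subset by blast
  have ch: "continuous_on (closure \<Omega>) h" "continuous_on (closure \<Omega>) (jacobi_matrix h)"
    using Ck_on_continuous_on[OF h(3)] continuous_on_jacobi_matrix[OF h(3)] h(2) continuous_on_subset by blast+
  have fh: "f x = h x" "jacobi_matrix f x = jacobi_matrix h x" if "x \<in> \<Omega>" for x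
  proof -
    show "f x = h x" using h(4) that closure_subset by blast
    have "frechet_derivative f (at x) = frechet_derivative h (at x)"
      using h(4) closure_subset by (intro frechet_derivative_cong_open[OF open_\<Omega> that]) blast
    then show "jacobi_matrix f x = jacobi_matrix h x" by (simp add: jacobi_matrix_def jacobian_def)
  qed
  have ih: "integrable (lebesgue_on \<Omega>) h" "integrable (lebesgue_on \<Omega>) (jacobi_matrix h)"
    by (intro integrable_continuous_on_closure ch)+
  have "has_weak_gradient \<Omega> h (jacobi_matrix h)"
    unfolding has_weak_gradient_def
  proof (intro conjI allI impI)
    show "locally_integrable \<Omega> h" "locally_integrable \<Omega> (jacobi_matrix h)"
      using ih by (auto intro: integrable_imp_locally_integrable[OF \<Omega>_lebesgue])
    fix \<phi> :: "real^'d \<Rightarrow> real" and i j assume \<phi>: "test_function \<Omega> \<phi>"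
    have hi: "Ck_on 1 V (\<lambda>x. h x $ i)"
      by (rule Ck_on_bounded_linear_compose[OF h(1) bounded_linear_vec_nth h(3)])
    have "frechet_derivative (\<lambda>x. h x $ i) (at x) e = frechet_derivative h (at x) e $ i" if "x \<in> \<Omega>" for x e
    proof -
      have "(h has_derivative frechet_derivative h (at x)) (at x)"
        using h(3) that \<Omega>V Ck_on_SucD(1)[of 0 V h x] by auto
      from frechet_derivative_at[OF bounded_linear.has_derivative[OF bounded_linear_vec_nth this]]
      show ?thesis by metis
    qed
    then have "(\<integral>x. frechet_derivative (\<lambda>x. h x $ i) (at x) (axis j 1) * \<phi> x \<partial>lebesgue_on \<Omega>)
        = (\<integral>x. jacobi_matrix h x $ i $ j * \<phi> x \<partial>lebesgue_on \<Omega>)"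
      by (intro Bochner_Integration.integral_cong) (auto simp: jacobi_matrix_entry)
    then show "(\<integral>x. h x $ i * frechet_derivative \<phi> (at x) (axis j 1) \<partial>lebesgue_on \<Omega>)
        = - (\<integral>x. jacobi_matrix h x $ i $ j * \<phi> x \<partial>lebesgue_on \<Omega>)"
      using integration_by_parts_test_function[OF hi h(1) \<Omega>V open_\<Omega> \<phi>] by simp
  qed
  then show "has_weak_gradient \<Omega> f (jacobi_matrix f)"
    by (rule has_weak_gradient_AE_cong[OF open_\<Omega>]) (auto simp: fh intro!: AE_I2)
  show "integrable (lebesgue_on \<Omega>) f"
    by (subst Bochner_Integration.integrable_cong[OF refl, of _ f h]) (simp_all add: fh ih)
  show "integrable (lebesgue_on \<Omega>) (jacobi_matrix f)"
    by (subst Bochner_Integration.integrable_cong[OF refl, of _ "jacobi_matrix f" "jacobi_matrix h"])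
      (simp_all add: fh ih)
qed

lemma C1_approx_has_weak_gradient:
  assumes "C1_approx \<Omega> \<phi> u G"
  shows "has_weak_gradient \<Omega> u G"
proof (rule has_weak_gradient_L1_limit[OF open_\<Omega>, where un=\<phi> and Gn="\<lambda>n. jacobi_matrix (\<phi> n)"])
  show "has_weak_gradient \<Omega> (\<phi> n) (jacobi_matrix (\<phi> n))" "\<phi> n \<in> borel_measurable (lebesgue_on \<Omega>)"
    "jacobi_matrix (\<phi> n) \<in> borel_measurable (lebesgue_on \<Omega>)" for n
    using assms C1_closure_weak_gradient[of "\<phi> n"] unfolding C1_approx_def by auto
qed (use assms in \<open>auto simp: C1_approx_def\<close>)

lemma C1_approx_const: "C1_closure \<Omega> f \<Longrightarrow> C1_approx \<Omega> (\<lambda>j. f) f (jacobi_matrix f)"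
  using C1_closure_weak_gradient unfolding C1_approx_def by auto

lemma C1_approx_AE_cong:
  assumes "C1_approx \<Omega> \<phi> u G" "AE x in lebesgue_on \<Omega>. u x = w x" "AE x in lebesgue_on \<Omega>. G x = H x"
  shows "C1_approx \<Omega> \<phi> w H"
proof -
  have i: "integrable (lebesgue_on \<Omega>) u" "integrable (lebesgue_on \<Omega>) G" using assms by (auto simp: C1_approx_def)
  have ae: "AE x in lebesgue_on \<Omega>. w x = u x" "AE x in lebesgue_on \<Omega>. H x = G x"
    using assms(2,3) by (auto elim: eventually_mono)
  note m = borel_measurable_lebesgue_on_AE_cong[OF \<Omega>_lebesgue borel_measurable_integrable[OF i(1)] ae(1)]
    borel_measurable_lebesgue_on_AE_cong[OF \<Omega>_lebesgue borel_measurable_integrable[OF i(2)] ae(2)]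
  have "integrable (lebesgue_on \<Omega>) w" "integrable (lebesgue_on \<Omega>) H"
    using integrable_cong_AE[OF borel_measurable_integrable[OF i(1)] m(1) assms(2)]
      integrable_cong_AE[OF borel_measurable_integrable[OF i(2)] m(2) assms(3)] i by auto
  moreover have "(\<integral>\<^sup>+x. ennreal (norm (\<phi> j x - u x)) \<partial>lebesgue_on \<Omega>) = (\<integral>\<^sup>+x. ennreal (norm (\<phi> j x - w x)) \<partial>lebesgue_on \<Omega>)" for j
    by (rule nn_integral_cong_AE) (use assms(2) in \<open>auto elim: eventually_mono\<close>)
  moreover have "(\<integral>\<^sup>+x. ennreal (norm (jacobi_matrix (\<phi> j) x - G x)) \<partial>lebesgue_on \<Omega>) = (\<integral>\<^sup>+x. ennreal (norm (jacobi_matrix (\<phi> j) x - H x)) \<partial>lebesgue_on \<Omega>)" for j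
    by (rule nn_integral_cong_AE) (use assms(3) in \<open>auto elim: eventually_mono\<close>)
  ultimately show ?thesis using assms(1) by (simp add: C1_approx_def)
qed

lemma tendsto_0_nn_integral_bound:
  assumes "\<And>j. AE x in M. norm (f j x) \<le> a * norm (g j x) + b * norm (h j x)" "0 \<le> a" "0 \<le> b"
    "\<And>j. g j \<in> borel_measurable M" "\<And>j. h j \<in> borel_measurable M"
    "(\<lambda>j. \<integral>\<^sup>+x. ennreal (norm (g j x)) \<partial>M) \<longlonglongrightarrow> 0" "(\<lambda>j. \<integral>\<^sup>+x. ennreal (norm (h j x)) \<partial>M) \<longlonglongrightarrow> 0"
  shows "(\<lambda>j. \<integral>\<^sup>+x. ennreal (norm (f j x)) \<partial>M) \<longlonglongrightarrow> 0"
proof (rule tendsto_sandwich[OF _ _ tendsto_const])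
  let ?b = "\<lambda>j. ennreal a * (\<integral>\<^sup>+x. ennreal (norm (g j x)) \<partial>M) + ennreal b * (\<integral>\<^sup>+x. ennreal (norm (h j x)) \<partial>M)"
  show "?b \<longlonglongrightarrow> 0"
    using tendsto_add[OF ennreal_tendsto_cmult[OF _ assms(6), of "ennreal a"] ennreal_tendsto_cmult[OF _ assms(7), of "ennreal b"]]
    by simp
  have "(\<integral>\<^sup>+x. ennreal (norm (f j x)) \<partial>M) \<le> ?b j" for j
  proof -
    have "(\<integral>\<^sup>+x. ennreal (norm (f j x)) \<partial>M) \<le> (\<integral>\<^sup>+x. ennreal a * ennreal (norm (g j x)) + ennreal b * ennreal (norm (h j x)) \<partial>M)"
      using assms(1)[of j]
      by (intro nn_integral_mono_AE)
        (erule eventually_mono, simp add: ennreal_mult[symmetric] ennreal_plus[symmetric] assms(2,3) ennreal_leI del: ennreal_plus)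
    also have "\<dots> = ?b j"
      using assms(4)[of j] assms(5)[of j] by (simp add: nn_integral_add nn_integral_cmult)
    finally show ?thesis .
  qed
  then show "\<forall>\<^sub>F j in sequentially. (\<integral>\<^sup>+x. ennreal (norm (f j x)) \<partial>M) \<le> ?b j" by simp
qed simp

lemma C1_approx_measurable:
  assumes "C1_approx \<Omega> \<phi> u G"
  shows "(\<lambda>x. \<phi> j x - u x) \<in> borel_measurable (lebesgue_on \<Omega>)"
    "(\<lambda>x. jacobi_matrix (\<phi> j) x - G x) \<in> borel_measurable (lebesgue_on \<Omega>)"
  using assms C1_closure_weak_gradient[of "\<phi> j"] unfolding C1_approx_def
  by (auto intro!: borel_measurable_diff)

lemma C1_approx_add_scaleR:
  assumes u: "C1_approx \<Omega> \<phi> u G" and w: "C1_approx \<Omega> \<psi> w H"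
  shows "C1_approx \<Omega> (\<lambda>j x. \<phi> j x + c *\<^sub>R \<psi> j x) (\<lambda>x. u x + c *\<^sub>R w x) (\<lambda>x. G x + c *\<^sub>R H x)"
proof -
  note \<phi> = u[unfolded C1_approx_def] and \<psi> = w[unfolded C1_approx_def]
  have jac: "jacobi_matrix (\<lambda>x. \<phi> j x + c *\<^sub>R \<psi> j x) x = jacobi_matrix (\<phi> j) x + c *\<^sub>R jacobi_matrix (\<psi> j) x" if "x \<in> \<Omega>" for j x
    using \<phi> \<psi> that by (intro jacobi_matrix_add_scaleR[OF open_\<Omega>]) auto
  have "(\<lambda>j. \<integral>\<^sup>+x. ennreal (norm (\<phi> j x + c *\<^sub>R \<psi> j x - (u x + c *\<^sub>R w x))) \<partial>lebesgue_on \<Omega>) \<longlonglongrightarrow> 0"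
    by (rule tendsto_0_nn_integral_bound[where a=1 and b="\<bar>c\<bar>" and g="\<lambda>j x. \<phi> j x - u x" and h="\<lambda>j x. \<psi> j x - w x"])
      (use \<phi> \<psi> C1_approx_measurable[OF u] C1_approx_measurable[OF w] in \<open>auto intro!: AE_I2 norm_add_scaleR_diff_le\<close>)
  moreover have "(\<lambda>j. \<integral>\<^sup>+x. ennreal (norm (jacobi_matrix (\<lambda>x. \<phi> j x + c *\<^sub>R \<psi> j x) x - (G x + c *\<^sub>R H x))) \<partial>lebesgue_on \<Omega>) \<longlonglongrightarrow> 0"
    by (rule tendsto_0_nn_integral_bound[where a=1 and b="\<bar>c\<bar>" and g="\<lambda>j x. jacobi_matrix (\<phi> j) x - G x" and h="\<lambda>j x. jacobi_matrix (\<psi> j) x - H x"])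
      (use \<phi> \<psi> C1_approx_measurable[OF u] C1_approx_measurable[OF w] in \<open>auto intro!: AE_I2 norm_add_scaleR_diff_le simp: jac\<close>)
  ultimately show ?thesis
    using \<phi> \<psi> unfolding C1_approx_def by (auto intro!: C1_closure_add)
qed

text \<open>
  With \<open>D\<close> for Jacobi matrices,
  \<open>D(Q \<circ> \<phi>\<^sub>j) - DQ(u) G = DQ(\<phi>\<^sub>j) (D\<phi>\<^sub>j - G) + (DQ(\<phi>\<^sub>j) - DQ(u)) G\<close>. The first term is small because
  \<open>DQ\<close> is bounded, the second because \<open>DQ\<close> is Lipschitz and \<open>G\<close> is bounded. Boundedness of \<open>G\<close> thus
  makes $L^1$ convergence of \<open>\<phi>\<^sub>j\<close> sufficient, without subsequences converging almost everywhere.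
\<close>

lemma C1_approx_compose:
  fixes Q :: "real^'k \<Rightarrow> real^'m"
  assumes u: "C1_approx \<Omega> \<phi> u G"
    and Q: "Ck_on 2 UNIV Q" "compact C" "\<And>y. y \<notin> C \<Longrightarrow> Q y = 0"
    and R: "AE x in lebesgue_on \<Omega>. norm (G x) \<le> R"
  shows "C1_approx \<Omega> (\<lambda>j x. Q (\<phi> j x)) (\<lambda>x. Q (u x)) (\<lambda>x. jacobi_matrix Q (u x) ** G x)"
proof -
  have Q1: "Ck_on 1 UNIV Q" by (rule Ck_on_le[OF Q(1)]) simp
  obtain K where K: "0 \<le> K" "\<And>y z. norm (Q y - Q z) \<le> K * norm (y - z)"
      "\<And>y (A :: real^'d^'k). norm (jacobi_matrix Q y ** A) \<le> K * norm A"
      "\<And>y z (A :: real^'d^'k). norm ((jacobi_matrix Q y - jacobi_matrix Q z) ** A) \<le> K * norm (y - z) * norm A"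
    by (rule C2_compact_support_jacobi_matrix_bounds[OF Q]) (assumption, rule that)
  note \<phi> = u[unfolded C1_approx_def]
  have R0: "AE x in lebesgue_on \<Omega>. norm (G x) \<le> max 0 R" using R by (rule eventually_mono) simp
  have jac: "jacobi_matrix (\<lambda>x. Q (\<phi> j x)) x = jacobi_matrix Q (\<phi> j x) ** jacobi_matrix (\<phi> j) x" if "x \<in> \<Omega>" for j x
    using \<phi> that Q1 by (intro jacobi_matrix_compose[OF open_\<Omega>]) auto
  have cQ: "continuous_on UNIV Q" by (rule Ck_on_continuous_on[OF Q1])
  have um: "u \<in> borel_measurable (lebesgue_on \<Omega>)" and Gm: "G \<in> borel_measurable (lebesgue_on \<Omega>)"
    using \<phi> by auto
  have iQ: "integrable (lebesgue_on \<Omega>) (\<lambda>x. Q (u x))"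
  proof -
    obtain D where "\<And>y. norm (Q y) \<le> D" using compact_support_bounded[OF cQ Q(2,3)] by blast
    then show ?thesis
      by (intro finite_measure.integrable_const_bound[OF finite_measure_\<Omega>, of _ D] AE_I2
          measurable_compose[OF um borel_measurable_continuous_onI[OF cQ]])
  qed
  have JG: "(\<lambda>x. jacobi_matrix Q (u x) ** G x) \<in> borel_measurable (lebesgue_on \<Omega>)"
    by (rule borel_measurable_continuous_Pair[OF um Gm])
      (intro continuous_on_matrix_mult continuous_on_compose2[OF continuous_on_jacobi_matrix[OF Q1]] continuous_intros, auto)
  have iJ: "integrable (lebesgue_on \<Omega>) (\<lambda>x. jacobi_matrix Q (u x) ** G x)"
  proof (rule Bochner_Integration.integrable_bound[OF _ JG])
    show "integrable (lebesgue_on \<Omega>) (\<lambda>x. K *\<^sub>R G x)" using \<phi> by simp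
    show "AE x in lebesgue_on \<Omega>. norm (jacobi_matrix Q (u x) ** G x) \<le> norm (K *\<^sub>R G x)"
      using K(1,3) by (intro AE_I2) simp
  qed
  have "(\<lambda>j. \<integral>\<^sup>+x. ennreal (norm (Q (\<phi> j x) - Q (u x))) \<partial>lebesgue_on \<Omega>) \<longlonglongrightarrow> 0"
    by (rule tendsto_0_nn_integral_bound[where a=K and b=0 and g="\<lambda>j x. \<phi> j x - u x" and h="\<lambda>j x. \<phi> j x - u x"])
      (use \<phi> K C1_approx_measurable[OF u] in auto)
  moreover have "(\<lambda>j. \<integral>\<^sup>+x. ennreal (norm (jacobi_matrix (\<lambda>x. Q (\<phi> j x)) x - jacobi_matrix Q (u x) ** G x)) \<partial>lebesgue_on \<Omega>) \<longlonglongrightarrow> 0"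
  proof (rule tendsto_0_nn_integral_bound[where a=K and b="K * max 0 R" and g="\<lambda>j x. jacobi_matrix (\<phi> j) x - G x" and h="\<lambda>j x. \<phi> j x - u x"])
    show "AE x in lebesgue_on \<Omega>. norm (jacobi_matrix (\<lambda>x. Q (\<phi> j x)) x - jacobi_matrix Q (u x) ** G x)
        \<le> K * norm (jacobi_matrix (\<phi> j) x - G x) + K * max 0 R * norm (\<phi> j x - u x)" for j
      using R0 AE_space[of "lebesgue_on \<Omega>"]
    proof eventually_elim
      case (elim x)
      then have x: "x \<in> \<Omega>" by simp
      have "jacobi_matrix (\<lambda>x. Q (\<phi> j x)) x - jacobi_matrix Q (u x) ** G x
        = jacobi_matrix Q (\<phi> j x) ** (jacobi_matrix (\<phi> j) x - G x) + (jacobi_matrix Q (\<phi> j x) - jacobi_matrix Q (u x)) ** G x"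
        unfolding jac[OF x]
        by (simp add: vec_eq_iff matrix_matrix_mult_def sum_subtractf algebra_simps)
      then have "norm (jacobi_matrix (\<lambda>x. Q (\<phi> j x)) x - jacobi_matrix Q (u x) ** G x)
        \<le> K * norm (jacobi_matrix (\<phi> j) x - G x) + K * norm (\<phi> j x - u x) * norm (G x)"
        using norm_triangle_mono[OF K(3,4)] by metis
      also have "K * norm (\<phi> j x - u x) * norm (G x) \<le> K * norm (\<phi> j x - u x) * max 0 R"
        using elim K(1) by (intro mult_left_mono) auto
      finally show ?case by (simp add: mult_ac)
    qed
  qed (use \<phi> K(1) C1_approx_measurable[OF u] in auto)
  ultimately show ?thesis
    using \<phi> iQ iJ C1_closure_compose[OF _ Q1] unfolding C1_approx_def by auto
qed

lemma sobolev_norm_1_C1_closure_diff: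
  assumes "C1_closure \<Omega> f" "has_weak_gradient \<Omega> u G"
  shows "sobolev_norm \<Omega> 1 (\<lambda>x. f x - u x) =
    (\<integral>\<^sup>+x. ennreal (norm (f x - u x)) \<partial>lebesgue_on \<Omega>) + (\<integral>\<^sup>+x. ennreal (norm (jacobi_matrix f x - G x)) \<partial>lebesgue_on \<Omega>)"
proof -
  have "AE x in lebesgue_on \<Omega>. weak_gradient \<Omega> (\<lambda>x. f x - u x) x = jacobi_matrix f x - G x"
    by (intro weak_gradient_AE_eq[OF open_\<Omega>] has_weak_gradient_diff[OF open_\<Omega>] C1_closure_weak_gradient assms)
  then have "AE x in lebesgue_on \<Omega>. ennreal (norm (weak_gradient \<Omega> (\<lambda>x. f x - u x) x)) = ennreal (norm (jacobi_matrix f x - G x))"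
    by (rule eventually_mono) simp
  then show ?thesis unfolding sobolev_norm_def Lp_norm_1 by (simp add: nn_integral_cong_AE)
qed

text \<open>
  The weak gradient of \<open>\<phi>\<^sub>j - u\<close> is determined almost everywhere, so the norm in the definition of
  the trace is the one measured by \<open>C1_approx\<close>.
\<close>

lemma C1_approx_iff_sobolev_norm:
  assumes "integrable (lebesgue_on \<Omega>) u" "integrable (lebesgue_on \<Omega>) G" "has_weak_gradient \<Omega> u G"
    "\<And>j. C1_closure \<Omega> (\<phi> j)"
  shows "C1_approx \<Omega> \<phi> u G \<longleftrightarrow> (\<lambda>j. sobolev_norm \<Omega> 1 (\<lambda>x. \<phi> j x - u x)) \<longlonglongrightarrow> 0"
proof -
  let ?a = "\<lambda>j. \<integral>\<^sup>+x. ennreal (norm (\<phi> j x - u x)) \<partial>lebesgue_on \<Omega>"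
  let ?b = "\<lambda>j. \<integral>\<^sup>+x. ennreal (norm (jacobi_matrix (\<phi> j) x - G x)) \<partial>lebesgue_on \<Omega>"
  have "(\<lambda>j. ?a j + ?b j) \<longlonglongrightarrow> 0 \<longleftrightarrow> ?a \<longlonglongrightarrow> 0 \<and> ?b \<longlonglongrightarrow> 0"
  proof
    assume l: "(\<lambda>j. ?a j + ?b j) \<longlonglongrightarrow> 0"
    have "?a \<longlonglongrightarrow> 0" by (rule tendsto_sandwich[OF _ _ tendsto_const l]) (auto intro!: always_eventually)
    moreover have "?b \<longlonglongrightarrow> 0" by (rule tendsto_sandwich[OF _ _ tendsto_const l]) (auto intro!: always_eventually)
    ultimately show "?a \<longlonglongrightarrow> 0 \<and> ?b \<longlonglongrightarrow> 0" ..
  next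
    assume "?a \<longlonglongrightarrow> 0 \<and> ?b \<longlonglongrightarrow> 0"
    then show "(\<lambda>j. ?a j + ?b j) \<longlonglongrightarrow> 0" using tendsto_add[of ?a 0 sequentially ?b 0] by simp
  qed
  then show ?thesis
    using assms by (simp add: C1_approx_def sobolev_norm_1_C1_closure_diff[OF assms(4,3)])
qed

text \<open>
  If \<open>\<phi>\<^sub>j\<close> approximates \<open>u\<close> and has boundary values tending to \<open>w\<close>, then
  \<open>\<chi>\<^sub>j = \<phi>\<^sub>j + Q(\<phi>\<^sub>j + t v) - Q(\<phi>\<^sub>j)\<close> equals \<open>\<phi>\<^sub>j\<close> where \<open>v\<close> vanishes, in particular on \<open>\<Gamma>\<close>, and tends
  to \<open>u + Q(u + t v) - Q(u) = Q(u + t v)\<close> in $W^{1,1}$. Hence the variation keeps the trace. The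
  more obvious approximation \<open>Q(\<phi>\<^sub>j + t v)\<close> has boundary values \<open>Q(\<phi>\<^sub>j)\<close>, and comparing their limit with
  \<open>w\<close> would require knowing that \<open>w\<close> is fixed by \<open>Q\<close>.

  Since \<open>Q(u)\<close> is \<open>u\<close>, uniqueness of weak gradients also yields \<open>DQ(u) G = G\<close>.
\<close>

lemma projected_variation_trace_and_gradient:
  fixes u v :: "real^'d \<Rightarrow> real^'k"
    and t :: real and m :: "real^'d \<Rightarrow> real^'k" and H :: "real^'d \<Rightarrow> real^'d^'k"
  assumes tr: "has_trace_on \<Omega> \<Gamma> u w"
    and u: "integrable (lebesgue_on \<Omega>) u" "integrable (lebesgue_on \<Omega>) G" "has_weak_gradient \<Omega> u G"
    and R: "AE x in lebesgue_on \<Omega>. norm (G x) \<le> R"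
    and Q: "Ck_on 2 UNIV Q" "compact C" "\<And>y. y \<notin> C \<Longrightarrow> Q y = 0"
    and Qu: "AE x in lebesgue_on \<Omega>. Q (u x) = u x"
    and v: "C1_closure \<Omega> v" "\<And>x. x \<in> \<Gamma> \<Longrightarrow> v x = 0"
    and m_def: "m = (\<lambda>x. Q (u x + t *\<^sub>R v x))"
    and H_def: "H = (\<lambda>x. jacobi_matrix Q (u x + t *\<^sub>R v x) ** (G x + t *\<^sub>R jacobi_matrix v x))"
  shows "has_trace_on \<Omega> \<Gamma> m w" "integrable (lebesgue_on \<Omega>) m" "integrable (lebesgue_on \<Omega>) H"
    "has_weak_gradient \<Omega> m H" "AE x in lebesgue_on \<Omega>. jacobi_matrix Q (u x) ** G x = G x"
proof -
  obtain \<phi> where \<phi>: "\<And>j. C1_closure \<Omega> (\<phi> j)" "(\<lambda>j. sobolev_norm \<Omega> 1 (\<lambda>x. \<phi> j x - u x)) \<longlonglongrightarrow> 0"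
      "(\<lambda>j. \<integral>\<^sup>+x\<in>\<Gamma>. ennreal (norm (\<phi> j x - w x)) \<partial>surface_measure) \<longlonglongrightarrow> 0"
    and w: "set_integrable surface_measure \<Gamma> w"
    using tr unfolding has_trace_on_def by auto
  have au: "C1_approx \<Omega> \<phi> u G" using C1_approx_iff_sobolev_norm[OF u \<phi>(1)] \<phi>(2) by simp
  have auv: "C1_approx \<Omega> (\<lambda>j x. \<phi> j x + t *\<^sub>R v x) (\<lambda>x. u x + t *\<^sub>R v x) (\<lambda>x. G x + t *\<^sub>R jacobi_matrix v x)"
    by (rule C1_approx_add_scaleR[OF au C1_approx_const[OF v(1)]])
  obtain R' where R': "AE x in lebesgue_on \<Omega>. norm (G x + t *\<^sub>R jacobi_matrix v x) \<le> R'"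
  proof -
    obtain S where S: "\<And>x. x \<in> \<Omega> \<Longrightarrow> norm (jacobi_matrix v x) \<le> S"
      by (rule C1_closure_bounded[OF v(1)]) (rule that)
    have "AE x in lebesgue_on \<Omega>. norm (G x + t *\<^sub>R jacobi_matrix v x) \<le> R + \<bar>t\<bar> * S"
      using R AE_space[of "lebesgue_on \<Omega>"]
      by eventually_elim (auto intro!: norm_triangle_mono mult_left_mono S)
    then show ?thesis by (rule that)
  qed
  have aQ: "C1_approx \<Omega> (\<lambda>j x. Q (\<phi> j x)) (\<lambda>x. Q (u x)) (\<lambda>x. jacobi_matrix Q (u x) ** G x)"
    by (rule C1_approx_compose[OF au Q R])
  have am: "C1_approx \<Omega> (\<lambda>j x. Q (\<phi> j x + t *\<^sub>R v x)) m H"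
    unfolding m_def H_def by (rule C1_approx_compose[OF auv Q R'])
  show "has_weak_gradient \<Omega> m H" by (rule C1_approx_has_weak_gradient[OF am])
  show im: "integrable (lebesgue_on \<Omega>) m" "integrable (lebesgue_on \<Omega>) H"
    using am by (auto simp: C1_approx_def)
  show JG: "AE x in lebesgue_on \<Omega>. jacobi_matrix Q (u x) ** G x = G x"
    by (rule has_weak_gradient_unique[OF open_\<Omega> has_weak_gradient_AE_cong[OF open_\<Omega> C1_approx_has_weak_gradient[OF aQ] Qu] u(3)]) simp
  \<comment> \<open>The factors \<open>1\<close> and \<open>-1\<close> match the form \<open>f + c g\<close> of \<open>C1_approx_add_scaleR\<close>.\<close>
  let ?\<chi> = "\<lambda>j x. (\<phi> j x + 1 *\<^sub>R Q (\<phi> j x + t *\<^sub>R v x)) + (-1) *\<^sub>R Q (\<phi> j x)"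
  have "C1_approx \<Omega> ?\<chi> (\<lambda>x. (u x + 1 *\<^sub>R m x) + (-1) *\<^sub>R Q (u x)) (\<lambda>x. (G x + 1 *\<^sub>R H x) + (-1) *\<^sub>R (jacobi_matrix Q (u x) ** G x))"
    by (rule C1_approx_add_scaleR[OF C1_approx_add_scaleR[OF au am] aQ])
  then have a\<chi>: "C1_approx \<Omega> ?\<chi> m H"
    by (rule C1_approx_AE_cong) (use Qu JG in \<open>auto elim: eventually_mono\<close>)
  then have C\<chi>: "C1_closure \<Omega> (?\<chi> j)" for j unfolding C1_approx_def by blast
  have "(\<lambda>j. sobolev_norm \<Omega> 1 (\<lambda>x. ?\<chi> j x - m x)) \<longlonglongrightarrow> 0"
    using C1_approx_iff_sobolev_norm[OF im C1_approx_has_weak_gradient[OF am] C\<chi>] a\<chi> by simp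
  moreover have "(\<integral>\<^sup>+x\<in>\<Gamma>. ennreal (norm (?\<chi> j x - w x)) \<partial>surface_measure) = (\<integral>\<^sup>+x\<in>\<Gamma>. ennreal (norm (\<phi> j x - w x)) \<partial>surface_measure)" for j
    by (rule nn_integral_cong) (auto simp: v(2) indicator_def)
  ultimately show "has_trace_on \<Omega> \<Gamma> m w"
    unfolding has_trace_on_def using w C\<chi> \<phi>(3) by (intro conjI exI[of _ ?\<chi>]) simp_all
qed

end

section \<open>Differentiation under the integral sign\<close>

text \<open>
  The mean value theorem bounds the difference quotients by \<open>B\<close>, so dominated convergence applies.
  The derivative \<open>f'\<close> is measurable in \<open>x\<close> as a limit of difference quotients almost everywhere.
\<close>

lemma integral_has_real_derivative_dominated:
  fixes f f' :: "'a::euclidean_space \<Rightarrow> real \<Rightarrow> real"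
  assumes S: "S \<in> lmeasurable"
    and I: "open I" "convex I" "t0 \<in> I"
    and int: "\<And>t. t \<in> I \<Longrightarrow> integrable (lebesgue_on S) (\<lambda>x. f x t)"
    and der: "AE x in lebesgue_on S. \<forall>t\<in>I. (f x has_real_derivative f' x t) (at t) \<and> \<bar>f' x t\<bar> \<le> B"
  shows "((\<lambda>t. \<integral>x. f x t \<partial>lebesgue_on S) has_real_derivative (\<integral>x. f' x t0 \<partial>lebesgue_on S)) (at t0)"
    and "integrable (lebesgue_on S) (\<lambda>x. f' x t0)"
proof -
  have SL: "S \<in> sets lebesgue" using S by (rule fmeasurableD)
  have fm: "finite_measure (lebesgue_on S)" by (rule finite_measure_lebesgue_on[OF S])
  let ?q = "\<lambda>x s. (f x s - f x t0) / (s - t0)"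
  have atI: "at t0 within I = at t0" by (rule at_within_open[OF I(3,1)])
  have lim: "AE x in lebesgue_on S. (?q x \<longlongrightarrow> f' x t0) (at t0 within I)"
    using der
  proof (rule eventually_mono)
    fix x assume "\<forall>t\<in>I. (f x has_real_derivative f' x t) (at t) \<and> \<bar>f' x t\<bar> \<le> B"
    then have "(f x has_real_derivative f' x t0) (at t0)" using I(3) by blast
    then show "(?q x \<longlongrightarrow> f' x t0) (at t0 within I)"
      unfolding atI has_field_derivative_iff .
  qed
  have lip: "AE x in lebesgue_on S. \<forall>s\<in>I - {t0}. \<bar>?q x s\<bar> \<le> B"
    using der
  proof (rule eventually_mono, intro ballI)
    fix x s
    assume d: "\<forall>t\<in>I. (f x has_real_derivative f' x t) (at t) \<and> \<bar>f' x t\<bar> \<le> B" and s: "s \<in> I - {t0}"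
    have "norm (f x s - f x t0) \<le> B * norm (s - t0)"
      by (rule field_differentiable_bound[OF I(2), of _ "f' x"])
        (use d s I(3) in \<open>auto intro: has_field_derivative_at_within\<close>)
    then show "\<bar>?q x s\<bar> \<le> B" using s by (simp add: divide_le_eq)
  qed
  have qm: "(\<lambda>x. ?q x s) \<in> borel_measurable (lebesgue_on S)" if "s \<in> I" for s
    using int[OF that] int[OF I(3)] by measurable
  \<comment> \<open>A sequence inside \<open>I\<close>, along which \<open>f' x t0\<close> is a countable limit and hence measurable.\<close>
  obtain X0 where X0: "\<And>i. X0 i \<in> I - {t0}" "X0 \<longlonglongrightarrow> t0"
  proof -
    have "t0 islimpt I" using I(1,3) interior_limit_point interior_open by metis
    then show ?thesis using that unfolding islimpt_sequential by blast
  qed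
  have m': "(\<lambda>x. f' x t0) \<in> borel_measurable (lebesgue_on S)"
  proof (rule borel_measurable_lebesgue_on_AE_cong[OF SL])
    show "(\<lambda>x. lim (\<lambda>i. ?q x (X0 i))) \<in> borel_measurable (lebesgue_on S)"
      using X0(1) by (intro borel_measurable_lim_metric qm) auto
    show "AE x in lebesgue_on S. f' x t0 = lim (\<lambda>i. ?q x (X0 i))"
      using lim
    proof (rule eventually_mono)
      fix x assume "(?q x \<longlongrightarrow> f' x t0) (at t0 within I)"
      then have "(\<lambda>i. ?q x (X0 i)) \<longlonglongrightarrow> f' x t0"
        using X0 unfolding tendsto_at_iff_sequentially o_def by blast
      then show "f' x t0 = lim (\<lambda>i. ?q x (X0 i))" by (rule limI[symmetric])
    qed
  qed
  show "integrable (lebesgue_on S) (\<lambda>x. f' x t0)"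
  proof (rule finite_measure.integrable_const_bound[OF fm _ m', of B])
    show "AE x in lebesgue_on S. norm (f' x t0) \<le> B"
      using der by (rule eventually_mono) (use I(3) in simp)
  qed
  have "((\<lambda>s. ((\<integral>x. f x s \<partial>lebesgue_on S) - (\<integral>x. f x t0 \<partial>lebesgue_on S)) / (s - t0)) \<longlongrightarrow> (\<integral>x. f' x t0 \<partial>lebesgue_on S)) (at t0 within I)"
    unfolding tendsto_at_iff_sequentially
  proof (intro allI impI)
    fix X assume X: "\<forall>i. X i \<in> I - {t0}" "X \<longlonglongrightarrow> t0"
    have "(\<lambda>i. \<integral>x. ?q x (X i) \<partial>lebesgue_on S) \<longlonglongrightarrow> (\<integral>x. f' x t0 \<partial>lebesgue_on S)"
    proof (rule integral_dominated_convergence[where w="\<lambda>_. B"])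
      show "AE x in lebesgue_on S. (\<lambda>i. ?q x (X i)) \<longlonglongrightarrow> f' x t0"
        using lim by (rule eventually_mono) (use X in \<open>unfold tendsto_at_iff_sequentially o_def, blast\<close>)
      show "AE x in lebesgue_on S. norm (?q x (X i)) \<le> B" for i
        using lip by (rule eventually_mono) (use X in simp)
      show "(\<lambda>x. ?q x (X i)) \<in> borel_measurable (lebesgue_on S)" for i using X qm by auto
      show "integrable (lebesgue_on S) (\<lambda>_. B)" by (rule finite_measure.integrable_const[OF fm])
    qed (rule m')
    moreover have "(\<integral>x. ?q x (X i) \<partial>lebesgue_on S) = ((\<integral>x. f x (X i) \<partial>lebesgue_on S) - (\<integral>x. f x t0 \<partial>lebesgue_on S)) / (X i - t0)" for i
      using int[of "X i"] int[OF I(3)] X by simp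
    ultimately show "((\<lambda>s. ((\<integral>x. f x s \<partial>lebesgue_on S) - (\<integral>x. f x t0 \<partial>lebesgue_on S)) / (s - t0)) \<circ> X) \<longlonglongrightarrow> (\<integral>x. f' x t0 \<partial>lebesgue_on S)"
      by (simp only: o_def)
  qed
  then show "((\<lambda>t. \<integral>x. f x t \<partial>lebesgue_on S) has_real_derivative (\<integral>x. f' x t0 \<partial>lebesgue_on S)) (at t0)"
    unfolding atI has_field_derivative_iff .
qed

section \<open>Curves with uniformly bounded second derivatives\<close>

text \<open>
  Curves \<open>t \<mapsto> f x t\<close> that are twice differentiable, with bounds that do not depend on \<open>x\<close>: exactly what
  is needed to differentiate \<open>\<integral> f x t dx\<close> twice under the integral sign. The bound on \<open>f\<close> itself makes
  products stay in the class.
\<close>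

definition C2_family :: "'x set \<Rightarrow> real set \<Rightarrow> ('x \<Rightarrow> real \<Rightarrow> 'b::real_normed_vector) \<Rightarrow> bool" where
  "C2_family X I f \<longleftrightarrow> (\<exists>f' f'' B. \<forall>x\<in>X. \<forall>t\<in>I.
     (f x has_vector_derivative f' x t) (at t) \<and> (f' x has_vector_derivative f'' x t) (at t) \<and>
     norm (f x t) \<le> B \<and> norm (f' x t) \<le> B \<and> norm (f'' x t) \<le> B)"

lemma C2_familyI:
  assumes "\<And>x t. x \<in> X \<Longrightarrow> t \<in> I \<Longrightarrow> (f x has_vector_derivative f' x t) (at t)"
    "\<And>x t. x \<in> X \<Longrightarrow> t \<in> I \<Longrightarrow> (f' x has_vector_derivative f'' x t) (at t)"
    "\<And>x t. x \<in> X \<Longrightarrow> t \<in> I \<Longrightarrow> norm (f x t) \<le> B0"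
    "\<And>x t. x \<in> X \<Longrightarrow> t \<in> I \<Longrightarrow> norm (f' x t) \<le> B1"
    "\<And>x t. x \<in> X \<Longrightarrow> t \<in> I \<Longrightarrow> norm (f'' x t) \<le> B2"
  shows "C2_family X I f"
  unfolding C2_family_def
  by (rule exI[of _ f'], rule exI[of _ f''], rule exI[of _ "max B0 (max B1 B2)"])
    (use assms in \<open>auto simp: le_max_iff_disj\<close>)

lemma C2_familyE:
  assumes "C2_family X I f"
  obtains f' f'' B where "0 \<le> B"
    "\<And>x t. x \<in> X \<Longrightarrow> t \<in> I \<Longrightarrow> (f x has_vector_derivative f' x t) (at t)"
    "\<And>x t. x \<in> X \<Longrightarrow> t \<in> I \<Longrightarrow> (f' x has_vector_derivative f'' x t) (at t)"
    "\<And>x t. x \<in> X \<Longrightarrow> t \<in> I \<Longrightarrow> norm (f x t) \<le> B"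
    "\<And>x t. x \<in> X \<Longrightarrow> t \<in> I \<Longrightarrow> norm (f' x t) \<le> B"
    "\<And>x t. x \<in> X \<Longrightarrow> t \<in> I \<Longrightarrow> norm (f'' x t) \<le> B"
proof -
  obtain f' f'' B where *: "\<forall>x\<in>X. \<forall>t\<in>I.
     (f x has_vector_derivative f' x t) (at t) \<and> (f' x has_vector_derivative f'' x t) (at t) \<and>
     norm (f x t) \<le> B \<and> norm (f' x t) \<le> B \<and> norm (f'' x t) \<le> B"
    using assms unfolding C2_family_def by blast
  show ?thesis
    by (rule that[of "max 0 B" f' f'']) (use * in \<open>auto simp: le_max_iff_disj\<close>)
qed

lemma C2_family_affine:
  assumes "\<And>x. x \<in> X \<Longrightarrow> norm (a x) \<le> A" "\<And>x. x \<in> X \<Longrightarrow> norm (b x) \<le> B" "\<And>t. t \<in> I \<Longrightarrow> \<bar>t\<bar> \<le> D"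
  shows "C2_family X I (\<lambda>x t. a x + t *\<^sub>R b x)"
proof (rule C2_familyI[where f'="\<lambda>x t. b x" and f''="\<lambda>x t. 0" and ?B1.0=B and ?B2.0=0])
  fix x t assume x: "x \<in> X" "t \<in> I"
  show "((\<lambda>t. a x + t *\<^sub>R b x) has_vector_derivative b x) (at t)"
    by (auto intro!: derivative_eq_intros)
  show "norm (a x + t *\<^sub>R b x) \<le> A + D * B"
    using assms(1,2)[OF x(1)] assms(3)[OF x(2)] abs_ge_zero[of t]
    by (intro norm_triangle_mono) (simp, unfold norm_scaleR, intro mult_mono, auto)
qed (use assms in auto)

lemma C2_family_add:
  assumes "C2_family X I f" "C2_family X I g"
  shows "C2_family X I (\<lambda>x t. f x t + g x t)"
proof -
  obtain f' f'' B where f: "0 \<le> B"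
    "\<And>x t. x \<in> X \<Longrightarrow> t \<in> I \<Longrightarrow> (f x has_vector_derivative f' x t) (at t)"
    "\<And>x t. x \<in> X \<Longrightarrow> t \<in> I \<Longrightarrow> (f' x has_vector_derivative f'' x t) (at t)"
    "\<And>x t. x \<in> X \<Longrightarrow> t \<in> I \<Longrightarrow> norm (f x t) \<le> B"
    "\<And>x t. x \<in> X \<Longrightarrow> t \<in> I \<Longrightarrow> norm (f' x t) \<le> B"
    "\<And>x t. x \<in> X \<Longrightarrow> t \<in> I \<Longrightarrow> norm (f'' x t) \<le> B" by (rule C2_familyE[OF assms(1)]) (rule that)
  obtain g' g'' C where g: "0 \<le> C"
    "\<And>x t. x \<in> X \<Longrightarrow> t \<in> I \<Longrightarrow> (g x has_vector_derivative g' x t) (at t)"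
    "\<And>x t. x \<in> X \<Longrightarrow> t \<in> I \<Longrightarrow> (g' x has_vector_derivative g'' x t) (at t)"
    "\<And>x t. x \<in> X \<Longrightarrow> t \<in> I \<Longrightarrow> norm (g x t) \<le> C"
    "\<And>x t. x \<in> X \<Longrightarrow> t \<in> I \<Longrightarrow> norm (g' x t) \<le> C"
    "\<And>x t. x \<in> X \<Longrightarrow> t \<in> I \<Longrightarrow> norm (g'' x t) \<le> C" by (rule C2_familyE[OF assms(2)]) (rule that)
  show ?thesis
    by (rule C2_familyI[where f'="\<lambda>x t. f' x t + g' x t" and f''="\<lambda>x t. f'' x t + g'' x t" and ?B0.0="B + C" and ?B1.0="B + C" and ?B2.0="B + C"])
      (use f g in \<open>auto intro!: has_vector_derivative_add norm_triangle_mono\<close>)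
qed

lemma C2_family_bounded_linear:
  assumes "bounded_linear L" "C2_family X I f"
  shows "C2_family X I (\<lambda>x t. L (f x t))"
proof -
  obtain f' f'' B where f: "0 \<le> B"
    "\<And>x t. x \<in> X \<Longrightarrow> t \<in> I \<Longrightarrow> (f x has_vector_derivative f' x t) (at t)"
    "\<And>x t. x \<in> X \<Longrightarrow> t \<in> I \<Longrightarrow> (f' x has_vector_derivative f'' x t) (at t)"
    "\<And>x t. x \<in> X \<Longrightarrow> t \<in> I \<Longrightarrow> norm (f x t) \<le> B"
    "\<And>x t. x \<in> X \<Longrightarrow> t \<in> I \<Longrightarrow> norm (f' x t) \<le> B"
    "\<And>x t. x \<in> X \<Longrightarrow> t \<in> I \<Longrightarrow> norm (f'' x t) \<le> B" by (rule C2_familyE[OF assms(2)]) (rule that)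
  obtain K where K: "0 \<le> K" "\<And>y. norm (L y) \<le> norm y * K" using bounded_linear.nonneg_bounded[OF assms(1)] by blast
  have nb: "norm (L y) \<le> B * K" if "norm y \<le> B" for y
    using K(2)[of y] mult_right_mono[OF that K(1)] by linarith
  show ?thesis
    by (rule C2_familyI[where f'="\<lambda>x t. L (f' x t)" and f''="\<lambda>x t. L (f'' x t)" and ?B0.0="B * K" and ?B1.0="B * K" and ?B2.0="B * K"])
      (use f in \<open>auto intro!: bounded_linear.has_vector_derivative[OF assms(1)] nb\<close>)
qed

lemma C2_family_mult:
  fixes f g :: "'x \<Rightarrow> real \<Rightarrow> real"
  assumes "C2_family X I f" "C2_family X I g"
  shows "C2_family X I (\<lambda>x t. f x t * g x t)"
proof -
  obtain f' f'' B where f: "0 \<le> B"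
    "\<And>x t. x \<in> X \<Longrightarrow> t \<in> I \<Longrightarrow> (f x has_vector_derivative f' x t) (at t)"
    "\<And>x t. x \<in> X \<Longrightarrow> t \<in> I \<Longrightarrow> (f' x has_vector_derivative f'' x t) (at t)"
    "\<And>x t. x \<in> X \<Longrightarrow> t \<in> I \<Longrightarrow> norm (f x t) \<le> B"
    "\<And>x t. x \<in> X \<Longrightarrow> t \<in> I \<Longrightarrow> norm (f' x t) \<le> B"
    "\<And>x t. x \<in> X \<Longrightarrow> t \<in> I \<Longrightarrow> norm (f'' x t) \<le> B" by (rule C2_familyE[OF assms(1)]) (rule that)
  obtain g' g'' C where g: "0 \<le> C"
    "\<And>x t. x \<in> X \<Longrightarrow> t \<in> I \<Longrightarrow> (g x has_vector_derivative g' x t) (at t)"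
    "\<And>x t. x \<in> X \<Longrightarrow> t \<in> I \<Longrightarrow> (g' x has_vector_derivative g'' x t) (at t)"
    "\<And>x t. x \<in> X \<Longrightarrow> t \<in> I \<Longrightarrow> norm (g x t) \<le> C"
    "\<And>x t. x \<in> X \<Longrightarrow> t \<in> I \<Longrightarrow> norm (g' x t) \<le> C"
    "\<And>x t. x \<in> X \<Longrightarrow> t \<in> I \<Longrightarrow> norm (g'' x t) \<le> C" by (rule C2_familyE[OF assms(2)]) (rule that)
  have nb: "norm (a * b) \<le> B * C" if "norm a \<le> B" "norm b \<le> C" for a b :: real
    using that f(1) by (simp add: abs_mult mult_mono)
  show ?thesis
  proof (rule C2_familyI[where f'="\<lambda>x t. f x t * g' x t + f' x t * g x t"
        and f''="\<lambda>x t. (f x t * g'' x t + f' x t * g' x t) + (f' x t * g' x t + f'' x t * g x t)"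
        and ?B0.0="B * C" and ?B1.0="B * C + B * C" and ?B2.0="(B * C + B * C) + (B * C + B * C)"])
    fix x t assume x: "x \<in> X" "t \<in> I"
    show "((\<lambda>t. f x t * g x t) has_vector_derivative f x t * g' x t + f' x t * g x t) (at t)"
      by (intro has_vector_derivative_mult f g x)
    show "((\<lambda>t. f x t * g' x t + f' x t * g x t) has_vector_derivative
        (f x t * g'' x t + f' x t * g' x t) + (f' x t * g' x t + f'' x t * g x t)) (at t)"
      by (intro has_vector_derivative_add has_vector_derivative_mult f g x)
  qed (intro nb norm_triangle_mono f g; assumption)+
qed

lemma C2_family_sum:
  assumes "\<And>i. i \<in> J \<Longrightarrow> C2_family X I (f i)"
  shows "C2_family X I (\<lambda>x t. \<Sum>i\<in>J. f i x t)"
  using assms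
proof (induction J rule: infinite_finite_induct)
  case (insert i J)
  then show ?case by (auto intro!: C2_family_add)
qed (auto intro!: C2_familyI[where f'="\<lambda>x t. 0" and f''="\<lambda>x t. 0" and ?B0.0=0 and ?B1.0=0 and ?B2.0=0])

lemma bounded_linear_axis: "bounded_linear (axis i :: 'b::real_normed_vector \<Rightarrow> 'b^'n)"
proof (rule bounded_linear_intro[where K=1])
  show "axis i (x + y) = (axis i x + axis i y :: 'b^'n)" "axis i (r *\<^sub>R x) = (r *\<^sub>R axis i x :: 'b^'n)" for x y r
    by (auto simp: vec_eq_iff axis_def)
  show "norm (axis i x :: 'b^'n) \<le> norm x * 1" for x
  proof -
    have "norm (axis i x :: 'b^'n) \<le> (\<Sum>j\<in>UNIV. norm ((axis i x :: 'b^'n) $ j))"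
      unfolding norm_vec_def by (rule L2_set_le_sum) simp
    also have "\<dots> = (\<Sum>j\<in>UNIV. if j = i then norm x else 0)"
      by (rule sum.cong) (auto simp: axis_def)
    finally show ?thesis by simp
  qed
qed

lemma C2_family_vec:
  fixes f :: "'x \<Rightarrow> real \<Rightarrow> 'b::real_normed_vector^'n"
  assumes "\<And>i. C2_family X I (\<lambda>x t. f x t $ i)"
  shows "C2_family X I f"
proof -
  have "C2_family X I (\<lambda>x t. \<Sum>i\<in>UNIV. axis i (f x t $ i))"
    by (intro C2_family_sum C2_family_bounded_linear[OF bounded_linear_axis] assms)
  moreover have "(\<Sum>i\<in>UNIV. axis i (f x t $ i)) = f x t" for x t
    by (simp add: vec_eq_iff axis_def if_distrib cong: if_cong)
  ultimately show ?thesis by simp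
qed

lemma C2_family_Pair:
  assumes "C2_family X I f" "C2_family X I g"
  shows "C2_family X I (\<lambda>x t. (f x t, g x t))"
proof -
  have "C2_family X I (\<lambda>x t. (f x t, 0) + (0, g x t))"
    by (intro C2_family_add C2_family_bounded_linear[where L="\<lambda>y. (y, 0)"] C2_family_bounded_linear[where L="\<lambda>y. (0, y)"]
        assms bounded_linear_Pair bounded_linear_ident bounded_linear_zero)
  then show ?thesis by simp
qed

lemma has_vector_derivative_compose_has_derivative:
  assumes "(z has_vector_derivative z') (at t)" "(g has_derivative G) (at (z t))"
  shows "((\<lambda>s. g (z s)) has_vector_derivative G z') (at t)"
proof -
  have "((\<lambda>s. g (z s)) has_derivative (\<lambda>s. G (s *\<^sub>R z'))) (at t)"
    by (rule has_derivative_compose[OF assms(1)[unfolded has_vector_derivative_def] assms(2)])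
  then show ?thesis
    unfolding has_vector_derivative_def by (simp add: linear_scale[OF has_derivative_linear[OF assms(2)]])
qed

text \<open>
  Regularity of \<open>\<Phi> x\<close> means differentiability of its derivatives in fixed directions, whereas the
  first derivative of the composition is \<open>D\<Phi>(z) z'\<close> with a moving direction. Expanding \<open>z'\<close> in a basis
  gives the second derivative \<open>D\<Phi>(z) z'' + \<Sum>\<^sub>b (z' \<bullet> b) D(D\<Phi>(\<cdot>) b)(z) z'\<close>.
\<close>

lemma C2_family_compose:
  fixes \<Phi> :: "'x \<Rightarrow> 'e::euclidean_space \<Rightarrow> 'b::real_normed_vector"
  assumes z: "C2_family X I z" and I: "open I"
    and S: "\<And>x t. x \<in> X \<Longrightarrow> t \<in> I \<Longrightarrow> z x t \<in> S"
    and \<Phi>: "\<And>x. x \<in> X \<Longrightarrow> Ck_on 2 S (\<Phi> x)"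
    and C0: "\<And>x t. x \<in> X \<Longrightarrow> t \<in> I \<Longrightarrow> norm (\<Phi> x (z x t)) \<le> C0"
    and C1: "\<And>x t h. x \<in> X \<Longrightarrow> t \<in> I \<Longrightarrow> norm (frechet_derivative (\<Phi> x) (at (z x t)) h) \<le> C * norm h"
    and C2: "\<And>x t h k. x \<in> X \<Longrightarrow> t \<in> I \<Longrightarrow>
      norm (frechet_derivative (\<lambda>y. frechet_derivative (\<Phi> x) (at y) h) (at (z x t)) k) \<le> C * norm h * norm k"
  shows "C2_family X I (\<lambda>x t. \<Phi> x (z x t))"
proof -
  obtain z' z'' B where z': "0 \<le> B"
    "\<And>x t. x \<in> X \<Longrightarrow> t \<in> I \<Longrightarrow> (z x has_vector_derivative z' x t) (at t)"
    "\<And>x t. x \<in> X \<Longrightarrow> t \<in> I \<Longrightarrow> (z' x has_vector_derivative z'' x t) (at t)"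
    "\<And>x t. x \<in> X \<Longrightarrow> t \<in> I \<Longrightarrow> norm (z x t) \<le> B"
    "\<And>x t. x \<in> X \<Longrightarrow> t \<in> I \<Longrightarrow> norm (z' x t) \<le> B"
    "\<And>x t. x \<in> X \<Longrightarrow> t \<in> I \<Longrightarrow> norm (z'' x t) \<le> B" by (rule C2_familyE[OF z]) (rule that)
  define D where "D x y h = frechet_derivative (\<Phi> x) (at y) h" for x y h
  define E where "E x h y k = frechet_derivative (\<lambda>y. D x y h) (at y) k" for x h y k
  have \<Phi>2: "Ck_on (Suc (Suc 0)) S (\<Phi> x)" if "x \<in> X" for x using \<Phi>[OF that] by (simp add: numeral_2_eq_2)
  have d1: "(\<Phi> x has_derivative D x y) (at y)" if "x \<in> X" "y \<in> S" for x y
    using Ck_on_SucD(1)[OF \<Phi>2[OF that(1)] that(2)] unfolding D_def by simp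
  have d2: "((\<lambda>y. D x y h) has_derivative E x h y) (at y)" if "x \<in> X" "y \<in> S" for x y h
    using Ck_on_SucD(1)[OF Ck_on_SucD(2)[OF \<Phi>2[OF that(1)]] that(2)] unfolding D_def E_def by simp
  note lin = has_derivative_linear[OF d1]
  have C1': "norm (D x (z x t) h) \<le> \<bar>C\<bar> * norm h" if "x \<in> X" "t \<in> I" for x t h
    using C1[OF that, of h] mult_right_mono[OF abs_ge_self[of C] norm_ge_zero[of h]] unfolding D_def by linarith
  have C2': "norm (E x h (z x t) k) \<le> \<bar>C\<bar> * norm h * norm k" if "x \<in> X" "t \<in> I" for x t h k
    using C2[OF that, of h k] mult_right_mono[OF abs_ge_self[of C], of "norm h * norm k"]
    unfolding D_def E_def by (simp add: mult.assoc)
  show ?thesis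
  proof (rule C2_familyI[where f'="\<lambda>x t. D x (z x t) (z' x t)" and
        f''="\<lambda>x t. D x (z x t) (z'' x t) + (\<Sum>b\<in>Basis. (z' x t \<bullet> b) *\<^sub>R E x b (z x t) (z' x t))" and
        ?B0.0=C0 and ?B1.0="\<bar>C\<bar> * B" and ?B2.0="\<bar>C\<bar> * B + (\<Sum>b\<in>(Basis::'e set). B * (\<bar>C\<bar> * 1 * B))"])
    fix x t assume x: "x \<in> X" "t \<in> I"
    have S': "z x t \<in> S" by (rule S[OF x])
    show "((\<lambda>t. \<Phi> x (z x t)) has_vector_derivative D x (z x t) (z' x t)) (at t)"
      by (rule has_vector_derivative_compose_has_derivative[OF z'(2)[OF x] d1[OF x(1) S']])
    have ex: "D x (z x s) h = (\<Sum>b\<in>Basis. (h \<bullet> b) *\<^sub>R D x (z x s) b)" if "s \<in> I" for s h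
      using lin[OF x(1) S[OF x(1) that]]
      by (subst euclidean_representation[of h, symmetric]) (simp only: linear_sum linear_scale)
    have "((\<lambda>s. \<Sum>b\<in>Basis. (z' x s \<bullet> b) *\<^sub>R D x (z x s) b) has_vector_derivative
        (\<Sum>b\<in>Basis. (z' x t \<bullet> b) *\<^sub>R E x b (z x t) (z' x t) + (z'' x t \<bullet> b) *\<^sub>R D x (z x t) b)) (at t)"
    proof (rule has_vector_derivative_sum, rule has_vector_derivative_scaleR)
      fix b :: 'e
      show "((\<lambda>s. z' x s \<bullet> b) has_real_derivative z'' x t \<bullet> b) (at t)"
        using bounded_linear.has_vector_derivative[OF bounded_linear_inner_left z'(3)[OF x], of b]
        by (simp add: has_real_derivative_iff_has_vector_derivative)
      show "((\<lambda>s. D x (z x s) b) has_vector_derivative E x b (z x t) (z' x t)) (at t)"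
        by (rule has_vector_derivative_compose_has_derivative[OF z'(2)[OF x] d2[OF x(1) S']])
    qed
    also have "(\<Sum>b\<in>Basis. (z' x t \<bullet> b) *\<^sub>R E x b (z x t) (z' x t) + (z'' x t \<bullet> b) *\<^sub>R D x (z x t) b)
      = D x (z x t) (z'' x t) + (\<Sum>b\<in>Basis. (z' x t \<bullet> b) *\<^sub>R E x b (z x t) (z' x t))"
      by (simp add: sum.distrib ex[OF x(2), of "z'' x t"])
    finally show "((\<lambda>t. D x (z x t) (z' x t)) has_vector_derivative
        D x (z x t) (z'' x t) + (\<Sum>b\<in>Basis. (z' x t \<bullet> b) *\<^sub>R E x b (z x t) (z' x t))) (at t)"
      by (rule has_vector_derivative_transform_within_open[OF _ I x(2)]) (simp add: ex[symmetric])
    show "norm (\<Phi> x (z x t)) \<le> C0" by (rule C0[OF x])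
    have D_le: "norm (D x (z x t) h) \<le> \<bar>C\<bar> * B" if "norm h \<le> B" for h
      using C1'[OF x, of h] mult_left_mono[OF that abs_ge_zero[of C]] by linarith
    show "norm (D x (z x t) (z' x t)) \<le> \<bar>C\<bar> * B" by (rule D_le[OF z'(5)[OF x]])
    show "norm (D x (z x t) (z'' x t) + (\<Sum>b\<in>Basis. (z' x t \<bullet> b) *\<^sub>R E x b (z x t) (z' x t)))
        \<le> \<bar>C\<bar> * B + (\<Sum>b\<in>(Basis::'e set). B * (\<bar>C\<bar> * 1 * B))"
    proof (intro norm_triangle_mono D_le z'(6)[OF x] sum_norm_le)
      fix b :: 'e assume b: "b \<in> Basis"
      have "\<bar>z' x t \<bullet> b\<bar> \<le> B" using Basis_le_norm[OF b, of "z' x t"] z'(5)[OF x] by linarith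
      moreover have "norm (E x b (z x t) (z' x t)) \<le> \<bar>C\<bar> * 1 * B"
        using C2'[OF x, of b "z' x t"] mult_left_mono[OF z'(5)[OF x], of "\<bar>C\<bar>"] b by simp
      ultimately show "norm ((z' x t \<bullet> b) *\<^sub>R E x b (z x t) (z' x t)) \<le> B * (\<bar>C\<bar> * 1 * B)"
        unfolding norm_scaleR using z'(1) by (intro mult_mono) auto
    qed
  qed
qed

lemma C2_family_integral_twice_differentiable:
  fixes f :: "'a::euclidean_space \<Rightarrow> real \<Rightarrow> real" and g :: "real \<Rightarrow> real"
  assumes S: "S \<in> lmeasurable" and \<delta>: "0 < \<delta>"
    and fam: "C2_family X {-\<delta><..<\<delta>} f" and X: "AE x in lebesgue_on S. x \<in> X"
    and meas: "\<And>t. \<bar>t\<bar> < \<delta> \<Longrightarrow> (\<lambda>x. f x t) \<in> borel_measurable (lebesgue_on S)"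
    and g: "\<And>t. \<bar>t\<bar> < \<delta> \<Longrightarrow> g t = (\<integral>x. f x t \<partial>lebesgue_on S)"
  shows "g differentiable (at 0)" "\<forall>\<^sub>F t in nhds 0. g differentiable (at t)" "deriv g differentiable (at 0)"
proof -
  let ?I = "{-\<delta><..<\<delta>}"
  obtain f' f'' B where f: "0 \<le> B"
    "\<And>x t. x \<in> X \<Longrightarrow> t \<in> ?I \<Longrightarrow> (f x has_vector_derivative f' x t) (at t)"
    "\<And>x t. x \<in> X \<Longrightarrow> t \<in> ?I \<Longrightarrow> (f' x has_vector_derivative f'' x t) (at t)"
    "\<And>x t. x \<in> X \<Longrightarrow> t \<in> ?I \<Longrightarrow> norm (f x t) \<le> B"
    "\<And>x t. x \<in> X \<Longrightarrow> t \<in> ?I \<Longrightarrow> norm (f' x t) \<le> B"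
    "\<And>x t. x \<in> X \<Longrightarrow> t \<in> ?I \<Longrightarrow> norm (f'' x t) \<le> B" by (rule C2_familyE[OF fam]) (rule that)
  have I: "open ?I" "convex ?I" by auto
  have int: "integrable (lebesgue_on S) (\<lambda>x. f x t)" if "t \<in> ?I" for t
  proof (rule finite_measure.integrable_const_bound[OF finite_measure_lebesgue_on[OF S], of _ B])
    show "AE x in lebesgue_on S. norm (f x t) \<le> B"
      using X by (rule eventually_mono) (rule f(4)[OF _ that])
    show "(\<lambda>x. f x t) \<in> borel_measurable (lebesgue_on S)" using that by (intro meas) auto
  qed
  have der: "AE x in lebesgue_on S. \<forall>t\<in>?I. (f x has_real_derivative f' x t) (at t) \<and> \<bar>f' x t\<bar> \<le> B"
    using X by (rule eventually_mono) (use f(2,5) in \<open>auto simp: has_real_derivative_iff_has_vector_derivative\<close>)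
  have der': "AE x in lebesgue_on S. \<forall>t\<in>?I. (f' x has_real_derivative f'' x t) (at t) \<and> \<bar>f'' x t\<bar> \<le> B"
    using X by (rule eventually_mono) (use f(3,6) in \<open>auto simp: has_real_derivative_iff_has_vector_derivative\<close>)
  note D1 = integral_has_real_derivative_dominated[OF S I _ int der]
  note D2 = integral_has_real_derivative_dominated(1)[OF S I _ D1(2) der']
  have g1: "(g has_real_derivative (\<integral>x. f' x t \<partial>lebesgue_on S)) (at t)" if "t \<in> ?I" for t
    by (rule has_field_derivative_transform_within_open[OF D1(1)[OF that] I(1) that]) (use g in auto)
  then have dg: "deriv g t = (\<integral>x. f' x t \<partial>lebesgue_on S)" if "t \<in> ?I" for t
    using DERIV_imp_deriv that by blast
  have 0: "0 \<in> ?I" using \<delta> by simp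
  show g0: "g differentiable (at 0)" using g1[OF 0] real_differentiable_def by blast
  show "\<forall>\<^sub>F t in nhds 0. g differentiable (at t)"
    using eventually_nhds_in_open[OF I(1) 0] by (rule eventually_mono) (use g1 real_differentiable_def in blast)
  have "(deriv g has_real_derivative (\<integral>x. f'' x 0 \<partial>lebesgue_on S)) (at 0)"
    by (rule has_field_derivative_transform_within_open[OF D2[OF 0] I(1) 0]) (use dg in auto)
  then show "deriv g differentiable (at 0)" using real_differentiable_def by blast
qed

section \<open>The second derivative test\<close>

text \<open>
  If \<open>g''(0) < 0\<close>, then \<open>g'\<close>, which vanishes at \<open>0\<close>, is negative just to the right of \<open>0\<close>, and by the mean
  value theorem \<open>g\<close> takes values below \<open>g 0\<close> there.
\<close>

lemma local_min_imp_second_derivative_nonneg: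
  fixes g :: "real \<Rightarrow> real"
  assumes \<delta>: "0 < \<delta>" and min: "\<And>t. \<bar>t\<bar> < \<delta> \<Longrightarrow> g 0 \<le> g t"
    and g1: "\<forall>\<^sub>F t in nhds 0. g differentiable (at t)" and g2: "deriv g differentiable (at 0)"
  shows "0 \<le> deriv (deriv g) 0"
proof (rule ccontr)
  assume neg: "\<not> 0 \<le> deriv (deriv g) 0"
  obtain e where e: "0 < e" "\<And>t. \<bar>t\<bar> < e \<Longrightarrow> g differentiable (at t)"
    using g1 by (auto simp: eventually_nhds_metric dist_real_def)
  have d1: "(g has_real_derivative deriv g t) (at t)" if "\<bar>t\<bar> < e" for t
    using e(2)[OF that] by (simp add: DERIV_deriv_iff_real_differentiable)
  have d2: "(deriv g has_real_derivative deriv (deriv g) 0) (at 0)"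
    using g2 by (simp add: DERIV_deriv_iff_real_differentiable)
  have 0: "deriv g 0 = 0"
    by (rule DERIV_local_min[OF d1[of 0] \<delta>]) (use e min in auto)
  obtain d where d: "0 < d" "\<And>h. 0 < h \<Longrightarrow> h < d \<Longrightarrow> deriv g (0 + h) < deriv g 0"
    using DERIV_neg_dec_right[OF d2] neg by auto
  define h where "h = min d (min e \<delta>) / 2"
  have h: "0 < h" "h < d" "h < e" "h < \<delta>" using d(1) e(1) \<delta> by (auto simp: h_def)
  obtain \<xi> where \<xi>: "0 < \<xi>" "\<xi> < h" "g h - g 0 = (h - 0) * deriv g \<xi>"
    using MVT2[of 0 h g "deriv g"] h d1 by auto
  have "deriv g \<xi> < 0" using d(2)[of \<xi>] \<xi> h 0 by simp
  then have "g h < g 0" using \<xi>(3) h(1) mult_pos_neg[of h "deriv g \<xi>"] by simp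
  then show False using min[of h] h by simp
qed

section \<open>Energy along the projected variation\<close>

lemma Lp_norm_infinity_le:
  assumes "f \<in> borel_measurable N" "AE x in N. norm (f x) \<le> c"
  shows "Lp_norm N \<infinity> f \<le> ennreal c"
proof -
  have "(\<lambda>x. ennreal (norm (f x))) \<in> borel_measurable N" using assms(1) by measurable
  moreover have "AE x in N. ennreal (norm (f x)) \<le> ennreal c"
    using assms(2) by (rule eventually_mono) (rule ennreal_leI)
  ultimately show ?thesis unfolding Lp_norm_def by (simp add: esssup_I)
qed

lemma Lp_norm_infinity_AE_bounded:
  assumes "Lp_norm N \<infinity> f < \<infinity>"
  obtains R where "0 \<le> R" "AE x in N. norm (f x) \<le> R"
proof -
  let ?s = "esssup N (\<lambda>x. ennreal (norm (f x)))"
  have s: "?s < top" using assms by (simp add: Lp_norm_def)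
  have "AE x in N. ennreal (norm (f x)) \<le> ?s" by (rule esssup_AE)
  then have "AE x in N. norm (f x) \<le> enn2real ?s"
    by (rule eventually_mono) (metis s enn2real_mono enn2real_ennreal norm_ge_zero)
  then show ?thesis using that[of "enn2real ?s"] by simp
qed

lemma nearest_point_projection_eq_self:
  assumes "nearest_point_projection M U P" "y \<in> M" "y \<in> U"
  shows "P y = y"
proof (rule ccontr)
  assume "P y \<noteq> y"
  then have "dist y (P y) < dist y y"
    using assms unfolding nearest_point_projection_def by metis
  then show False by simp
qed

lemma has_trace_on_AE_cong:
  fixes u :: "real^'d \<Rightarrow> real^'k"
  assumes \<Omega>: "open \<Omega>" "bounded \<Omega>" and tr: "has_trace_on \<Omega> \<Gamma> u w"
    and u: "has_weak_gradient \<Omega> u G" and ae: "AE x in lebesgue_on \<Omega>. u x = u' x"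
  shows "has_trace_on \<Omega> \<Gamma> u' w"
proof -
  have u': "has_weak_gradient \<Omega> u' G"
    by (rule has_weak_gradient_AE_cong[OF \<Omega>(1) u ae]) simp
  have eq: "sobolev_norm \<Omega> 1 (\<lambda>x. \<phi> x - u x) = sobolev_norm \<Omega> 1 (\<lambda>x. \<phi> x - u' x)" if \<phi>: "C1_closure \<Omega> \<phi>" for \<phi>
  proof -
    have "(\<integral>\<^sup>+x. ennreal (norm (\<phi> x - u x)) \<partial>lebesgue_on \<Omega>) = (\<integral>\<^sup>+x. ennreal (norm (\<phi> x - u' x)) \<partial>lebesgue_on \<Omega>)"
      by (rule nn_integral_cong_AE) (use ae in \<open>rule eventually_mono, simp\<close>)
    then show ?thesis
      by (simp add: sobolev_norm_1_C1_closure_diff[OF \<Omega> \<phi> u] sobolev_norm_1_C1_closure_diff[OF \<Omega> \<phi> u'])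
  qed
  obtain \<phi> where \<phi>: "\<forall>j. C1_closure \<Omega> (\<phi> j)" "(\<lambda>j. sobolev_norm \<Omega> 1 (\<lambda>x. \<phi> j x - u x)) \<longlonglongrightarrow> 0"
      "(\<lambda>j. \<integral>\<^sup>+x\<in>\<Gamma>. ennreal (norm (\<phi> j x - w x)) \<partial>surface_measure) \<longlonglongrightarrow> 0"
    and w: "set_integrable surface_measure \<Gamma> w"
    using tr unfolding has_trace_on_def by auto
  have "(\<lambda>j. sobolev_norm \<Omega> 1 (\<lambda>x. \<phi> j x - u' x)) \<longlonglongrightarrow> 0"
    using \<phi>(2) eq \<phi>(1) by simp
  then show ?thesis unfolding has_trace_on_def using w \<phi>(1,3) by blast
qed

text \<open>
  Any representatives \<open>p\<close> and \<open>H\<close> of the map and its gradient may be used. The integrand is measurable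
  because \<open>F\<close> is continuous on a closed set to which the arguments belong almost everywhere.
\<close>

lemma energy_eq_integral:
  fixes p m :: "real^'d \<Rightarrow> real^'k" and H :: "real^'d \<Rightarrow> real^'d^'k"
  assumes \<Omega>: "open \<Omega>" and M: "closed M"
    and F: "continuous_on (closure \<Omega> \<times> M \<times> UNIV) (\<lambda>(x, y, A). F x y A)"
    and p: "p \<in> borel_measurable (lebesgue_on \<Omega>)" and H: "H \<in> borel_measurable (lebesgue_on \<Omega>)"
    and pM: "AE x in lebesgue_on \<Omega>. p x \<in> M"
    and m: "has_weak_gradient \<Omega> m H'" "AE x in lebesgue_on \<Omega>. m x = p x" "AE x in lebesgue_on \<Omega>. H' x = H x"
  shows "energy \<Omega> F m = (\<integral>x. F x (p x) (H x) \<partial>lebesgue_on \<Omega>)"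
    and "(\<lambda>x. F x (p x) (H x)) \<in> borel_measurable (lebesgue_on \<Omega>)"
proof -
  have \<Omega>L: "\<Omega> \<in> sets lebesgue" using \<Omega> by auto
  let ?K = "closure \<Omega> \<times> M \<times> (UNIV :: (real^'d^'k) set)"
  have "closed ?K" using M by (intro closed_Times) auto
  then have Km: "?K \<in> sets borel" by (rule borel_closed)
  have Fm: "(\<lambda>z. indicator ?K z *\<^sub>R (case z of (x, y, A) \<Rightarrow> F x y A)) \<in> borel_measurable borel"
    by (rule borel_measurable_continuous_on_indicator[OF Km F])
  have idm: "(\<lambda>x. x) \<in> borel_measurable (lebesgue_on \<Omega>)"
    by (rule continuous_imp_measurable_on_sets_lebesgue[OF continuous_on_id \<Omega>L])
  have "(\<lambda>x. (x, p x, H x)) \<in> borel_measurable (lebesgue_on \<Omega>)"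
    by (intro borel_measurable_Pair idm p H)
  from measurable_compose[OF this Fm]
  have g: "(\<lambda>x. indicator ?K (x, p x, H x) *\<^sub>R F x (p x) (H x)) \<in> borel_measurable (lebesgue_on \<Omega>)" by simp
  have "AE x in lebesgue_on \<Omega>. F x (p x) (H x) = indicator ?K (x, p x, H x) *\<^sub>R F x (p x) (H x)"
    using pM AE_space[of "lebesgue_on \<Omega>"]
    by eventually_elim (use closure_subset in \<open>auto simp: indicator_def\<close>)
  then show meas: "(\<lambda>x. F x (p x) (H x)) \<in> borel_measurable (lebesgue_on \<Omega>)"
    by (rule borel_measurable_lebesgue_on_AE_cong[OF \<Omega>L g])
  have ae: "AE x in lebesgue_on \<Omega>. F x (m x) (weak_gradient \<Omega> m x) = F x (p x) (H x)"
    using m(2,3) weak_gradient_AE_eq[OF \<Omega> m(1)] by eventually_elim simp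
  show "energy \<Omega> F m = (\<integral>x. F x (p x) (H x) \<partial>lebesgue_on \<Omega>)"
    unfolding energy_def
    by (rule integral_cong_AE[OF borel_measurable_lebesgue_on_AE_cong[OF \<Omega>L meas ae] meas ae])
qed

lemma C2_family_compact_support_compose:
  fixes q :: "'e::euclidean_space \<Rightarrow> 'b::real_normed_vector"
  assumes q: "Ck_on 2 UNIV q" "compact C" "\<And>y. y \<notin> C \<Longrightarrow> q y = 0"
    and z: "C2_family X I z" and I: "open I"
  shows "C2_family X I (\<lambda>x t. q (z x t))"
proof -
  have q1: "Ck_on 1 UNIV q" by (rule Ck_on_le[OF q(1)]) simp
  obtain B0 where B0: "\<And>y. norm (q y) \<le> B0"
    using compact_support_bounded[OF Ck_on_continuous_on[OF q1] q(2,3)] by blast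
  obtain B1 where B1: "\<And>y h. norm (frechet_derivative q (at y) h) \<le> B1 * norm h"
    by (rule C1_compact_support_derivative_bound[OF q1 q(2,3)]) (assumption, rule that)
  obtain B2 where B2: "\<And>y h k. norm (frechet_derivative (\<lambda>z. frechet_derivative q (at z) h) (at y) k) \<le> B2 * norm h * norm k"
    by (rule C2_compact_support_second_derivative_bound[OF q]) (assumption, rule that)
  show ?thesis
  proof (rule C2_family_compose[OF z I, of UNIV "\<lambda>_. q" B0 "max B1 B2"])
    show "norm (frechet_derivative q (at (z x t)) h) \<le> max B1 B2 * norm h" for x t h
      using B1[of "z x t" h] mult_right_mono[OF max.cobounded1[of B1 B2] norm_ge_zero[of h]] by linarith
    show "norm (frechet_derivative (\<lambda>y. frechet_derivative q (at y) h) (at (z x t)) k) \<le> max B1 B2 * norm h * norm k" for x t h k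
      using B2[of h "z x t" k] mult_right_mono[OF max.cobounded2[of B2 B1], of "norm h * norm k"]
      by (simp add: mult.assoc)
  qed (use q(1) B0 in auto)
qed

text \<open>
  The curve of values and gradients of \<open>Q(u + t v)\<close> at a point. Its second component contains the first
  derivative of \<open>Q\<close>, which is why \<open>Q\<close> must be of class $C^3$ for two derivatives in \<open>t\<close>.
\<close>

lemma C2_family_chain_rule_curve:
  fixes Q :: "real^'k \<Rightarrow> real^'m" and u v :: "'x \<Rightarrow> real^'k" and G J :: "'x \<Rightarrow> real^'d^'k"
  assumes Q: "Ck_on 3 UNIV Q" "compact C" "\<And>y. y \<notin> C \<Longrightarrow> Q y = 0"
    and bd: "\<And>x. x \<in> X \<Longrightarrow> norm (u x) \<le> R" "\<And>x. x \<in> X \<Longrightarrow> norm (v x) \<le> R"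
      "\<And>x. x \<in> X \<Longrightarrow> norm (G x) \<le> R" "\<And>x. x \<in> X \<Longrightarrow> norm (J x) \<le> R"
    and I: "open I" "\<And>t. t \<in> I \<Longrightarrow> \<bar>t\<bar> \<le> D"
  shows "C2_family X I (\<lambda>x t. (Q (u x + t *\<^sub>R v x), jacobi_matrix Q (u x + t *\<^sub>R v x) ** (G x + t *\<^sub>R J x)))"
proof -
  have w: "C2_family X I (\<lambda>x t. u x + t *\<^sub>R v x)" and W: "C2_family X I (\<lambda>x t. G x + t *\<^sub>R J x)"
    by (rule C2_family_affine[where A=R and B=R and D=D]; use bd I in blast)+
  have Q3: "Ck_on (Suc 2) UNIV Q" using Q(1) by (simp only: numeral_3_eq_3 numeral_2_eq_2)
  have "C2_family X I (\<lambda>x t. Q (u x + t *\<^sub>R v x))"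
    by (rule C2_family_compact_support_compose[OF Ck_on_Suc_imp[OF Q3] Q(2,3) w I(1)])
  moreover have "C2_family X I (\<lambda>x t. jacobi_matrix Q (u x + t *\<^sub>R v x) ** (G x + t *\<^sub>R J x))"
  proof (intro C2_family_vec)
    fix i j
    have J: "C2_family X I (\<lambda>x t. jacobi_matrix Q (u x + t *\<^sub>R v x) $ i $ l)" for l
      unfolding jacobi_matrix_entry
    proof (rule C2_family_compact_support_compose[OF _ Q(2) _ w I(1)])
      show "Ck_on 2 UNIV (\<lambda>y. frechet_derivative Q (at y) (axis l 1) $ i)"
        by (rule Ck_on_bounded_linear_compose[OF open_UNIV bounded_linear_vec_nth Ck_on_SucD(2)[OF Q3]])
      show "frechet_derivative Q (at y) (axis l 1) $ i = 0" if "y \<notin> C" for y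
        using frechet_derivative_zero_outside[OF compact_imp_closed[OF Q(2)] Q(3) that] by simp
    qed
    have "C2_family X I (\<lambda>x t. \<Sum>l\<in>UNIV. jacobi_matrix Q (u x + t *\<^sub>R v x) $ i $ l * (G x + t *\<^sub>R J x) $ l $ j)"
      by (intro C2_family_sum C2_family_mult J C2_family_bounded_linear[OF bounded_linear_matrix_entry W])
    then show "C2_family X I (\<lambda>x t. (jacobi_matrix Q (u x + t *\<^sub>R v x) ** (G x + t *\<^sub>R J x)) $ i $ j)"
      by (simp add: matrix_matrix_mult_def)
  qed
  ultimately show ?thesis by (rule C2_family_Pair)
qed

text \<open>
  The values stay in \<open>M\<close> and the gradients in a fixed ball. There \<open>F\<close> is bounded by compactness and
  its derivatives by \<open>locally_bounded_derivatives\<close>, uniformly in \<open>x\<close>.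
\<close>

lemma C2_family_integrand:
  fixes F :: "real^'d \<Rightarrow> real^'k \<Rightarrow> real^'d^'k \<Rightarrow> real"
  assumes \<Omega>: "bounded \<Omega>" and M: "compact M" and N: "open N" "M \<subseteq> N"
    and F: "continuous_on (closure \<Omega> \<times> M \<times> UNIV) (\<lambda>(x, y, A). F x y A)"
    and F2: "\<And>x. x \<in> \<Omega> \<Longrightarrow> Ck_on 2 (N \<times> UNIV) (\<lambda>(y, A). F x y A)"
    and lb: "locally_bounded_derivatives \<Omega> M F"
    and X: "X \<subseteq> \<Omega>" and I: "open I" and z: "C2_family X I (\<lambda>x t. (p x t, q x t))"
    and pM: "\<And>x t. x \<in> X \<Longrightarrow> t \<in> I \<Longrightarrow> p x t \<in> M"
  shows "C2_family X I (\<lambda>x t. F x (p x t) (q x t))"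
proof -
  obtain z' z'' B where B: "0 \<le> B"
    "\<And>x t. x \<in> X \<Longrightarrow> t \<in> I \<Longrightarrow> ((\<lambda>t. (p x t, q x t)) has_vector_derivative z' x t) (at t)"
    "\<And>x t. x \<in> X \<Longrightarrow> t \<in> I \<Longrightarrow> (z' x has_vector_derivative z'' x t) (at t)"
    "\<And>x t. x \<in> X \<Longrightarrow> t \<in> I \<Longrightarrow> norm (p x t, q x t) \<le> B"
    "\<And>x t. x \<in> X \<Longrightarrow> t \<in> I \<Longrightarrow> norm (z' x t) \<le> B"
    "\<And>x t. x \<in> X \<Longrightarrow> t \<in> I \<Longrightarrow> norm (z'' x t) \<le> B"
    by (rule C2_familyE[OF z]) (rule that)
  have qB: "norm (q x t) \<le> B" if "x \<in> X" "t \<in> I" for x t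
    using B(4)[OF that] norm_snd_le[of "q x t" "p x t"] by linarith
  let ?K = "closure \<Omega> \<times> M \<times> cball (0 :: real^'d^'k) B"
  have "compact ?K" using \<Omega> M by (intro compact_Times) (simp_all add: compact_closure)
  moreover have "continuous_on ?K (\<lambda>(x, y, A). F x y A)"
    by (rule continuous_on_subset[OF F]) auto
  ultimately have "bounded ((\<lambda>(x, y, A). F x y A) ` ?K)"
    by (intro compact_imp_bounded compact_continuous_image)
  then obtain C0 where C0: "\<And>x y A. x \<in> closure \<Omega> \<Longrightarrow> y \<in> M \<Longrightarrow> norm A \<le> B \<Longrightarrow> norm (F x y A) \<le> C0"
    by (fastforce simp: bounded_iff)
  obtain C where C: "\<forall>x\<in>\<Omega>. \<forall>y\<in>M. \<forall>A. norm A \<le> B \<longrightarrow> (\<forall>h k.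
        \<bar>frechet_derivative (case_prod (F x)) (at (y, A)) h\<bar> \<le> C * norm h \<and>
        \<bar>frechet_derivative (\<lambda>z. frechet_derivative (case_prod (F x)) (at z) h) (at (y, A)) k\<bar>
          \<le> C * norm h * norm k)"
    using lb[unfolded locally_bounded_derivatives_def, THEN spec, of B] by (elim exE) (rule that)
  have "C2_family X I (\<lambda>x t. case_prod (F x) (p x t, q x t))"
  proof (rule C2_family_compose[OF z I, of "N \<times> UNIV" "\<lambda>x. case_prod (F x)" C0 C])
    fix x t h k assume x: "x \<in> X" "t \<in> I"
    then have x\<Omega>: "x \<in> \<Omega>" using X by blast
    show "(p x t, q x t) \<in> N \<times> UNIV" using pM[OF x] N(2) by auto
    show "norm (case_prod (F x) (p x t, q x t)) \<le> C0"
      using C0[OF _ pM[OF x] qB[OF x], of x] x\<Omega> closure_subset by auto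
    show "norm (frechet_derivative (case_prod (F x)) (at (p x t, q x t)) h) \<le> C * norm h"
      using C[rule_format, OF x\<Omega> pM[OF x] qB[OF x]] by simp
    show "norm (frechet_derivative (\<lambda>y. frechet_derivative (case_prod (F x)) (at y) h) (at (p x t, q x t)) k) \<le> C * norm h * norm k"
      using C[rule_format, OF x\<Omega> pM[OF x] qB[OF x]] by simp
  next
    fix x assume "x \<in> X"
    then show "Ck_on 2 (N \<times> UNIV) (case_prod (F x))" using F2[of x] X by blast
  qed
  then show ?thesis by simp
qed

theorem theorem9:
  fixes \<Omega> \<Gamma>1 \<Gamma>2 :: "(real^'d) set"
    and M U N :: "(real^'k) set"
    and P :: "real^'k \<Rightarrow> real^'k"
    and F :: "real^'d \<Rightarrow> real^'k \<Rightarrow> real^'d^'k \<Rightarrow> real"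
    and n0 n :: "real^'d \<Rightarrow> real^'k"
  assumes "bounded_lipschitz_domain \<Omega>"
    and "openin (top_of_set (frontier \<Omega>)) \<Gamma>1" and "openin (top_of_set (frontier \<Omega>)) \<Gamma>2"
    and "\<Gamma>1 \<in> sets surface_measure" and "\<Gamma>2 \<in> sets surface_measure"
    and "\<Gamma>1 \<inter> \<Gamma>2 = {}" and "frontier \<Omega> = closure \<Gamma>1 \<union> closure \<Gamma>2"
    and "C_submanifold 4 M" and "closed M" and "bounded M"
    and "open U" and "M \<subseteq> U" and "nearest_point_projection M U P" and "Ck_on 3 U P"
    and "continuous_on (closure \<Omega> \<times> M \<times> UNIV) (\<lambda>(x, y, A). F x y A)"
    and "open N" and "M \<subseteq> N" and "N \<subseteq> U"
    and "\<And>x. x \<in> \<Omega> \<Longrightarrow> Ck_on 2 (N \<times> UNIV) (\<lambda>(y, A). F x y A)"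
    and "n0 \<in> sobolev_into \<Omega> 1 M"
    and "n \<in> admissible \<Omega> \<Gamma>1 M n0 \<inter> sobolev_into \<Omega> \<infinity> M"
    and "weak_local_minimizer \<Omega> F (admissible \<Omega> \<Gamma>1 M n0) n"
  shows "\<forall>v \<in> variations \<Omega> \<Gamma>1.
    let g = (\<lambda>t::real. energy \<Omega> F (\<lambda>x. P (n x + t *\<^sub>R v x)));
        diff1 = g differentiable (at 0);
        diff2 = ((\<forall>\<^sub>F t in nhds 0. g differentiable (at t)) \<and> deriv g differentiable (at 0))
    in (diff1 \<longrightarrow> deriv g 0 = 0) \<and> (diff2 \<longrightarrow> deriv (deriv g) 0 \<ge> 0) \<and>
       (locally_bounded_derivatives \<Omega> M F \<longrightarrow> diff1 \<and> diff2)"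
proof
  fix v :: "real^'d \<Rightarrow> real^'k" assume v: "v \<in> variations \<Omega> \<Gamma>1"
  note lip = assms(1) and U = assms(11,12) and npp = assms(13) and P = assms(14) and F = assms(15)
    and N = assms(16,17) and F2 = assms(19) and n = assms(21) and wlm = assms(22)
  have o: "open \<Omega>" and b: "bounded \<Omega>" using lip by (auto simp: bounded_lipschitz_domain_def)
  have \<Omega>L: "\<Omega> \<in> sets lebesgue" using o by auto
  have \<Omega>lm: "\<Omega> \<in> lmeasurable" using o b by (simp add: lmeasurable_open)
  have M: "compact M" using assms(9,10) compact_eq_bounded_closed by blast
  have vC1: "C1_closure \<Omega> v" and v0: "\<And>x. x \<in> \<Gamma>1 \<Longrightarrow> v x = 0"
    using v smooth_closure_imp_C1_closure by (auto simp: variations_def)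
  have PM: "P y \<in> M" if "y \<in> U" for y using npp that by (simp add: nearest_point_projection_def)
  have PP: "P y = y" if "y \<in> M" for y
    using nearest_point_projection_eq_self[OF npp that] U(2) that by blast
  obtain Q W C where Q: "Ck_on 3 UNIV Q" "open W" "M \<subseteq> W" "W \<subseteq> U" "\<And>y. y \<in> W \<Longrightarrow> Q y = P y"
    "compact C" "\<And>y. y \<notin> C \<Longrightarrow> Q y = 0"
    by (rule Ck_on_compact_support_extension[OF M U P]) (rule that)
  have Q2: "Ck_on 2 UNIV Q" by (rule Ck_on_le[OF Q(1)]) simp
  have QM: "Q y = y" if "y \<in> M" for y using Q(5)[of y] PP[OF that] Q(3) that by auto

  have ntr: "same_trace_on \<Omega> \<Gamma>1 n n0"
    and ninf: "n \<in> sobolev_into \<Omega> \<infinity> M" using n by (auto simp: admissible_def)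
  have nM: "AE x in lebesgue_on \<Omega>. n x \<in> M" and nm: "n \<in> borel_measurable (lebesgue_on \<Omega>)"
    using ninf by (auto simp: sobolev_into_def sobolev_def)
  obtain G where Gm: "G \<in> borel_measurable (lebesgue_on \<Omega>)" and G: "has_weak_gradient \<Omega> n G"
    and Ginf: "Lp_norm (lebesgue_on \<Omega>) \<infinity> G < \<infinity>"
    using ninf by (auto simp: sobolev_into_def sobolev_def)
  obtain R1 where R1: "0 \<le> R1" "AE x in lebesgue_on \<Omega>. norm (G x) \<le> R1"
    by (rule Lp_norm_infinity_AE_bounded[OF Ginf]) (rule that)
  obtain R2 where R2: "\<And>y. y \<in> M \<Longrightarrow> norm y \<le> R2"
    using assms(10) by (auto simp: bounded_iff)
  obtain R3 where R3: "\<And>x. x \<in> \<Omega> \<Longrightarrow> norm (v x) \<le> R3" "\<And>x. x \<in> \<Omega> \<Longrightarrow> norm (jacobi_matrix v x) \<le> R3"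
    by (rule C1_closure_bounded[OF o b vC1]) (rule that)
  define R where "R = max 0 (max R1 (max R2 R3))"
  have R: "0 \<le> R" "R1 \<le> R" "R2 \<le> R" "R3 \<le> R" by (auto simp: R_def)
  \<comment> \<open>The points of full measure at which all bounds hold for the chosen representatives.\<close>
  define X where "X = {x \<in> \<Omega>. n x \<in> M \<and> norm (G x) \<le> R}"
  have X: "AE x in lebesgue_on \<Omega>. x \<in> X"
    using nM R1(2) AE_space[of "lebesgue_on \<Omega>"] by eventually_elim (use R in \<open>auto simp: X_def\<close>)
  have Xb: "norm (n x) \<le> R" "norm (v x) \<le> R" "norm (G x) \<le> R" "norm (jacobi_matrix v x) \<le> R" "n x \<in> M" "x \<in> \<Omega>"
    if "x \<in> X" for x
    using that R2[of "n x"] R3[of x] R unfolding X_def by auto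
  have in_int: "integrable (lebesgue_on \<Omega>) n"
    by (rule finite_measure.integrable_const_bound[OF finite_measure_lebesgue_on[OF \<Omega>lm] _ nm, of R])
      (use X Xb(1) in \<open>rule eventually_mono\<close>)
  have iG_int: "integrable (lebesgue_on \<Omega>) G"
    by (rule finite_measure.integrable_const_bound[OF finite_measure_lebesgue_on[OF \<Omega>lm] _ Gm, of R])
      (use X Xb(3) in \<open>rule eventually_mono\<close>)
  obtain \<rho> where \<rho>: "0 < \<rho>" "(\<Union>y\<in>M. ball y \<rho>) \<subseteq> W"
    using compact_subset_open_imp_ball_epsilon_subset[OF M Q(2,3)] by blast
  \<comment> \<open>Keeps \<open>n x + t v x\<close> within \<open>\<rho>\<close> of \<open>M\<close>; the summand \<open>1\<close> avoids division by zero.\<close>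
  define \<delta> where "\<delta> = \<rho> / (R + 1)"
  have \<delta>: "0 < \<delta>" using \<rho>(1) R(1) by (simp add: \<delta>_def)
  have inW: "n x + t *\<^sub>R v x \<in> W" if "x \<in> X" "\<bar>t\<bar> < \<delta>" for x t
  proof -
    have "norm (t *\<^sub>R v x) \<le> \<bar>t\<bar> * (R + 1)" using Xb(2)[OF that(1)] by (auto intro!: mult_left_mono)
    also have "\<dots> < \<rho>" using that(2) R(1) by (simp add: \<delta>_def pos_less_divide_eq)
    finally have "n x + t *\<^sub>R v x \<in> ball (n x) \<rho>" by (simp add: dist_norm)
    then show ?thesis using \<rho>(2) Xb(5)[OF that(1)] by blast
  qed
  define p where "p x t = Q (n x + t *\<^sub>R v x)" for x t
  define H where "H x t = jacobi_matrix Q (n x + t *\<^sub>R v x) ** (G x + t *\<^sub>R jacobi_matrix v x)" for x t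
  define m where "m t x = P (n x + t *\<^sub>R v x)" for t x
  have mp: "m t x = p x t" "p x t \<in> M" if "x \<in> X" "\<bar>t\<bar> < \<delta>" for x t
    using inW[OF that] Q(4,5) PM unfolding m_def p_def by auto
  have Qn: "AE x in lebesgue_on \<Omega>. Q (n x) = n x"
    using nM by (rule eventually_mono) (rule QM)
  obtain w where w: "has_trace_on \<Omega> \<Gamma>1 n w" "has_trace_on \<Omega> \<Gamma>1 n0 w"
    using ntr unfolding same_trace_on_def by blast
  note var = projected_variation_trace_and_gradient[OF o b w(1) in_int iG_int G R1(2) Q2 Q(6,7) Qn vC1 v0 refl refl]
  have vp: "has_trace_on \<Omega> \<Gamma>1 (\<lambda>x. p x t) w" "integrable (lebesgue_on \<Omega>) (\<lambda>x. p x t)"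
      "integrable (lebesgue_on \<Omega>) (\<lambda>x. H x t)" "has_weak_gradient \<Omega> (\<lambda>x. p x t) (\<lambda>x. H x t)" for t
    unfolding p_def H_def by (rule var(1)[of t] var(2)[of t] var(3)[of t] var(4)[of t]; assumption)+
  have aep: "AE x in lebesgue_on \<Omega>. p x t = m t x" if "\<bar>t\<bar> < \<delta>" for t
    using X by (rule eventually_mono) (simp add: mp(1) that)
  have pM: "AE x in lebesgue_on \<Omega>. p x t \<in> M" if "\<bar>t\<bar> < \<delta>" for t
    using X by (rule eventually_mono) (simp add: mp(2) that)
  have mwg: "has_weak_gradient \<Omega> (m t) (\<lambda>x. H x t)" if "\<bar>t\<bar> < \<delta>" for t
    by (rule has_weak_gradient_AE_cong[OF o vp(4) aep[OF that]]) simp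
  have mm: "m t \<in> borel_measurable (lebesgue_on \<Omega>)" if "\<bar>t\<bar> < \<delta>" for t
    by (rule borel_measurable_lebesgue_on_AE_cong[OF \<Omega>L borel_measurable_integrable[OF vp(2)[of t]]])
      (use aep[OF that] in \<open>rule eventually_mono, simp\<close>)
  have Gn: "AE x in lebesgue_on \<Omega>. G x = H x 0"
  proof (rule eventually_mono[OF var(5)])
    fix x assume "jacobi_matrix Q (n x) ** G x = G x"
    then show "G x = H x 0" unfolding H_def by simp
  qed

  have adm: "m t \<in> admissible \<Omega> \<Gamma>1 M n0" if t: "\<bar>t\<bar> < \<delta>" for t
  proof -
    have mi: "integrable (lebesgue_on \<Omega>) (m t)"
      using vp(2) integrable_cong_AE[OF borel_measurable_integrable[OF vp(2)] mm[OF t] aep[OF t]] by blast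
    have "m t \<in> sobolev \<Omega> 1"
      unfolding sobolev_def
    proof (intro CollectI conjI bexI[of _ "\<lambda>x. H x t"])
      show "Lp_norm (lebesgue_on \<Omega>) 1 (m t) < \<infinity>"
        using mi by (simp add: Lp_norm_1 integrable_iff_bounded)
      show "Lp_norm (lebesgue_on \<Omega>) 1 (\<lambda>x. H x t) < \<infinity>"
        using vp(3)[of t] by (simp add: Lp_norm_1 integrable_iff_bounded)
    qed (use mm[OF t] mwg[OF t] vp(3)[of t] in auto)
    moreover have "AE x in lebesgue_on \<Omega>. m t x \<in> M"
      using X by (rule eventually_mono) (use mp t in auto)
    moreover have "same_trace_on \<Omega> \<Gamma>1 (m t) n0"
      unfolding same_trace_on_def using has_trace_on_AE_cong[OF o b vp(1,4) aep[OF t]] w(2) by blast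
    ultimately show ?thesis by (simp add: admissible_def sobolev_into_def)
  qed

  \<comment> \<open>Closeness to \<open>n\<close>: both norms are at most a constant times \<open>\<bar>t\<bar>\<close>.\<close>
  obtain K where K: "0 \<le> K" "\<And>y z. norm (Q y - Q z) \<le> K * norm (y - z)"
      "\<And>y (A :: real^'d^'k). norm (jacobi_matrix Q y ** A) \<le> K * norm A"
      "\<And>y z (A :: real^'d^'k). norm ((jacobi_matrix Q y - jacobi_matrix Q z) ** A) \<le> K * norm (y - z) * norm A"
    by (rule C2_compact_support_jacobi_matrix_bounds[OF Q2 Q(6,7)]) (assumption, rule that)
  have small: "sobolev_norm \<Omega> \<infinity> (\<lambda>x. n x - m t x) \<le> ennreal (\<bar>t\<bar> * (K * R + (K * R * R + K * R)))"
    if t: "\<bar>t\<bar> < \<delta>" for t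
  proof -
    have d0: "norm (n x - m t x) \<le> \<bar>t\<bar> * (K * R)" if x: "x \<in> X" for x
    proof -
      have "norm (n x - m t x) \<le> K * norm (n x - (n x + t *\<^sub>R v x))"
        using K(2)[of "n x" "n x + t *\<^sub>R v x"] QM[OF Xb(5)[OF x]] mp(1)[OF x t] by (simp add: p_def)
      also have "\<dots> \<le> K * (\<bar>t\<bar> * R)" using Xb(2)[OF x] K(1) by (auto intro!: mult_left_mono)
      finally show ?thesis by (simp add: mult_ac)
    qed
    have d1: "norm (H x 0 - H x t) \<le> \<bar>t\<bar> * (K * R * R + K * R)" if x: "x \<in> X" for x
    proof -
      let ?y = "n x + t *\<^sub>R v x"
      have eq: "H x 0 - H x t = (jacobi_matrix Q (n x) - jacobi_matrix Q ?y) ** G x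
          - jacobi_matrix Q ?y ** (t *\<^sub>R jacobi_matrix v x)"
        unfolding H_def by (simp add: vec_eq_iff matrix_matrix_mult_def sum_subtractf sum.distrib algebra_simps)
      have "norm (H x 0 - H x t) \<le> K * norm (n x - ?y) * norm (G x) + K * norm (t *\<^sub>R jacobi_matrix v x)"
        unfolding eq using norm_triangle_ineq4[of "(jacobi_matrix Q (n x) - jacobi_matrix Q ?y) ** G x" "jacobi_matrix Q ?y ** (t *\<^sub>R jacobi_matrix v x)"]
          K(3)[of ?y "t *\<^sub>R jacobi_matrix v x"] K(4)[of "n x" ?y "G x"] by linarith
      also have "\<dots> \<le> K * (\<bar>t\<bar> * R) * R + K * (\<bar>t\<bar> * R)"
        using Xb(2-4)[OF x] K(1) R(1) by (intro add_mono mult_mono) (auto intro!: mult_left_mono)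
      finally show ?thesis by (simp add: algebra_simps)
    qed
    have wg: "AE x in lebesgue_on \<Omega>. weak_gradient \<Omega> (\<lambda>x. n x - m t x) x = G x - H x t"
      by (rule weak_gradient_AE_eq[OF o has_weak_gradient_diff[OF o G mwg[OF t]]])
    have wgm: "weak_gradient \<Omega> (\<lambda>x. n x - m t x) \<in> borel_measurable (lebesgue_on \<Omega>)"
      by (rule borel_measurable_lebesgue_on_AE_cong[OF \<Omega>L _ wg])
        (intro borel_measurable_diff Gm borel_measurable_integrable[OF vp(3)])
    have "Lp_norm (lebesgue_on \<Omega>) \<infinity> (\<lambda>x. n x - m t x) \<le> ennreal (\<bar>t\<bar> * (K * R))"
    proof (rule Lp_norm_infinity_le)
      show "AE x in lebesgue_on \<Omega>. norm (n x - m t x) \<le> \<bar>t\<bar> * (K * R)"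
        using X by (rule eventually_mono) (rule d0)
    qed (intro borel_measurable_diff nm mm t)
    moreover have "Lp_norm (lebesgue_on \<Omega>) \<infinity> (weak_gradient \<Omega> (\<lambda>x. n x - m t x)) \<le> ennreal (\<bar>t\<bar> * (K * R * R + K * R))"
    proof (rule Lp_norm_infinity_le[OF wgm])
      show "AE x in lebesgue_on \<Omega>. norm (weak_gradient \<Omega> (\<lambda>x. n x - m t x) x) \<le> \<bar>t\<bar> * (K * R * R + K * R)"
        using X wg Gn by eventually_elim (simp add: d1)
    qed
    ultimately have "sobolev_norm \<Omega> \<infinity> (\<lambda>x. n x - m t x)
        \<le> ennreal (\<bar>t\<bar> * (K * R)) + ennreal (\<bar>t\<bar> * (K * R * R + K * R))"
      unfolding sobolev_norm_def by (rule add_mono)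
    also have "\<dots> = ennreal (\<bar>t\<bar> * (K * R + (K * R * R + K * R)))"
      using K(1) R(1) by (subst ennreal_plus[symmetric]) (simp_all add: distrib_left)
    finally show ?thesis .
  qed

  define g where "g t = energy \<Omega> F (\<lambda>x. P (n x + t *\<^sub>R v x))" for t
  have gm: "g t = energy \<Omega> F (m t)" for t by (simp add: g_def m_def[abs_def])
  have gint: "g t = (\<integral>x. F x (p x t) (H x t) \<partial>lebesgue_on \<Omega>)"
    and gmeas: "(\<lambda>x. F x (p x t) (H x t)) \<in> borel_measurable (lebesgue_on \<Omega>)" if t: "\<bar>t\<bar> < \<delta>" for t
  proof -
    have "AE x in lebesgue_on \<Omega>. m t x = p x t" using aep[OF t] by (rule eventually_mono) simp
    note E = energy_eq_integral[OF o assms(9) F borel_measurable_integrable[OF vp(2)]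
        borel_measurable_integrable[OF vp(3)] pM[OF t] mwg[OF t] this]
    show "g t = (\<integral>x. F x (p x t) (H x t) \<partial>lebesgue_on \<Omega>)" unfolding gm by (rule E(1)) simp
    show "(\<lambda>x. F x (p x t) (H x t)) \<in> borel_measurable (lebesgue_on \<Omega>)" by (rule E(2)) simp
  qed
  have g0: "g 0 = energy \<Omega> F n"
  proof -
    have "AE x in lebesgue_on \<Omega>. n x = p x 0" using Qn by (rule eventually_mono) (simp add: p_def)
    from energy_eq_integral(1)[OF o assms(9) F borel_measurable_integrable[OF vp(2)]
        borel_measurable_integrable[OF vp(3)] pM G this Gn]
    show ?thesis using gint[of 0] \<delta> by simp
  qed

  obtain \<epsilon> where \<epsilon>: "0 < \<epsilon>" "\<And>k. k \<in> admissible \<Omega> \<Gamma>1 M n0 \<Longrightarrow>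
      sobolev_norm \<Omega> \<infinity> (\<lambda>x. n x - k x) < ennreal \<epsilon> \<Longrightarrow> energy \<Omega> F n \<le> energy \<Omega> F k"
    using wlm unfolding weak_local_minimizer_def by blast
  define L where "L = K * R + (K * R * R + K * R)"
  have L: "0 \<le> L" using K(1) R(1) by (simp add: L_def)
  define \<eta> where "\<eta> = min \<delta> (\<epsilon> / (L + 1))"
  have \<eta>: "0 < \<eta>" using \<delta> \<epsilon>(1) L by (simp add: \<eta>_def)
  have gmin: "g 0 \<le> g t" if t: "\<bar>t\<bar> < \<eta>" for t
  proof -
    have t\<delta>: "\<bar>t\<bar> < \<delta>" using t by (simp add: \<eta>_def)
    have "\<bar>t\<bar> * L \<le> \<bar>t\<bar> * (L + 1)" by (simp add: mult_left_mono)
    also have "\<dots> < \<epsilon>" using t L by (simp add: \<eta>_def pos_less_divide_eq)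
    finally have "ennreal (\<bar>t\<bar> * L) < ennreal \<epsilon>" using \<epsilon>(1) by (simp add: ennreal_lessI)
    then have "sobolev_norm \<Omega> \<infinity> (\<lambda>x. n x - m t x) < ennreal \<epsilon>"
      using small[OF t\<delta>] unfolding L_def by (rule le_less_trans[rotated])
    then show ?thesis unfolding g0 gm[of t] by (rule \<epsilon>(2)[OF adm[OF t\<delta>]])
  qed

  have 1: "deriv g 0 = 0" if "g differentiable (at 0)"
  proof (rule DERIV_local_min[OF _ \<eta>])
    show "(g has_real_derivative deriv g 0) (at 0)"
      using that by (simp add: DERIV_deriv_iff_real_differentiable)
    show "\<forall>y. \<bar>0 - y\<bar> < \<eta> \<longrightarrow> g 0 \<le> g y" using gmin by simp
  qed
  have 2: "0 \<le> deriv (deriv g) 0"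
    if "\<forall>\<^sub>F t in nhds 0. g differentiable (at t)" "deriv g differentiable (at 0)"
    by (rule local_min_imp_second_derivative_nonneg[OF \<eta> gmin that])
  have 3: "g differentiable (at 0)" "\<forall>\<^sub>F t in nhds 0. g differentiable (at t)" "deriv g differentiable (at 0)"
    if lb: "locally_bounded_derivatives \<Omega> M F"
  proof -
    have z: "C2_family X {-\<delta><..<\<delta>} (\<lambda>x t. (p x t, H x t))"
      unfolding p_def H_def
      by (rule C2_family_chain_rule_curve[OF Q(1,6,7), where R=R and D=\<delta>]) (use Xb(1-4) in auto)
    have f: "C2_family X {-\<delta><..<\<delta>} (\<lambda>x t. F x (p x t) (H x t))"
    proof (rule C2_family_integrand[OF b M N F F2 lb _ _ z])
      show "X \<subseteq> \<Omega>" by (auto simp: X_def)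
      show "p x t \<in> M" if "x \<in> X" "t \<in> {-\<delta><..<\<delta>}" for x t using mp(2)[of x t] that by auto
    qed auto
    show "g differentiable (at 0)" "\<forall>\<^sub>F t in nhds 0. g differentiable (at t)" "deriv g differentiable (at 0)"
      by (rule C2_family_integral_twice_differentiable[OF \<Omega>lm \<delta> f X gmeas gint]; assumption)+
  qed
  show "let g = (\<lambda>t::real. energy \<Omega> F (\<lambda>x. P (n x + t *\<^sub>R v x)));
        diff1 = g differentiable (at 0);
        diff2 = ((\<forall>\<^sub>F t in nhds 0. g differentiable (at t)) \<and> deriv g differentiable (at 0))
    in (diff1 \<longrightarrow> deriv g 0 = 0) \<and> (diff2 \<longrightarrow> deriv (deriv g) 0 \<ge> 0) \<and>
       (locally_bounded_derivatives \<Omega> M F \<longrightarrow> diff1 \<and> diff2)"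
    unfolding Let_def g_def[abs_def, symmetric] using 1 2 3 by blast
qed

end
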